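(* Let $a,b,c,d\in\mathbb{Z}$ be distinct integers, and let $T_{a,b,c,d}:(\mathbb{P}^2_{\mathbb{C}})^{\mathbb{Z}}\dashrightarrow(\mathbb{P}^2_{\mathbb{C}})^{\mathbb{Z}}$ be the skew pentagram map with parameters $(a,b,c,d)$ over $\mathbb{C}$. (1) If $T_{a,b,c,d}$ is equal-length (that is, $|b-a|=|d-c|$), then its dynamical degree satisfies $\lambda_1(T_{a,b,c,d})=1$. (2) There are infinitely many truly skew pentagram maps $T_{a,b,c,d}$ (that is, with $|b-a|\neq|d-c|$) such that $\lambda_1(T_{a,b,c,d})=4$.
   Context: Let $k$ be an algebraically closed field (here $k=\mathbb{C}$) and let $\operatorname{Ind}$ denote the indeterminacy locus of a rational map. A local rule on $(\mathbb{P}^N)^{\mathbb{Z}}$ is a finite nonempty set $S\subset\mathbb{Z}$ (a neighborhood) with a rational map $\varphi:(\mathbb{P}^N)^S\dashrightarrow\mathbb{P}^N$. The associated lattice map is the partially defined map $T_\varphi:(\mathbb{P}^N)^{\mathbb{Z}}\dashrightarrow(\mathbb{P}^N)^{\mathbb{Z}}$, $(v_i)_{i}\mapsto(\varphi(v_{i+s}:s\in S))_{i}$. For finite nonempty $A\subset\mathbb{Z}$, the regional map $\varphi_A:(\mathbb{P}^N)^{A+S}\dashrightarrow(\mathbb{P}^N)^A$ is $v\mapsto(\varphi(v_{i+s}:s\in S))_{i\in A}$, where $A+S$ is the Minkowski sum. If $T,T'$ have local rules $(S,\varphi),(S',\varphi')$ and the image of $\varphi_{S'}$ is not contained in $\operatorname{Ind}\varphi'$,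 then $T'$ and $T$ are composable and $T'\circ T$ is the lattice map with local rule $\varphi'\circ\varphi_{S'}$ on $S+S'$. Iterates are $T^0=\mathrm{Id}$, $T^m=T\circ T^{m-1}$; $T$ is iterable if all iterates exist. The degree $\deg T$ of a lattice map is the total degree of the multihomogeneous polynomials giving a local rule $\varphi$ of $T$ when written without common factors (this does not depend on the local rule chosen). The dynamical degree of an iterable lattice map is $\lambda_1(T)=\lim_{m\to\infty}(\deg T^m)^{1/m}$ (the limit exists by submultiplicativity). For distinct $a,b,c,d\in\mathbb{Z}$, the skew pentagram map $T_{a,b,c,d}:(\mathbb{P}^2)^{\mathbb{Z}}\dashrightarrow(\mathbb{P}^2)^{\mathbb{Z}}$ is the lattice map with $S=\{a,b,c,d\}$ sending $(v_i)$ to $(v_i')$ with $v_i'=\overline{v_{i+a}v_{i+b}}\cap\overline{v_{i+c}v_{i+d}}$, where $\overline{pq}$ is the line through distinct points $p,q$. Skew pentagram maps are iterable. *)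

theory Defs
  imports "HOL-Analysis.Analysis" "HOL-Library.Poly_Mapping"
begin

section \<open>Projective space\<close>

text \<open>
  \<open>'n proj\<close> is the complex projective space of dimension \<open>CARD('n) - 1\<close>: its points are the
  one-dimensional linear subspaces of \<open>complex ^ 'n\<close>. In particular \<open>3 proj\<close> is the projective plane.
\<close>

typedef 'n proj = "{L :: (complex ^ 'n) set. vec.subspace L \<and> vec.dim L = 1}"
proof -
  define e :: "complex ^ 'n" where "e = axis undefined 1"
  have "e \<noteq> 0" by (simp add: e_def axis_eq_0_iff)
  then have "vec.independent {e}" by simp
  then have "vec.dim (vec.span {e}) = 1"
    using vec.dim_span_eq_card_independent[of "{e}"] by simp
  then show ?thesis by (intro exI[of _ "vec.span {e}"]) simp
qed

definition proj_point :: "complex ^ 'n \<Rightarrow> 'n proj" where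
  "proj_point w = Abs_proj (vec.span {w})"

text \<open>A choice of homogeneous coordinates; only used where the choice does not matter.\<close>

definition hcoords :: "'n proj \<Rightarrow> complex ^ 'n" where
  "hcoords p = (SOME w. w \<noteq> 0 \<and> w \<in> Rep_proj p)"


section \<open>Multihomogeneous polynomials\<close>

text \<open>
  Polynomials in the homogeneous coordinates \<open>(i, j)\<close>, where \<open>i\<close> is a site of the lattice and
  \<open>j\<close> is a coordinate index in the copy of projective space at that site.
\<close>

type_synonym 'n mpoly = "((int \<times> 'n) \<Rightarrow>\<^sub>0 nat) \<Rightarrow>\<^sub>0 complex"

definition mconst :: "complex \<Rightarrow> 'n mpoly" where
  "mconst c = Poly_Mapping.single 0 c"

definition mvar :: "int \<times> 'n \<Rightarrow> 'n mpoly" where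
  "mvar x = Poly_Mapping.single (Poly_Mapping.single x 1) 1"

definition mvars :: "'n mpoly \<Rightarrow> (int \<times> 'n) set" where
  "mvars p = (\<Union>m \<in> Poly_Mapping.keys p. Poly_Mapping.keys m)"

definition meval :: "(int \<times> 'n \<Rightarrow> complex) \<Rightarrow> 'n mpoly \<Rightarrow> complex" where
  "meval f p = (\<Sum>m \<in> Poly_Mapping.keys p.
     Poly_Mapping.lookup p m * (\<Prod>x \<in> Poly_Mapping.keys m. f x ^ Poly_Mapping.lookup m x))"

definition msubst :: "(int \<times> 'n \<Rightarrow> 'n mpoly) \<Rightarrow> 'n mpoly \<Rightarrow> 'n mpoly" where
  "msubst f p = (\<Sum>m \<in> Poly_Mapping.keys p.
     mconst (Poly_Mapping.lookup p m) * (\<Prod>x \<in> Poly_Mapping.keys m. f x ^ Poly_Mapping.lookup m x))"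

definition mshift :: "int \<Rightarrow> 'n mpoly \<Rightarrow> 'n mpoly" where
  "mshift i = msubst (\<lambda>(s, j). mvar (i + s, j))"

definition multihomogeneous :: "(int \<Rightarrow> nat) \<Rightarrow> ('n::finite) mpoly \<Rightarrow> bool" where
  "multihomogeneous \<delta> p \<longleftrightarrow>
     (\<forall>m \<in> Poly_Mapping.keys p. \<forall>i. (\<Sum>j\<in>UNIV. Poly_Mapping.lookup m (i, j)) = \<delta> i)"

definition mdegree :: "'n mpoly \<Rightarrow> nat" where
  "mdegree p = Max (insert 0
     ((\<lambda>m. \<Sum>x \<in> Poly_Mapping.keys m. Poly_Mapping.lookup m x) ` Poly_Mapping.keys p))"


section \<open>Rational maps and local rules\<close>

text \<open>
  A rational map from \<open>('n proj)\<^sup>S\<close> to \<open>'n proj\<close> is given by a tuple of multihomogeneous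
  polynomials of the same multidegree in the coordinates at the sites in \<open>S\<close>, not all zero. Two
  such tuples give the same rational map iff they are proportional. Every rational map has a tuple
  without common factors, unique up to a nonzero constant.
\<close>

type_synonym 'n tuple = "'n \<Rightarrow> 'n mpoly"

definition no_common_factor :: "'n tuple \<Rightarrow> bool" where
  "no_common_factor F \<longleftrightarrow> (\<forall>h. (\<forall>j. h dvd F j) \<longrightarrow> h dvd 1)"

definition proportional :: "'n tuple \<Rightarrow> 'n tuple \<Rightarrow> bool" where
  "proportional F G \<longleftrightarrow> (\<forall>j k. F j * G k = F k * G j)"

definition local_rule :: "int set \<Rightarrow> ('n::finite) tuple \<Rightarrow> bool" where
  "local_rule S F \<longleftrightarrow>
     finite S \<and> S \<noteq> {} \<and>
     (\<forall>j. mvars (F j) \<subseteq> S \<times> UNIV) \<and>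
     (\<exists>\<delta>. \<forall>j. multihomogeneous \<delta> (F j)) \<and>
     (\<exists>j. F j \<noteq> 0) \<and>
     no_common_factor F"

text \<open>
  Points of \<open>('n proj)\<^sup>S\<close> are given as configurations on all of the lattice, of which a local rule
  on \<open>S\<close> only sees the sites in \<open>S\<close>. Since the tuple of a local rule has no common factor, the
  indeterminacy locus is exactly its common zero locus.
\<close>

definition tuple_value :: "('n::finite) tuple \<Rightarrow> (int \<Rightarrow> 'n proj) \<Rightarrow> complex ^ 'n" where
  "tuple_value F v = (\<chi> j. meval (\<lambda>(s, k). hcoords (v s) $ k) (F j))"

definition indet :: "('n::finite) tuple \<Rightarrow> (int \<Rightarrow> 'n proj) set" where
  "indet F = {v. tuple_value F v = 0}"

definition rule_map :: "('n::finite) tuple \<Rightarrow> (int \<Rightarrow> 'n proj) \<Rightarrow> 'n proj" where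
  "rule_map F v = proj_point (tuple_value F v)"


section \<open>Lattice maps\<close>

type_synonym 'n pmap = "(int \<Rightarrow> 'n proj) \<rightharpoonup> (int \<Rightarrow> 'n proj)"

definition lattice_map :: "('n::finite) tuple \<Rightarrow> 'n pmap" where
  "lattice_map F v =
     (if \<forall>i. (\<lambda>s. v (i + s)) \<notin> indet F
      then Some (\<lambda>i. rule_map F (\<lambda>s. v (i + s)))
      else None)"

definition has_local_rule :: "('n::finite) pmap \<Rightarrow> int set \<Rightarrow> 'n tuple \<Rightarrow> bool" where
  "has_local_rule T S F \<longleftrightarrow> local_rule S F \<and> T = lattice_map F"

text \<open>
  \<open>rules_composable S' F' F\<close>: the image of the regional map of \<open>F\<close> on \<open>S'\<close> is not contained in the
  indeterminacy locus of \<open>F'\<close>. The values of the regional map at sites outside \<open>S'\<close> are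
  irrelevant, as \<open>F'\<close> only involves coordinates at sites in \<open>S'\<close>.
\<close>

definition rules_composable :: "int set \<Rightarrow> ('n::finite) tuple \<Rightarrow> 'n tuple \<Rightarrow> bool" where
  "rules_composable S' F' F \<longleftrightarrow>
     (\<exists>v. (\<forall>i\<in>S'. (\<lambda>s. v (i + s)) \<notin> indet F) \<and>
          (\<lambda>i. rule_map F (\<lambda>s. v (i + s))) \<notin> indet F')"

text \<open>
  \<open>rule_subst F' F\<close> represents the composition of \<open>F'\<close> with the regional map of \<open>F\<close>; common
  factors may appear.
\<close>

definition rule_subst :: "'n tuple \<Rightarrow> 'n tuple \<Rightarrow> 'n tuple" where
  "rule_subst F' F = (\<lambda>j. msubst (\<lambda>(i, k). mshift i (F k)) (F' j))"

text \<open>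
  \<open>is_comp T' T U\<close>: the lattice maps \<open>T'\<close> and \<open>T\<close> are composable, with composition \<open>U\<close>. By the
  last conjuncts, \<open>H\<close> is the tuple without common factors of the composed local rule.
\<close>

definition is_comp :: "('n::finite) pmap \<Rightarrow> 'n pmap \<Rightarrow> 'n pmap \<Rightarrow> bool" where
  "is_comp T' T U \<longleftrightarrow>
     (\<exists>S F S' F' H.
        has_local_rule T S F \<and> has_local_rule T' S' F' \<and> rules_composable S' F' F \<and>
        has_local_rule U {s + s' | s s'. s \<in> S \<and> s' \<in> S'} H \<and>
        proportional H (rule_subst F' F))"

text \<open>\<open>is_iterate T m U\<close>: the iterate \<open>T\<^sup>m\<close> exists and equals \<open>U\<close>. Here \<open>Some\<close> is the identity map.\<close>

inductive is_iterate :: "('n::finite) pmap \<Rightarrow> nat \<Rightarrow> 'n pmap \<Rightarrow> bool" for T where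
  zero: "is_iterate T 0 Some"
| Suc: "is_iterate T m U \<Longrightarrow> is_comp T U V \<Longrightarrow> is_iterate T (Suc m) V"

definition iterable :: "('n::finite) pmap \<Rightarrow> bool" where
  "iterable T \<longleftrightarrow> (\<forall>m. \<exists>U. is_iterate T m U)"

text \<open>The nonzero entries of the tuple of a local rule all have the same total degree.\<close>

definition has_degree :: "('n::finite) pmap \<Rightarrow> nat \<Rightarrow> bool" where
  "has_degree T d \<longleftrightarrow> (\<exists>S F j. has_local_rule T S F \<and> F j \<noteq> 0 \<and> d = mdegree (F j))"

text \<open>
  Iterates and degrees do not depend on the local rules chosen, so the sequence \<open>d\<close> is uniquely
  determined.
\<close>

definition has_dynamical_degree :: "('n::finite) pmap \<Rightarrow> real \<Rightarrow> bool" where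
  "has_dynamical_degree T l \<longleftrightarrow>
     iterable T \<and>
     (\<exists>d. (\<forall>m. \<exists>U. is_iterate T m U \<and> has_degree U (d m)) \<and>
          (\<lambda>m. root m (real (d m))) \<longlonglongrightarrow> l)"


section \<open>Skew pentagram maps\<close>

text \<open>The line through two distinct points of the projective plane, as a set of points.\<close>

definition line :: "3 proj \<Rightarrow> 3 proj \<Rightarrow> 3 proj set" where
  "line p q = {r. Rep_proj r \<subseteq> vec.span (Rep_proj p \<union> Rep_proj q)}"

text \<open>
  The map is defined at the configurations for which, at every site, both lines exist and are
  distinct, so that they meet in a single point.
\<close>

definition skew_pentagram :: "int \<Rightarrow> int \<Rightarrow> int \<Rightarrow> int \<Rightarrow> 3 pmap" where
  "skew_pentagram a b c d v =
     (if \<forall>i. v (i + a) \<noteq> v (i + b) \<and> v (i + c) \<noteq> v (i + d) \<and>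
             line (v (i + a)) (v (i + b)) \<noteq> line (v (i + c)) (v (i + d))
      then Some (\<lambda>i. THE p. p \<in> line (v (i + a)) (v (i + b)) \<inter> line (v (i + c)) (v (i + d)))
      else None)"

end

theory Submission
  imports Defs "HOL-Computational_Algebra.Polynomial"
    "HOL-Computational_Algebra.Fundamental_Theorem_Algebra" "Jordan_Normal_Form.Determinant"
begin

text \<open>
  In homogeneous coordinates a skew pentagram map is given by the quadrilinear expression
  \<open>(v\<^sub>a \<times> v\<^sub>b) \<times> (v\<^sub>c \<times> v\<^sub>d)\<close>, so that substituting it into itself gives tuples of degree \<open>4 ^ m\<close>
  (\<open>generic_iterate\<close>), and the degree of an iterate is smaller only if the components of this tuple have a
  common factor. Four points on a smooth plane cubic with \<open>v\<^sub>a + v\<^sub>b = v\<^sub>c + v\<^sub>d\<close> in the group law span two lines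
  that meet in the third point \<open>- (v\<^sub>a + v\<^sub>b)\<close> of the cubic. Hence configurations \<open>v\<^sub>i = P + Q\<^sub>i\<close>, with a
  variable point \<open>P\<close> and fixed 3-torsion points \<open>Q\<^sub>i\<close> that satisfy \<open>Q\<^bsub>i+a\<^esub> + Q\<^bsub>i+b\<^esub> = Q\<^bsub>i+c\<^esub> + Q\<^bsub>i+d\<^esub>\<close>, are mapped
  to configurations of the same kind, with \<open>P\<close> replaced by \<open>- 2 P\<close>. Identify the 3-torsion with the field
  with nine elements, let \<open>\<theta>\<^sup>2 = \<theta> + 1\<close>, and put \<open>Q\<^sub>i = \<theta>\<^sup>i\<close>. Since \<open>1 + \<theta>\<^sup>2 = \<theta> + \<theta>\<^sup>4\<close> and \<open>\<theta>\<close> has order 8, the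
  condition holds for \<open>(0, 2, 1, d)\<close> whenever \<open>d\<close> is 4 modulo 8. For the cubics of the Hesse pencil,
  translation by 3-torsion points is linear, and \<open>P \<mapsto> - 2 P\<close> is a map of the plane of degree 4 whose
  only base points are the twelve vertices of the four triangles in the pencil. Points that are not
  vertices are not mapped to vertices. So on a line that avoids the vertices the tuple of degree
  \<open>4 ^ m\<close> has no zero at all, whereas a nonconstant common factor would have one
  (\<open>no_common_factor_if_nonvanishing_on_line\<close>, \<open>no_common_factor_generic_iterate\<close>).

  For equal lengths, say \<open>b - a = d - c = L\<close>, let \<open>k = c - a\<close>. The sites \<open>p L + q k\<close> form
  a planar net, and the map replaces each quadrilateral by the intersection of its two opposite sides
  in the direction of \<open>p\<close>: this is the classical Laplace transform of nets. It is linear in the solutions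
  of the four-term relations between the corners of the quadrilaterals, and its \<open>m\<close>-th iterate
  combines the points of the bottom row of an \<open>m \<times> m\<close> block of quadrilaterals, and at the same time the
  points of the top row. Up to a factor it is the only combination with this property
  (\<open>combination_is_iterated_laplace\<close>). To find it means to solve \<open>m\<^sup>2 - 1\<close> linear equations in \<open>m\<^sup>2\<close>
  unknowns whose coefficients have degree 3, so by Cramer's rule (\<open>small_kernel_vector\<close>) there is a
  tuple of degree at most \<open>3 m\<^sup>2 + 1\<close> that is proportional to the iterate
  (\<open>small_tuple_parallel_to_iterate\<close>). A tuple of least degree among the proportional ones has no
  common factor (\<open>minimal_representation_reduced\<close>), hence the degree of the \<open>m\<close>-th iterate is at most
  quadratic in \<open>m\<close>. The other case of equal lengths, \<open>b - a = c - d\<close>, exchanges \<open>c\<close> and \<open>d\<close>.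
\<close>

section \<open>Evaluation homomorphisms\<close>

definition monom_value :: "(int \<times> 'n \<Rightarrow> 'r::comm_ring_1) \<Rightarrow> ((int \<times> 'n) \<Rightarrow>\<^sub>0 nat) \<Rightarrow> 'r" where
  "monom_value f m = (\<Prod>x \<in> Poly_Mapping.keys m. f x ^ Poly_Mapping.lookup m x)"

text \<open>
  Evaluation at complex numbers, substitution of polynomials, restriction to a parametrized line and
  Kronecker substitution are instances of one homomorphism, for different scalar maps \<open>\<phi>\<close>.
\<close>

definition phom :: "(complex \<Rightarrow> 'r::comm_ring_1) \<Rightarrow> (int \<times> 'n \<Rightarrow> 'r) \<Rightarrow> 'n mpoly \<Rightarrow> 'r" where
  "phom \<phi> f p = (\<Sum>m \<in> Poly_Mapping.keys p. \<phi> (Poly_Mapping.lookup p m) * monom_value f m)"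

lemma meval_eq_phom: "meval f = phom (\<lambda>c. c) f"
  by (simp add: fun_eq_iff meval_def phom_def monom_value_def)

lemma msubst_eq_phom: "msubst f = phom mconst f"
  by (simp add: fun_eq_iff msubst_def phom_def monom_value_def)

lemma monom_value_superset:
  assumes "finite A" "Poly_Mapping.keys m \<subseteq> A"
  shows "monom_value f m = (\<Prod>x \<in> A. f x ^ Poly_Mapping.lookup m x)"
  unfolding monom_value_def
  by (rule prod.mono_neutral_left) (use assms in \<open>auto simp: in_keys_iff\<close>)

lemma monom_value_zero [simp]: "monom_value f 0 = 1"
  by (simp add: monom_value_def)

lemma monom_value_single [simp]: "monom_value f (Poly_Mapping.single x n) = f x ^ n"
  by (simp add: monom_value_def)

lemma monom_value_add: "monom_value f (m + m') = monom_value f m * monom_value f m'"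
proof -
  let ?A = "Poly_Mapping.keys m \<union> Poly_Mapping.keys m'"
  have "monom_value f (m + m') = (\<Prod>x \<in> ?A. f x ^ Poly_Mapping.lookup (m + m') x)"
    by (rule monom_value_superset) (simp_all add: keys_add)
  also have "\<dots> = monom_value f m * monom_value f m'"
    by (simp add: monom_value_superset[of ?A] lookup_add power_add prod.distrib)
  finally show ?thesis .
qed

lemma mpoly_induct [case_names single plus]:
  assumes "\<And>m c. P (Poly_Mapping.single m c)" "\<And>p q. P p \<Longrightarrow> P q \<Longrightarrow> P (p + q)"
  shows "P (p :: 'a \<Rightarrow>\<^sub>0 'b::comm_monoid_add)"
proof (induction p rule: update_induct)
  case const
  show ?case using assms(1)[of undefined 0] by simp
next
  case (update f a b)
  have "Poly_Mapping.update a b f = f + Poly_Mapping.single a b"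
    by (rule poly_mapping_eqI)
      (use update in \<open>auto simp: lookup_update lookup_add lookup_single when_def in_keys_iff\<close>)
  then show ?case using assms update by simp
qed

locale scalar_hom =
  fixes \<phi> :: "complex \<Rightarrow> 'r::comm_ring_1"
  assumes hom_add: "\<phi> (x + y) = \<phi> x + \<phi> y"
    and hom_mult: "\<phi> (x * y) = \<phi> x * \<phi> y"
    and hom_one: "\<phi> 1 = 1"
begin

lemma hom_zero: "\<phi> 0 = 0"
  using hom_add[of 0 0] by simp

lemma phom_superset:
  assumes "finite M" "Poly_Mapping.keys p \<subseteq> M"
  shows "phom \<phi> f p = (\<Sum>m \<in> M. \<phi> (Poly_Mapping.lookup p m) * monom_value f m)"
  unfolding phom_def
  by (rule sum.mono_neutral_left) (use assms in \<open>auto simp: in_keys_iff hom_zero\<close>)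

lemma phom_zero [simp]: "phom \<phi> f 0 = 0"
  by (simp add: phom_def)

lemma phom_single: "phom \<phi> f (Poly_Mapping.single m c) = \<phi> c * monom_value f m"
  by (simp add: phom_def hom_zero)

lemma phom_add: "phom \<phi> f (p + q) = phom \<phi> f p + phom \<phi> f q"
proof -
  let ?A = "Poly_Mapping.keys p \<union> Poly_Mapping.keys q"
  have "phom \<phi> f (p + q) = (\<Sum>m \<in> ?A. \<phi> (Poly_Mapping.lookup (p + q) m) * monom_value f m)"
    by (rule phom_superset) (simp_all add: keys_add)
  also have "\<dots> = phom \<phi> f p + phom \<phi> f q"
    by (simp add: phom_superset[of ?A] lookup_add hom_add distrib_right sum.distrib)
  finally show ?thesis .
qed

lemma phom_mult: "phom \<phi> f (p * q) = phom \<phi> f p * phom \<phi> f q"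
proof (induction p rule: mpoly_induct)
  case (single m c)
  show ?case
  proof (induction q rule: mpoly_induct)
    case (single m' c')
    show ?case
      by (simp add: mult_single phom_single hom_mult monom_value_add mult_ac)
  next
    case (plus p q)
    then show ?case by (simp add: distrib_left phom_add)
  qed
next
  case (plus p q)
  then show ?case by (simp add: distrib_right phom_add)
qed

lemma phom_one [simp]: "phom \<phi> f 1 = 1"
  using phom_single[of f 0 1] by (simp add: hom_one)

lemma phom_uminus: "phom \<phi> f (- p) = - phom \<phi> f p"
  using phom_add[of f p "- p"] by (simp add: eq_neg_iff_add_eq_0 add.commute)

lemma phom_diff: "phom \<phi> f (p - q) = phom \<phi> f p - phom \<phi> f q"
  using phom_add[of f p "- q"] by (simp add: phom_uminus)

lemma phom_sum: "phom \<phi> f (sum g A) = (\<Sum>x\<in>A. phom \<phi> f (g x))"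
  by (induction A rule: infinite_finite_induct) (simp_all add: phom_add)

lemma phom_prod: "phom \<phi> f (prod g A) = (\<Prod>x\<in>A. phom \<phi> f (g x))"
  by (induction A rule: infinite_finite_induct) (simp_all add: phom_mult)

lemma phom_power: "phom \<phi> f (p ^ n) = phom \<phi> f p ^ n"
  by (induction n) (simp_all add: phom_mult)

lemma phom_mvar [simp]: "phom \<phi> f (mvar x) = f x"
  by (simp add: mvar_def phom_single hom_one)

lemma phom_mconst [simp]: "phom \<phi> f (mconst c) = \<phi> c"
  by (simp add: mconst_def phom_single)

lemma phom_msubst: "phom \<phi> f (msubst g p) = phom \<phi> (\<lambda>x. phom \<phi> f (g x)) p"
  unfolding msubst_def phom_sum phom_mult phom_prod phom_power phom_mconst
  by (simp add: phom_def monom_value_def)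

end

interpretation meval: scalar_hom "\<lambda>c. c"
  rewrites "phom (\<lambda>c. c) = meval"
  by unfold_locales (simp_all add: meval_eq_phom fun_eq_iff)

interpretation mconst: scalar_hom "mconst :: complex \<Rightarrow> 'n mpoly"
  by unfold_locales (simp_all add: mconst_def single_add mult_single)

lemma msubst_hom:
  "msubst f (p + q) = msubst f p + msubst f q"
  "msubst f (p - q) = msubst f p - msubst f q"
  "msubst f (p * q) = msubst f p * msubst f q"
  "msubst f (Poly_Mapping.single m c) = mconst c * monom_value f m"
  "msubst f 0 = 0"
  "msubst f (mvar x) = f x"
  by (simp_all add: msubst_eq_phom mconst.phom_add mconst.phom_diff mconst.phom_mult
      mconst.phom_single)

lemma msubst_msubst: "msubst f (msubst g p) = msubst (\<lambda>x. msubst f (g x)) p"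
  using mconst.phom_msubst[of f g p] by (simp add: msubst_eq_phom)

interpretation peval: scalar_hom "\<lambda>c. [:c:] :: complex poly"
  by unfold_locales simp_all

lemma meval_mshift: "meval f (mshift i p) = meval (\<lambda>(s, j). f (i + s, j)) p"
  unfolding mshift_def meval.phom_msubst by (simp add: case_prod_unfold)

lemma poly_peval: "poly (phom (\<lambda>c. [:c:]) f p) t = meval (\<lambda>x. poly (f x) t) p"
  by (simp add: phom_def meval_eq_phom poly_sum monom_value_def poly_prod)

section \<open>Kronecker substitution\<close>

definition weight :: "(int \<times> 'n \<Rightarrow> nat) \<Rightarrow> ((int \<times> 'n) \<Rightarrow>\<^sub>0 nat) \<Rightarrow> nat" where
  "weight w m = (\<Sum>x \<in> Poly_Mapping.keys m. w x * Poly_Mapping.lookup m x)"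

lemma weight_superset:
  assumes "finite A" "Poly_Mapping.keys m \<subseteq> A"
  shows "weight w m = (\<Sum>x \<in> A. w x * Poly_Mapping.lookup m x)"
  unfolding weight_def
  by (rule sum.mono_neutral_left) (use assms in \<open>auto simp: in_keys_iff\<close>)

lemma weight_zero [simp]: "weight w 0 = 0"
  by (simp add: weight_def)

lemma weight_single [simp]: "weight w (Poly_Mapping.single x n) = w x * n"
  by (simp add: weight_def)

lemma weight_add: "weight w (m + m') = weight w m + weight w m'"
proof -
  let ?A = "Poly_Mapping.keys m \<union> Poly_Mapping.keys m'"
  have "weight w (m + m') = (\<Sum>x \<in> ?A. w x * Poly_Mapping.lookup (m + m') x)"
    by (rule weight_superset) (simp_all add: keys_add)
  also have "\<dots> = weight w m + weight w m'"
    by (simp add: weight_superset[of ?A] lookup_add sum.distrib distrib_left)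
  finally show ?thesis .
qed

text \<open>
  Positional notation: give the new variable a weight larger than all values that the weights of the
  other variables take on \<open>M\<close>.
\<close>

lemma separating_weight_on:
  fixes M :: "((int \<times> 'n) \<Rightarrow>\<^sub>0 nat) set"
  assumes "finite X" "finite M"
  shows "\<exists>w :: int \<times> 'n \<Rightarrow> nat. \<forall>m\<in>M. \<forall>m'\<in>M.
     (\<Sum>x\<in>X. w x * Poly_Mapping.lookup m x) = (\<Sum>x\<in>X. w x * Poly_Mapping.lookup m' x) \<longrightarrow>
     (\<forall>x\<in>X. Poly_Mapping.lookup m x = Poly_Mapping.lookup m' x)"
  using assms(1)
proof (induction X rule: finite_induct)
  case empty
  then show ?case by simp
next
  case (insert y X)
  then obtain w where w: "\<And>m m'. m \<in> M \<Longrightarrow> m' \<in> M \<Longrightarrow>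
     (\<Sum>x\<in>X. w x * Poly_Mapping.lookup m x) = (\<Sum>x\<in>X. w x * Poly_Mapping.lookup m' x) \<Longrightarrow>
     \<forall>x\<in>X. Poly_Mapping.lookup m x = Poly_Mapping.lookup m' x"
    by blast
  define s where "s m = (\<Sum>x\<in>X. w x * Poly_Mapping.lookup m x)" for m :: "(int \<times> 'n) \<Rightarrow>\<^sub>0 nat"
  define B where "B = Suc (Max (insert 0 (s ` M)))"
  have sB: "s m < B" if "m \<in> M" for m
    using that assms(2) unfolding B_def by (simp add: less_Suc_eq_le)
  define w' where "w' = w(y := B)"
  have w': "(\<Sum>x\<in>insert y X. w' x * Poly_Mapping.lookup m x) = B * Poly_Mapping.lookup m y + s m" for m
  proof -
    have "(\<Sum>x\<in>X. w' x * Poly_Mapping.lookup m x) = s m"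
      unfolding s_def by (rule sum.cong) (use insert.hyps in \<open>auto simp: w'_def\<close>)
    then show ?thesis using insert.hyps by (simp add: w'_def)
  qed
  have "\<forall>x\<in>insert y X. Poly_Mapping.lookup m x = Poly_Mapping.lookup m' x"
    if "m \<in> M" "m' \<in> M" and eq: "B * Poly_Mapping.lookup m y + s m = B * Poly_Mapping.lookup m' y + s m'"
    for m m'
  proof -
    have "s m < B" "s m' < B" using sB that(1,2) by auto
    then have "s m = (B * Poly_Mapping.lookup m y + s m) mod B" "s m' = (B * Poly_Mapping.lookup m' y + s m') mod B"
      by simp_all
    then have s: "s m = s m'" using eq by metis
    have "B > 0" by (simp add: B_def)
    with eq s have "Poly_Mapping.lookup m y = Poly_Mapping.lookup m' y" by simp
    with w[OF that(1,2)] s show ?thesis by (simp add: s_def)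
  qed
  then show ?case unfolding w'[symmetric] by blast
qed

lemma separating_weight:
  fixes M :: "((int \<times> 'n) \<Rightarrow>\<^sub>0 nat) set"
  assumes "finite M"
  obtains w :: "int \<times> 'n \<Rightarrow> nat" where "inj_on (weight w) M"
proof -
  define X where "X = (\<Union>m\<in>M. Poly_Mapping.keys m)"
  have X: "finite X" using assms by (simp add: X_def)
  obtain w :: "int \<times> 'n \<Rightarrow> nat" where w: "\<forall>m\<in>M. \<forall>m'\<in>M.
     (\<Sum>x\<in>X. w x * Poly_Mapping.lookup m x) = (\<Sum>x\<in>X. w x * Poly_Mapping.lookup m' x) \<longrightarrow>
     (\<forall>x\<in>X. Poly_Mapping.lookup m x = Poly_Mapping.lookup m' x)"
    using separating_weight_on[OF X assms] by blast
  have "inj_on (weight w) M"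
  proof (rule inj_onI)
    fix m m' assume m: "m \<in> M" "m' \<in> M" "weight w m = weight w m'"
    then have sub: "Poly_Mapping.keys m \<subseteq> X" "Poly_Mapping.keys m' \<subseteq> X" by (auto simp: X_def)
    have "\<forall>x\<in>X. Poly_Mapping.lookup m x = Poly_Mapping.lookup m' x"
      using w[rule_format, OF m(1,2)] m(3)
      unfolding weight_superset[OF X sub(1)] weight_superset[OF X sub(2)] by blast
    moreover have "Poly_Mapping.lookup m x = 0 \<and> Poly_Mapping.lookup m' x = 0" if "x \<notin> X" for x
      using sub that by (metis in_keys_iff subsetD)
    ultimately show "m = m'"
      by (intro poly_mapping_eqI) metis
  qed
  then show ?thesis by (rule that)
qed

lemma monom_value_monom:
  "monom_value (\<lambda>x. monom (monom (1::complex) (w x)) (v x)) m = monom (monom 1 (weight w m)) (weight v m)"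
proof -
  have "(\<Prod>x\<in>A. monom (monom (1::complex) (w x)) (v x) ^ Poly_Mapping.lookup m x) =
      monom (monom 1 (\<Sum>x\<in>A. w x * Poly_Mapping.lookup m x)) (\<Sum>x\<in>A. v x * Poly_Mapping.lookup m x)"
    for A
    by (induction A rule: infinite_finite_induct)
      (simp_all add: monom_power mult_monom monom_0 pCons_one)
  then show ?thesis by (simp add: monom_value_def weight_def)
qed

text \<open>
  Kronecker substitution in two variables: the inner exponent, given by \<open>w\<close>, is there to keep finitely
  many monomials apart, and the outer exponent records the grading \<open>v\<close>. The target is an integral
  domain, which is how the absence of zero divisors and the behaviour of gradings under products
  are obtained for polynomials in the variables \<open>(i, j)\<close>.
\<close>

definition kronecker :: "(int \<times> 'n \<Rightarrow> nat) \<Rightarrow> (int \<times> 'n \<Rightarrow> nat) \<Rightarrow> 'n mpoly \<Rightarrow> complex poly poly" where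
  "kronecker w v = phom (\<lambda>c. [:[:c:]:]) (\<lambda>x. monom (monom 1 (w x)) (v x))"

interpretation kronecker: scalar_hom "\<lambda>c. [:[:c:]:] :: complex poly poly"
  by unfold_locales (simp_all add: pCons_one)

lemma kronecker_mult: "kronecker w v (p * q) = kronecker w v p * kronecker w v q"
  by (simp add: kronecker_def kronecker.phom_mult)

lemma kronecker_expand: "kronecker w v p =
    (\<Sum>m \<in> Poly_Mapping.keys p. monom (monom (Poly_Mapping.lookup p m) (weight w m)) (weight v m))"
  by (simp add: kronecker_def phom_def monom_value_monom smult_monom)

lemma coeff_kronecker:
  assumes "inj_on (weight w) M" "Poly_Mapping.keys p \<subseteq> M" "m \<in> M"
  shows "coeff (coeff (kronecker w v p) (weight v m)) (weight w m) = Poly_Mapping.lookup p m"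
proof -
  have "coeff (coeff (kronecker w v p) (weight v m)) (weight w m) =
      (\<Sum>m' \<in> Poly_Mapping.keys p. if m' = m then Poly_Mapping.lookup p m' else 0)"
    unfolding kronecker_expand coeff_sum
    by (rule sum.cong) (use assms in \<open>auto simp: inj_on_def\<close>)
  also have "\<dots> = Poly_Mapping.lookup p m"
    by (simp add: in_keys_iff)
  finally show ?thesis .
qed

lemma kronecker_nonzero:
  assumes "inj_on (weight w) M" "Poly_Mapping.keys p \<subseteq> M" "p \<noteq> 0"
  shows "kronecker w v p \<noteq> 0"
proof -
  from \<open>p \<noteq> 0\<close> obtain m where m: "Poly_Mapping.lookup p m \<noteq> 0"
    by (metis lookup_zero poly_mapping_eqI)
  then have "m \<in> M" using assms(2) by (auto simp: in_keys_iff)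
  from coeff_kronecker[OF assms(1,2) this, of v] m show ?thesis by auto
qed

text \<open>
  A weight that separates the monomials of both factors takes the role of a monomial order.
\<close>

lemma mpoly_mult_nonzero:
  fixes p q :: "'n mpoly"
  assumes "p \<noteq> 0" "q \<noteq> 0"
  shows "p * q \<noteq> 0"
proof -
  let ?M = "Poly_Mapping.keys p \<union> Poly_Mapping.keys q"
  obtain w :: "int \<times> 'n \<Rightarrow> nat" where w: "inj_on (weight w) ?M"
    using separating_weight[of ?M] by auto
  have "kronecker w w p \<noteq> 0" "kronecker w w q \<noteq> 0"
    using kronecker_nonzero[OF w] assms by auto
  then have "kronecker w w (p * q) \<noteq> 0" by (simp add: kronecker_mult)
  then show ?thesis by (auto simp: kronecker_def)
qed

lemma mpoly_prod_nonzero: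
  fixes g :: "'a \<Rightarrow> 'n mpoly"
  shows "(\<And>x. x \<in> A \<Longrightarrow> g x \<noteq> 0) \<Longrightarrow> prod g A \<noteq> 0"
  by (induction A rule: infinite_finite_induct) (simp_all add: mpoly_mult_nonzero)

lemma mpoly_mult_cancel_left:
  fixes p q r :: "'n mpoly"
  assumes "p \<noteq> 0" "p * q = p * r"
  shows "q = r"
proof -
  have "p * (q - r) = 0" using assms(2) by (simp add: right_diff_distrib)
  with mpoly_mult_nonzero[OF assms(1), of "q - r"] show ?thesis by fastforce
qed

text \<open>
  All coordinates of the point can be chosen nonzero because it has the form \<open>x \<mapsto> t ^ w x\<close>. This keeps its
  coordinate vectors admissible as homogeneous coordinates.
\<close>

lemma meval_generic:
  fixes p :: "'n mpoly"
  assumes "p \<noteq> 0"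
  obtains f where "\<And>x. f x \<noteq> 0" "meval f p \<noteq> 0"
proof -
  obtain w :: "int \<times> 'n \<Rightarrow> nat" where w: "inj_on (weight w) (Poly_Mapping.keys p)"
    using separating_weight[of "Poly_Mapping.keys p"] by auto
  define P where "P = poly (kronecker w (\<lambda>_. 0) p) 1"
  have val: "poly P t = meval (\<lambda>x. t ^ w x) p" for t
    by (simp add: P_def kronecker_def phom_def meval_eq_phom poly_sum poly_monom poly_prod monom_value_def
        poly_power)
  have "P \<noteq> 0"
  proof -
    from assms obtain m where m: "m \<in> Poly_Mapping.keys p"
      by (metis in_keys_iff lookup_zero poly_mapping_eqI)
    have "P = coeff (kronecker w (\<lambda>_. 0) p) 0"
      unfolding P_def kronecker_expand by (simp add: weight_def poly_sum poly_monom coeff_sum)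
    then have "coeff P (weight w m) = Poly_Mapping.lookup p m"
      using coeff_kronecker[OF w subset_refl m, of "\<lambda>_. 0"] by (simp add: weight_def)
    then show ?thesis using m by (auto simp: in_keys_iff)
  qed
  then have "finite {t. poly P t = 0}" by (rule poly_roots_finite)
  then have "finite (insert 0 {t. poly P t = 0})" by simp
  then obtain t where "t \<notin> insert 0 {t. poly P t = 0}"
    using infinite_UNIV_char_0 ex_new_if_finite by blast
  then show ?thesis using that[of "\<lambda>x. t ^ w x"] val by auto
qed

section \<open>Homogeneous polynomials\<close>

definition homog :: "(int \<times> 'n \<Rightarrow> nat) \<Rightarrow> nat \<Rightarrow> 'n mpoly \<Rightarrow> bool" where
  "homog v n p \<longleftrightarrow> (\<forall>m \<in> Poly_Mapping.keys p. weight v m = n)"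

abbreviation site_wt :: "int \<Rightarrow> int \<times> 'n \<Rightarrow> nat" where
  "site_wt i \<equiv> \<lambda>x. if fst x = i then 1 else 0"

abbreviation homogeneous :: "nat \<Rightarrow> 'n mpoly \<Rightarrow> bool" where
  "homogeneous \<equiv> homog (\<lambda>_. 1)"

lemma weight_site_wt: "weight (site_wt i) m = (\<Sum>j\<in>UNIV. Poly_Mapping.lookup m (i, j :: 'n::finite))"
proof -
  let ?A = "Poly_Mapping.keys m \<union> Pair i ` UNIV"
  have "weight (site_wt i) m = (\<Sum>x\<in>?A. site_wt i x * Poly_Mapping.lookup m x)"
    by (rule weight_superset) auto
  also have "\<dots> = (\<Sum>x\<in>Pair i ` UNIV. Poly_Mapping.lookup m x)"
    by (rule sum.mono_neutral_cong_right) auto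
  also have "\<dots> = (\<Sum>j\<in>UNIV. Poly_Mapping.lookup m (i, j))"
    by (subst sum.reindex) (auto simp: inj_on_def)
  finally show ?thesis .
qed

lemma multihomogeneous_iff: "multihomogeneous \<delta> p \<longleftrightarrow> (\<forall>i. homog (site_wt i) (\<delta> i) p)"
  unfolding multihomogeneous_def homog_def weight_site_wt by blast

lemma homog_zero [simp]: "homog v n 0"
  by (simp add: homog_def)

lemma homog_add: "homog v n p \<Longrightarrow> homog v n q \<Longrightarrow> homog v n (p + q)"
  unfolding homog_def using keys_add[of p q] by blast

lemma mpoly_keys_uminus: "Poly_Mapping.keys (- p :: 'n mpoly) = Poly_Mapping.keys p"
  by (auto simp: in_keys_iff)

lemma homog_diff: "homog v n p \<Longrightarrow> homog v n q \<Longrightarrow> homog v n (p - q)"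
  using homog_add[of v n p "- q"] by (simp add: homog_def mpoly_keys_uminus)

lemma homog_mult: "homog v n p \<Longrightarrow> homog v n' q \<Longrightarrow> homog v (n + n') (p * q)"
  unfolding homog_def using keys_mult[of p q] by (auto simp: weight_add dest!: subsetD)

lemma homog_mvar: "homog v (v x) (mvar x)"
  by (simp add: homog_def mvar_def)

lemma homog_unique: "homog v n p \<Longrightarrow> homog v n' p \<Longrightarrow> p \<noteq> 0 \<Longrightarrow> n = n'"
  unfolding homog_def by (metis in_keys_iff lookup_zero poly_mapping_eqI)

lemma monom_factor:
  fixes P Q :: "'a::idom poly"
  assumes "P * Q = monom c W" "c \<noteq> 0" "coeff P n \<noteq> 0"
  shows "n = degree P" "degree P + degree Q = W"
proof -
  have nz: "P * Q \<noteq> 0" using assms by simp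
  then have "P \<noteq> 0" "Q \<noteq> 0" by auto
  then have "degree P + degree Q = W"
    using degree_mult_eq[of P Q] assms(1,2) by (simp add: degree_monom_eq)
  then show "degree P + degree Q = W" .
  have "order 0 P + order 0 Q = W"
    using order_mult[OF nz, of 0] assms by (simp add: order_0_monom)
  moreover have "order 0 P \<le> degree P" "order 0 Q \<le> degree Q"
    using nz by (auto intro: order_degree)
  ultimately have "order 0 P = degree P" using \<open>degree P + degree Q = W\<close> by linarith
  moreover have "monom 1 (order 0 P) dvd P" using nz by (subst monom_1_dvd_iff) auto
  ultimately have "\<not> n < degree P" using assms(3) by (auto simp: monom_1_dvd_iff')
  moreover have "n \<le> degree P" using assms(3) by (rule le_degree)
  ultimately show "n = degree P" by simp
qed

text \<open>
  Seen as a polynomial in the outer variable, a homogeneous product is a monomial. Degrees and orders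
  of vanishing at \<open>0\<close> both add up, so each factor is a monomial as well.
\<close>

lemma homog_factor:
  fixes p q :: "'n mpoly"
  assumes "homog v W (p * q)" "p \<noteq> 0" "q \<noteq> 0"
  obtains a b where "homog v a p" "homog v b q" "a + b = W"
proof -
  let ?M = "Poly_Mapping.keys p \<union> Poly_Mapping.keys q"
  obtain w :: "int \<times> 'n \<Rightarrow> nat" where w: "inj_on (weight w) ?M"
    using separating_weight[of ?M] by auto
  define P where "P = kronecker w v p"
  define Q where "Q = kronecker w v q"
  have nz: "P \<noteq> 0" "Q \<noteq> 0"
    using kronecker_nonzero[OF w] assms by (auto simp: P_def Q_def)
  define c where "c = (\<Sum>m \<in> Poly_Mapping.keys (p * q). monom (Poly_Mapping.lookup (p * q) m) (weight w m))"
  have PQ: "P * Q = monom c W"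
  proof -
    have "P * Q = kronecker w v (p * q)" by (simp add: P_def Q_def kronecker_mult)
    also have "\<dots> = monom c W"
      unfolding kronecker_expand c_def using assms(1)
      by (simp add: homog_def poly_eq_iff coeff_sum)
    finally show ?thesis .
  qed
  then have c: "c \<noteq> 0" using nz by auto
  have "coeff P (weight v m) \<noteq> 0" if "m \<in> Poly_Mapping.keys p" for m
    using coeff_kronecker[OF w, of p m v] that by (auto simp: P_def in_keys_iff)
  then have 1: "homog v (degree P) p"
    using monom_factor(1)[OF PQ c] by (auto simp: homog_def)
  have "coeff Q (weight v m) \<noteq> 0" if "m \<in> Poly_Mapping.keys q" for m
    using coeff_kronecker[OF w, of q m v] that by (auto simp: Q_def in_keys_iff)
  then have 2: "homog v (degree Q) q"
    using monom_factor(1)[of Q P c W] PQ c by (auto simp: homog_def mult.commute)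
  have "coeff P (degree P) \<noteq> 0" using nz by simp
  from monom_factor(2)[OF PQ c this] show ?thesis using that[OF 1 2] by simp
qed

lemma mvars_iff_homog: "x \<notin> mvars p \<longleftrightarrow> homog (\<lambda>y. if y = x then 1 else 0) 0 p"
proof -
  have "weight (\<lambda>y. if y = x then 1 else 0) m = Poly_Mapping.lookup m x" for m
    by (subst weight_superset[of "insert x (Poly_Mapping.keys m)"])
      (auto simp: if_distrib[of "\<lambda>z. z * _"] in_keys_iff cong: if_cong)
  then show ?thesis by (auto simp: mvars_def homog_def in_keys_iff)
qed

text \<open>
  Not to contain a variable is homogeneity of degree \<open>0\<close> for the grading by that variable.
\<close>

lemma mvars_factor:
  assumes "p \<noteq> 0" "q \<noteq> 0"
  shows "mvars q \<subseteq> mvars (p * q)"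
proof
  fix x assume "x \<in> mvars q"
  show "x \<in> mvars (p * q)"
  proof (rule ccontr)
    assume "x \<notin> mvars (p * q)"
    then have "homog (\<lambda>y. if y = x then 1 else 0) 0 (p * q)" by (simp add: mvars_iff_homog)
    from homog_factor[OF this assms] have "homog (\<lambda>y. if y = x then 1 else 0) 0 q"
      by (metis add_is_0)
    with \<open>x \<in> mvars q\<close> show False by (simp add: mvars_iff_homog[symmetric])
  qed
qed

section \<open>Cross products over a commutative ring\<close>

definition cross :: "(3 \<Rightarrow> 'r::comm_ring_1) \<Rightarrow> (3 \<Rightarrow> 'r) \<Rightarrow> 3 \<Rightarrow> 'r" where
  "cross u v = (\<lambda>j. if j = 1 then u 2 * v 3 - u 3 * v 2
     else if j = 2 then u 3 * v 1 - u 1 * v 3 else u 1 * v 2 - u 2 * v 1)"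

text \<open>
  Determinants and cross products are needed over polynomial rings as well as over the complex
  numbers, and with vectors as functions, which is the type of the tuples.
\<close>

definition det3 :: "(3 \<Rightarrow> 'r::comm_ring_1) \<Rightarrow> (3 \<Rightarrow> 'r) \<Rightarrow> (3 \<Rightarrow> 'r) \<Rightarrow> 'r" where
  "det3 u v w = u 1 * cross v w 1 + u 2 * cross v w 2 + u 3 * cross v w 3"

definition line_meet :: "(3 \<Rightarrow> 'r::comm_ring_1) \<Rightarrow> (3 \<Rightarrow> 'r) \<Rightarrow> (3 \<Rightarrow> 'r) \<Rightarrow> (3 \<Rightarrow> 'r) \<Rightarrow> 3 \<Rightarrow> 'r" where
  "line_meet u v x y = cross (cross u v) (cross x y)"

lemma cross_simps:
  "cross u v 1 = u 2 * v 3 - u 3 * v 2"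
  "cross u v 2 = u 3 * v 1 - u 1 * v 3"
  "cross u v 3 = u 1 * v 2 - u 2 * v 1"
  by (simp_all add: cross_def)

lemma fun3_eq_iff: "(u :: 3 \<Rightarrow> 'r) = v \<longleftrightarrow> u 1 = v 1 \<and> u 2 = v 2 \<and> u 3 = v 3"
  by (simp add: fun_eq_iff forall_3)

text \<open>
  The Grassmann expansions of the intersection point: once in the two points that span the first line,
  once in those that span the second. All incidences below are read off from these two formulas.
\<close>

lemma line_meet_on_first_line: "line_meet u v x y = (\<lambda>j. - det3 v x y * u j + det3 u x y * v j)"
  unfolding fun3_eq_iff line_meet_def det3_def cross_simps by (simp add: algebra_simps)

lemma line_meet_on_second_line: "line_meet u v x y = (\<lambda>j. det3 u v y * x j - det3 u v x * y j)"
  unfolding fun3_eq_iff line_meet_def det3_def cross_simps by (simp add: algebra_simps)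

lemma cross_cross: "cross x (cross y z) =
    (\<lambda>j. (x 1 * z 1 + x 2 * z 2 + x 3 * z 3) * y j - (x 1 * y 1 + x 2 * y 2 + x 3 * y 3) * z j)"
  unfolding fun3_eq_iff cross_simps by (simp add: algebra_simps)

lemma cross_scale: "cross (\<lambda>j. k * u j) (\<lambda>j. l * v j) = (\<lambda>j. k * l * cross u v j)"
  unfolding fun3_eq_iff cross_simps by (simp add: algebra_simps)

lemma line_meet_scale:
  "line_meet (\<lambda>j. k * u j) (\<lambda>j. l * v j) (\<lambda>j. m * x j) (\<lambda>j. n * y j) = (\<lambda>j. k * l * m * n * line_meet u v x y j)"
  unfolding line_meet_def cross_scale by (simp add: mult_ac)

lemma det3_combination:
  "det3 (\<lambda>j. k * u j + l * v j) x y = k * det3 u x y + l * det3 v x y"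
  "det3 x (\<lambda>j. k * u j + l * v j) y = k * det3 x u y + l * det3 x v y"
  "det3 x y (\<lambda>j. k * u j + l * v j) = k * det3 x y u + l * det3 x y v"
  unfolding det3_def cross_simps by (simp_all add: algebra_simps)

lemma det3_self [simp]: "det3 u u v = 0" "det3 u v u = 0" "det3 v u u = 0"
  unfolding det3_def cross_simps by (simp_all add: algebra_simps)

lemma det3_rotate: "det3 u v w = det3 v w u"
  unfolding det3_def cross_simps by (simp add: algebra_simps)

lemma det3_zero_left [simp]: "det3 (\<lambda>_. 0) v w = 0"
  by (simp add: det3_def)

lemma parallel_if_cross_zero:
  fixes u v :: "3 \<Rightarrow> complex"
  assumes "cross u v = (\<lambda>_. 0)" "u \<noteq> (\<lambda>_. 0)"
  obtains c where "v = (\<lambda>j. c * u j)"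
proof -
  have eq: "u 2 * v 3 = u 3 * v 2" "u 3 * v 1 = u 1 * v 3" "u 1 * v 2 = u 2 * v 1"
    using assms(1) by (simp_all add: fun3_eq_iff cross_simps)
  consider "u 1 \<noteq> 0" | "u 2 \<noteq> 0" | "u 3 \<noteq> 0" using assms(2) by (auto simp: fun3_eq_iff)
  then show ?thesis
  proof cases
    case 1 then show ?thesis using eq that[of "v 1 / u 1"] by (simp add: fun3_eq_iff field_simps)
  next
    case 2 then show ?thesis using eq that[of "v 2 / u 2"] by (simp add: fun3_eq_iff field_simps)
  next
    case 3 then show ?thesis using eq that[of "v 3 / u 3"] by (simp add: fun3_eq_iff field_simps)
  qed
qed

lemma cross_self [simp]: "cross u u = (\<lambda>_. 0)" "cross (\<lambda>_. 0) v = (\<lambda>_. 0)" "cross v (\<lambda>_. 0) = (\<lambda>_. 0)"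
  unfolding fun3_eq_iff cross_simps by simp_all

lemma cross_self_scale [simp]: "cross u (\<lambda>j. c * u j) = (\<lambda>_. 0)"
  unfolding fun3_eq_iff cross_simps by (simp add: algebra_simps)

lemma det3_zero_imp_combination:
  fixes u v x :: "3 \<Rightarrow> complex"
  assumes "cross u v \<noteq> (\<lambda>_. 0)" "det3 x u v = 0"
  obtains k l where "x = (\<lambda>j. k * u j + l * v j)"
proof -
  obtain y where y: "det3 u v y \<noteq> 0"
  proof -
    consider "cross u v 1 \<noteq> 0" | "cross u v 2 \<noteq> 0" | "cross u v 3 \<noteq> 0"
      using assms(1) by (auto simp: fun3_eq_iff)
    then show ?thesis
    proof cases
      case 1 then show ?thesis using that[of "\<lambda>j. if j = 1 then 1 else 0"]
        by (simp add: det3_def cross_simps algebra_simps)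
    next
      case 2 then show ?thesis using that[of "\<lambda>j. if j = 2 then 1 else 0"]
        by (simp add: det3_def cross_simps algebra_simps)
    next
      case 3 then show ?thesis using that[of "\<lambda>j. if j = 3 then 1 else 0"]
        by (simp add: det3_def cross_simps algebra_simps)
    qed
  qed
  have "det3 u v x = 0" using assms(2) det3_rotate by metis
  then have "(\<lambda>j. det3 u v y * x j) = (\<lambda>j. - det3 v x y * u j + det3 u x y * v j)"
    using line_meet_on_first_line[of u v x y] line_meet_on_second_line[of u v x y] by simp
  then have "x = (\<lambda>j. (- det3 v x y / det3 u v y) * u j + (det3 u x y / det3 u v y) * v j)"
    using y by (simp add: fun_eq_iff field_simps)
  then show ?thesis by (rule that)
qed

section \<open>Points and lines of the projective plane\<close>

definition pcoords :: "3 proj \<Rightarrow> 3 \<Rightarrow> complex" where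
  "pcoords p = (\<lambda>j. hcoords p $ j)"

lemma subspace_dim1:
  fixes L :: "(complex ^ 'n) set"
  assumes "vec.subspace L" "vec.dim L = 1" "w \<noteq> 0" "w \<in> L"
  shows "L = vec.span {w}"
proof -
  have "vec.independent {w}" using assms(3) by simp
  then have "L \<subseteq> vec.span {w}"
    using assms by (intro vec.card_ge_dim_independent) auto
  moreover have "vec.span {w} \<subseteq> L" using assms by (simp add: vec.span_minimal)
  ultimately show ?thesis by blast
qed

lemma hcoords: "hcoords p \<noteq> 0" "Rep_proj p = vec.span {hcoords p}"
proof -
  have p: "vec.subspace (Rep_proj p)" "vec.dim (Rep_proj p) = 1" using Rep_proj[of p] by auto
  have "\<exists>w. w \<noteq> 0 \<and> w \<in> Rep_proj p"
  proof (rule ccontr)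
    assume "\<not> (\<exists>w. w \<noteq> 0 \<and> w \<in> Rep_proj p)"
    then have "Rep_proj p \<subseteq> {0}" by blast
    then have "vec.dim (Rep_proj p) = 0" by (simp add: vec.dim_eq_0)
    with p show False by simp
  qed
  then have "hcoords p \<noteq> 0 \<and> hcoords p \<in> Rep_proj p"
    unfolding hcoords_def by (rule someI_ex)
  then show "hcoords p \<noteq> 0" "Rep_proj p = vec.span {hcoords p}"
    using subspace_dim1[OF p] by auto
qed

lemma Rep_proj_point:
  assumes "w \<noteq> 0"
  shows "Rep_proj (proj_point w) = vec.span {w}"
proof -
  have "vec.independent {w}" using assms by simp
  then have "vec.dim (vec.span {w}) = 1"
    using vec.dim_span_eq_card_independent[of "{w}"] by simp
  then show ?thesis unfolding proj_point_def by (intro Abs_proj_inverse) simp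
qed

lemma hcoords_proj_point:
  assumes "w \<noteq> 0"
  obtains c where "c \<noteq> 0" "\<And>j. hcoords (proj_point w) $ j = c * w $ j"
proof -
  have "hcoords (proj_point w) \<in> vec.span {w}"
    using hcoords(2)[of "proj_point w"] Rep_proj_point[OF assms] vec.span_base by blast
  then obtain c where c: "hcoords (proj_point w) = c *s w"
    by (auto simp: vec.span_singleton)
  then have "c \<noteq> 0" using hcoords(1)[of "proj_point w"] by auto
  with c show ?thesis using that by simp
qed

lemma pcoords_proj_point:
  assumes "w \<noteq> (\<lambda>_. 0)"
  obtains c where "c \<noteq> 0" "pcoords (proj_point (\<chi> j. w j)) = (\<lambda>j. c * w j)"
proof -
  have "vec_lambda w \<noteq> 0" using assms by (auto simp: Finite_Cartesian_Product.vec_eq_iff)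
  then obtain c where "c \<noteq> 0" "\<And>j. hcoords (proj_point (vec_lambda w)) $ j = c * vec_lambda w $ j"
    by (rule hcoords_proj_point) blast
  then show ?thesis by (intro that[of c]) (simp_all add: pcoords_def)
qed

lemma proj_point_hcoords: "proj_point (hcoords p) = p"
  using Rep_proj_point[OF hcoords(1)] hcoords(2) Rep_proj_inject by metis

lemma pcoords_nonzero: "pcoords p \<noteq> (\<lambda>_. 0)"
  using hcoords(1)[of p] by (auto simp: pcoords_def fun_eq_iff Finite_Cartesian_Product.vec_eq_iff)

lemma proj_eq_iff_cross: "p = q \<longleftrightarrow> cross (pcoords p) (pcoords q) = (\<lambda>_. 0)"
proof
  assume "p = q"
  then show "cross (pcoords p) (pcoords q) = (\<lambda>_. 0)"
    using cross_self_scale[of "pcoords p" 1] by simp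
next
  assume "cross (pcoords p) (pcoords q) = (\<lambda>_. 0)"
  then obtain c where "pcoords q = (\<lambda>j. c * pcoords p j)"
    by (rule parallel_if_cross_zero[OF _ pcoords_nonzero])
  then have c: "hcoords q = c *s hcoords p"
    by (simp add: pcoords_def fun_eq_iff Finite_Cartesian_Product.vec_eq_iff)
  then have "hcoords q \<in> Rep_proj p"
    by (simp add: hcoords(2)[of p] vec.span_scale vec.span_base)
  then have "Rep_proj p = vec.span {hcoords q}"
    using Rep_proj[of p] hcoords(1)[of q] by (intro subspace_dim1) auto
  then show "p = q" using hcoords(2)[of q] Rep_proj_inject by metis
qed

lemma in_line_iff_combination:
  "r \<in> line p q \<longleftrightarrow> (\<exists>k l. pcoords r = (\<lambda>j. k * pcoords p j + l * pcoords q j))"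
proof -
  have "vec.span (Rep_proj p \<union> Rep_proj q) = vec.span {hcoords p, hcoords q}"
    unfolding hcoords(2)[of p] hcoords(2)[of q] vec.span_eq
  proof
    show "vec.span {hcoords p} \<union> vec.span {hcoords q} \<subseteq> vec.span {hcoords p, hcoords q}"
      by (intro Un_least vec.span_mono) simp_all
    show "{hcoords p, hcoords q} \<subseteq> vec.span (vec.span {hcoords p} \<union> vec.span {hcoords q})"
      by (simp add: vec.span_base)
  qed
  then have "r \<in> line p q \<longleftrightarrow> hcoords r \<in> vec.span {hcoords p, hcoords q}"
    unfolding line_def hcoords(2)[of r] mem_Collect_eq
    using vec.span_base[of "hcoords r" "{hcoords r}"]
      vec.span_minimal[of "{hcoords r}" "vec.span {hcoords p, hcoords q}"] by auto
  also have "\<dots> \<longleftrightarrow> (\<exists>k l. hcoords r - k *s hcoords p = l *s hcoords q)"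
    by (auto simp: vec.span_breakdown_eq vec.span_singleton)
  also have "\<dots> \<longleftrightarrow> (\<exists>k l. pcoords r = (\<lambda>j. k * pcoords p j + l * pcoords q j))"
    by (simp add: pcoords_def fun_eq_iff Finite_Cartesian_Product.vec_eq_iff algebra_simps)
  finally show ?thesis .
qed

lemma in_line_iff_det3:
  assumes "p \<noteq> q"
  shows "r \<in> line p q \<longleftrightarrow> det3 (pcoords r) (pcoords p) (pcoords q) = 0"
proof
  assume "r \<in> line p q"
  then show "det3 (pcoords r) (pcoords p) (pcoords q) = 0"
    by (auto simp: in_line_iff_combination det3_combination)
next
  assume "det3 (pcoords r) (pcoords p) (pcoords q) = 0"
  moreover have "cross (pcoords p) (pcoords q) \<noteq> (\<lambda>_. 0)"
    using assms by (simp add: proj_eq_iff_cross)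
  ultimately show "r \<in> line p q"
    unfolding in_line_iff_combination using det3_zero_imp_combination by metis
qed

text \<open>
  The vector \<open>(p \<times> q) \<times> (r \<times> s)\<close> vanishes exactly where the geometric construction breaks down. This matches
  the indeterminacy locus of the rule with the domain of the skew pentagram map.
\<close>

lemma line_meet_nonzero_iff:
  "line_meet (pcoords p) (pcoords q) (pcoords r) (pcoords s) \<noteq> (\<lambda>_. 0) \<longleftrightarrow>
     p \<noteq> q \<and> r \<noteq> s \<and> line p q \<noteq> line r s"
proof (cases "p = q \<or> r = s")
  case True
  then have "line_meet (pcoords p) (pcoords q) (pcoords r) (pcoords s) = (\<lambda>_. 0)"
    unfolding line_meet_def using cross_self by auto
  then show ?thesis using True by auto
next
  case False
  then have ne: "p \<noteq> q" "r \<noteq> s" by simp_all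
  let ?u = "cross (pcoords p) (pcoords q)" and ?v = "cross (pcoords r) (pcoords s)"
  have "line_meet (pcoords p) (pcoords q) (pcoords r) (pcoords s) = (\<lambda>_. 0)" if "line p q = line r s"
  proof -
    have "p \<in> line p q" "q \<in> line p q" unfolding in_line_iff_det3[OF ne(1)] by simp_all
    then have "det3 (pcoords p) (pcoords r) (pcoords s) = 0" "det3 (pcoords q) (pcoords r) (pcoords s) = 0"
      unfolding that in_line_iff_det3[OF ne(2)] .
    then show ?thesis unfolding line_meet_on_first_line by simp
  qed
  moreover have "line p q = line r s"
    if eq: "line_meet (pcoords p) (pcoords q) (pcoords r) (pcoords s) = (\<lambda>_. 0)"
  proof -
    have u: "?u \<noteq> (\<lambda>_. 0)" and v: "?v \<noteq> (\<lambda>_. 0)" using ne unfolding proj_eq_iff_cross .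
    obtain c where c: "?v = (\<lambda>j. c * ?u j)"
      by (rule parallel_if_cross_zero[OF eq[unfolded line_meet_def] u])
    have "c \<noteq> 0" using c v by (intro notI) simp
    have "det3 x (pcoords r) (pcoords s) = c * det3 x (pcoords p) (pcoords q)" for x
      unfolding det3_def c by (simp add: algebra_simps)
    then have "t \<in> line r s \<longleftrightarrow> t \<in> line p q" for t
      unfolding in_line_iff_det3[OF ne(1)] in_line_iff_det3[OF ne(2)] using \<open>c \<noteq> 0\<close> by simp
    then have "line r s = line p q" by (rule Set.set_eqI)
    then show ?thesis by (rule sym)
  qed
  ultimately have "line_meet (pcoords p) (pcoords q) (pcoords r) (pcoords s) = (\<lambda>_. 0) \<longleftrightarrow> line p q = line r s"
    by (rule iffI[rotated])
  then show ?thesis using ne by simp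
qed

lemma line_meet_is_intersection:
  assumes "line_meet (pcoords p) (pcoords q) (pcoords r) (pcoords s) \<noteq> (\<lambda>_. 0)"
  shows "(THE t. t \<in> line p q \<inter> line r s) =
    proj_point (\<chi> j. line_meet (pcoords p) (pcoords q) (pcoords r) (pcoords s) j)"
proof -
  let ?m = "line_meet (pcoords p) (pcoords q) (pcoords r) (pcoords s)"
  have ne: "p \<noteq> q" "r \<noteq> s" using assms unfolding line_meet_nonzero_iff by simp_all
  define t0 where "t0 = proj_point (\<chi> j. ?m j)"
  obtain c where c: "c \<noteq> 0" "pcoords t0 = (\<lambda>j. c * ?m j)"
    using pcoords_proj_point[OF assms] unfolding t0_def by blast
  have "t0 \<in> line p q"
    unfolding in_line_iff_combination c(2) line_meet_on_first_line
    by (intro exI[of _ "c * (- det3 (pcoords q) (pcoords r) (pcoords s))"]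
          exI[of _ "c * det3 (pcoords p) (pcoords r) (pcoords s)"])
      (simp only: distrib_left mult.assoc)
  moreover have "t0 \<in> line r s"
    unfolding in_line_iff_combination c(2) line_meet_on_second_line
    by (intro exI[of _ "c * det3 (pcoords p) (pcoords q) (pcoords s)"]
          exI[of _ "c * (- det3 (pcoords p) (pcoords q) (pcoords r))"])
      (simp only: diff_conv_add_uminus distrib_left mult.assoc mult_minus_left)
  moreover have "t = t0" if "t \<in> line p q" "t \<in> line r s" for t
  proof -
    let ?t = "pcoords t"
    have "cross ?t ?m = (\<lambda>j. det3 ?t (pcoords r) (pcoords s) * cross (pcoords p) (pcoords q) j
        - det3 ?t (pcoords p) (pcoords q) * cross (pcoords r) (pcoords s) j)"
      unfolding line_meet_def det3_def by (rule cross_cross)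
    also have "\<dots> = (\<lambda>_. 0)"
      using that unfolding in_line_iff_det3[OF ne(1)] in_line_iff_det3[OF ne(2)] by simp
    finally have "cross ?t ?m = (\<lambda>_. 0)" .
    then have "cross ?t (pcoords t0) = (\<lambda>_. 0)"
      unfolding c(2) cross_scale[of 1 ?t c ?m, unfolded mult_1] by simp
    then show "t = t0" unfolding proj_eq_iff_cross .
  qed
  ultimately show ?thesis unfolding t0_def[symmetric] by (intro the_equality) blast+
qed

section \<open>The lattice iteration over a commutative ring\<close>

definition lattice_step :: "int \<Rightarrow> int \<Rightarrow> int \<Rightarrow> int \<Rightarrow> (int \<Rightarrow> 3 \<Rightarrow> 'r::comm_ring_1) \<Rightarrow> int \<Rightarrow> 3 \<Rightarrow> 'r" where
  "lattice_step a b c d v = (\<lambda>i. line_meet (v (i + a)) (v (i + b)) (v (i + c)) (v (i + d)))"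

definition generic_point :: "int \<Rightarrow> 3 tuple" where
  "generic_point i = (\<lambda>j. mvar (i, j))"

text \<open>
  The iterate of the rule at the configuration whose coordinates are the variables themselves, without
  cancelling common factors: the value at site \<open>i\<close> after \<open>m\<close> steps.
\<close>

definition generic_iterate :: "int \<Rightarrow> int \<Rightarrow> int \<Rightarrow> int \<Rightarrow> nat \<Rightarrow> int \<Rightarrow> 3 tuple" where
  "generic_iterate a b c d m = (lattice_step a b c d ^^ m) generic_point"

lemma generic_iterate_0 [simp]: "generic_iterate a b c d 0 = generic_point"
  by (simp add: generic_iterate_def)

lemma generic_iterate_Suc: "generic_iterate a b c d (Suc m) i =
    line_meet (generic_iterate a b c d m (i + a)) (generic_iterate a b c d m (i + b))
      (generic_iterate a b c d m (i + c)) (generic_iterate a b c d m (i + d))"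
  by (simp add: generic_iterate_def lattice_step_def)

lemma meval_cross: "meval f (cross u v j) = cross (\<lambda>k. meval f (u k)) (\<lambda>k. meval f (v k)) j"
  by (simp add: cross_def meval.phom_diff meval.phom_mult)

lemma meval_line_meet: "meval f (line_meet u v x y j) =
    line_meet (\<lambda>k. meval f (u k)) (\<lambda>k. meval f (v k)) (\<lambda>k. meval f (x k)) (\<lambda>k. meval f (y k)) j"
  by (simp add: line_meet_def meval_cross)

lemma meval_det3: "meval f (det3 u v w) =
    det3 (\<lambda>k. meval f (u k)) (\<lambda>k. meval f (v k)) (\<lambda>k. meval f (w k))"
  by (simp add: det3_def meval_cross meval.phom_add meval.phom_mult)

lemma msubst_line_meet: "msubst f (line_meet u v x y j) =
    line_meet (\<lambda>k. msubst f (u k)) (\<lambda>k. msubst f (v k)) (\<lambda>k. msubst f (x k)) (\<lambda>k. msubst f (y k)) j"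
  by (simp add: line_meet_def cross_def msubst_hom)

text \<open>
  Substituting numbers into the symbolic iterate is the same as iterating on numbers. Because of this,
  one suitable numerical orbit is enough to show that symbolic expressions do not vanish.
\<close>

lemma meval_generic_iterate:
  "meval f (generic_iterate a b c d m i j) = (lattice_step a b c d ^^ m) (\<lambda>i j. f (i, j)) i j"
  by (induction m arbitrary: i j) (simp_all add: generic_point_def generic_iterate_Suc meval_line_meet lattice_step_def)

lemma mshift_generic_iterate: "mshift s (generic_iterate a b c d m i j) = generic_iterate a b c d m (s + i) j"
  by (induction m arbitrary: i j)
    (simp_all add: generic_point_def generic_iterate_Suc mshift_def msubst_line_meet msubst_hom add.assoc)

lemma mshift_mshift: "mshift s (mshift t p) = mshift (s + t) p"
  by (simp add: mshift_def msubst_msubst msubst_hom case_prod_unfold add.assoc)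

lemma msubst_mvar_id: "msubst mvar p = (p :: 'n mpoly)"
proof (induction p rule: mpoly_induct)
  case (single m c)
  have "(\<Prod>x\<in>A. mvar x ^ Poly_Mapping.lookup m x) =
      Poly_Mapping.single (\<Sum>x\<in>A. Poly_Mapping.single x (Poly_Mapping.lookup m x)) 1"
    for A :: "(int \<times> 'n) set"
  proof (induction A rule: infinite_finite_induct)
    case (insert x A)
    have "mvar x ^ n = Poly_Mapping.single (Poly_Mapping.single x n) 1" for x :: "int \<times> 'n" and n
      by (induction n) (simp_all add: mvar_def mult_single single_add[symmetric])
    then show ?case using insert by (simp add: mult_single)
  qed simp_all
  moreover have "(\<Sum>x\<in>Poly_Mapping.keys m. Poly_Mapping.single x (Poly_Mapping.lookup m x)) = m"
    by (rule poly_mapping_eqI)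
      (simp add: lookup_sum lookup_single when_def in_keys_iff)
  ultimately show ?case
    by (simp add: msubst_hom monom_value_def mconst_def mult_single)
next
  case (plus p q)
  then show ?case by (simp add: msubst_hom)
qed

lemma mshift_0: "mshift 0 p = p"
  using msubst_mvar_id[of p] by (simp add: mshift_def case_prod_unfold)

lemma mshift_nonzero: "p \<noteq> 0 \<Longrightarrow> mshift s p \<noteq> 0"
  using mshift_mshift[of "- s" s p] mshift_0[of p] by (auto simp: mshift_def msubst_hom)

lemma mvars_diff: "mvars (p - q) \<subseteq> mvars p \<union> mvars (q :: 'n mpoly)"
proof -
  have "Poly_Mapping.keys (p - q) \<subseteq> Poly_Mapping.keys p \<union> Poly_Mapping.keys q"
    by (auto simp: in_keys_iff lookup_minus)
  then show ?thesis by (fastforce simp: mvars_def)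
qed

lemma mvars_add: "mvars (p + q) \<subseteq> mvars p \<union> mvars (q :: 'n mpoly)"
  using keys_add[of p q] by (fastforce simp: mvars_def)

lemma mvars_mult: "mvars (p * q) \<subseteq> mvars p \<union> mvars (q :: 'n mpoly)"
proof
  fix x assume "x \<in> mvars (p * q)"
  then obtain m where m: "m \<in> Poly_Mapping.keys (p * q)" "x \<in> Poly_Mapping.keys m"
    by (auto simp: mvars_def)
  then obtain k l where "m = k + l" "k \<in> Poly_Mapping.keys p" "l \<in> Poly_Mapping.keys q"
    using keys_mult[of p q] by auto
  then show "x \<in> mvars p \<union> mvars q"
    using m(2) keys_add[of k l] by (auto simp: mvars_def)
qed

lemma mvars_mvar [simp]: "mvars (mvar x) = {x}"
  by (simp add: mvars_def mvar_def)

lemma mvars_cross: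
  assumes "\<And>k. mvars (u k) \<subseteq> V" "\<And>k. mvars (v k) \<subseteq> V"
  shows "mvars (cross u v j) \<subseteq> V"
proof -
  have "mvars (u k * v l - u k' * v l') \<subseteq> V" "mvars (u k * v l) \<subseteq> V" for k l k' l'
    using mvars_diff mvars_mult assms by (meson Un_least order_trans)+
  then show ?thesis by (simp add: cross_def)
qed

lemma mvars_line_meet:
  assumes "\<And>k. mvars (u k) \<subseteq> V" "\<And>k. mvars (v k) \<subseteq> V" "\<And>k. mvars (x k) \<subseteq> V" "\<And>k. mvars (y k) \<subseteq> V"
  shows "mvars (line_meet u v x y j) \<subseteq> V"
  unfolding line_meet_def by (intro mvars_cross assms)

lemma homog_cross:
  assumes "\<And>k. homog w n (u k)" "\<And>k. homog w n' (v k)"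
  shows "homog w (n + n') (cross u v j)"
  unfolding cross_def by (auto intro!: homog_diff homog_mult assms)

lemma homog_line_meet:
  assumes "\<And>k. homog w n1 (u k)" "\<And>k. homog w n2 (v k)" "\<And>k. homog w n3 (x k)" "\<And>k. homog w n4 (y k)"
  shows "homog w (n1 + n2 + (n3 + n4)) (line_meet u v x y j)"
  unfolding line_meet_def by (intro homog_cross assms)

primrec sites :: "int set \<Rightarrow> nat \<Rightarrow> int set" where
  "sites S 0 = {0}"
| "sites S (Suc m) = {s + s' | s s'. s \<in> sites S m \<and> s' \<in> S}"

lemma finite_sites: "finite S \<Longrightarrow> finite (sites S m)"
  by (induction m) (auto simp: finite_image_set2)

lemma sites_nonempty: "S \<noteq> {} \<Longrightarrow> sites S m \<noteq> {}"
  by (induction m) auto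

lemma mvars_generic_iterate:
  "mvars (generic_iterate a b c d m i j) \<subseteq> (\<lambda>s. i + s) ` sites {a, b, c, d} m \<times> UNIV"
proof (induction m arbitrary: i j)
  case 0
  then show ?case by (simp add: generic_point_def)
next
  case (Suc m)
  have "mvars (generic_iterate a b c d m (i + e) j) \<subseteq> (\<lambda>s. i + s) ` sites {a, b, c, d} (Suc m) \<times> UNIV"
    if "e \<in> {a, b, c, d}" for e j
  proof -
    have "(\<lambda>s. i + e + s) ` sites {a, b, c, d} m \<subseteq> (\<lambda>s. i + s) ` sites {a, b, c, d} (Suc m)"
    proof
      fix x assume "x \<in> (\<lambda>s. i + e + s) ` sites {a, b, c, d} m"
      then obtain s where "s \<in> sites {a, b, c, d} m" "x = i + (s + e)" by auto
      then show "x \<in> (\<lambda>s. i + s) ` sites {a, b, c, d} (Suc m)" using that by auto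
    qed
    then show ?thesis using Suc.IH[of "i + e" j] by blast
  qed
  then show ?case unfolding generic_iterate_Suc by (intro mvars_line_meet) blast+
qed

lemma generic_iterate_homog:
  fixes w :: "int \<times> 3 \<Rightarrow> nat"
  assumes "\<And>s j. w (s, j) = u s"
  shows "\<exists>n. \<forall>j. homog w n (generic_iterate a b c d m i j)"
proof (induction m arbitrary: i)
  case 0
  have "homog w (u i) (generic_iterate a b c d 0 i j)" for j
    using homog_mvar[of w "(i, j)"] assms by (simp add: generic_point_def)
  then show ?case by blast
next
  case (Suc m)
  then show ?case unfolding generic_iterate_Suc by (meson homog_line_meet)
qed

lemma generic_iterate_multihomogeneous: "\<exists>\<delta>. \<forall>j. multihomogeneous \<delta> (generic_iterate a b c d m i j)"
proof -
  have "\<forall>k. \<exists>n. \<forall>j. homog (site_wt k) n (generic_iterate a b c d m i j)"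
    using generic_iterate_homog[of "site_wt _" "\<lambda>s. if s = _ then 1 else 0"] by simp
  then show ?thesis unfolding multihomogeneous_iff by metis
qed

lemma generic_iterate_homogeneous: "homogeneous (4 ^ m) (generic_iterate a b c d m i j)"
proof (induction m arbitrary: i j)
  case 0
  show ?case using homog_mvar[of "\<lambda>_. 1" "(i, j)"] by (simp add: generic_point_def)
next
  case (Suc m)
  have "homogeneous (4 ^ m + 4 ^ m + (4 ^ m + 4 ^ m)) (generic_iterate a b c d (Suc m) i j)"
    unfolding generic_iterate_Suc by (intro homog_line_meet Suc.IH)
  moreover have "4 ^ m + 4 ^ m + (4 ^ m + 4 ^ m) = (4 :: nat) ^ Suc m" by simp
  ultimately show ?case by (simp only:)
qed

lemma mdegree_homogeneous:
  assumes "homogeneous n p" "p \<noteq> 0"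
  shows "mdegree p = n"
proof -
  have "(\<lambda>m. \<Sum>x \<in> Poly_Mapping.keys m. Poly_Mapping.lookup m x) ` Poly_Mapping.keys p \<subseteq> {n}"
    using assms(1) by (auto simp: homog_def weight_def)
  moreover have "Poly_Mapping.keys p \<noteq> {}"
    using assms(2) by (metis in_keys_iff lookup_zero poly_mapping_eqI empty_iff)
  ultimately have "(\<lambda>m. \<Sum>x \<in> Poly_Mapping.keys m. Poly_Mapping.lookup m x) ` Poly_Mapping.keys p = {n}"
    by blast
  then show ?thesis by (simp add: mdegree_def)
qed

lemma homogeneous_if_multihomogeneous:
  fixes p :: "('n::finite) mpoly"
  assumes "multihomogeneous \<delta> p" "finite S" "mvars p \<subseteq> S \<times> UNIV"
  shows "homogeneous (\<Sum>i\<in>S. \<delta> i) p"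
  unfolding homog_def
proof
  fix m assume m: "m \<in> Poly_Mapping.keys p"
  then have "Poly_Mapping.keys m \<subseteq> S \<times> UNIV" using assms(3) by (auto simp: mvars_def)
  then have "weight (\<lambda>_. 1) m = (\<Sum>x\<in>S \<times> UNIV. Poly_Mapping.lookup m x)"
    using assms(2) by (subst weight_superset[of "S \<times> UNIV"]) auto
  also have "\<dots> = (\<Sum>i\<in>S. \<Sum>j\<in>UNIV. Poly_Mapping.lookup m (i, j))"
    by (simp add: sum.cartesian_product)
  also have "\<dots> = (\<Sum>i\<in>S. \<delta> i)"
    using assms(1) m by (auto simp: multihomogeneous_def)
  finally show "weight (\<lambda>_. 1) m = (\<Sum>i\<in>S. \<delta> i)" .
qed

section \<open>Absence of common factors\<close>

lemma meval_scale_homogeneous: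
  fixes p :: "'n mpoly"
  assumes "homogeneous n p"
  shows "meval (\<lambda>x. k * f x) p = k ^ n * meval f p"
proof -
  have "monom_value (\<lambda>x. k * f x) m = k ^ weight (\<lambda>_. 1) m * monom_value f m" for m :: "(int \<times> 'n) \<Rightarrow>\<^sub>0 nat"
    by (simp add: monom_value_def power_mult_distrib prod.distrib weight_def power_sum)
  then show ?thesis
    using assms by (simp add: meval_eq_phom phom_def homog_def sum_distrib_left mult_ac)
qed

text \<open>
  On each of the two affine charts of the line \<open>h\<close> is a polynomial in one complex variable without zeros,
  hence constant. Comparing the charts at one point gives \<open>2 ^ n = 1\<close>.
\<close>

lemma nonvanishing_on_line_imp_const:
  assumes h: "homogeneous n h"
    and nz: "\<And>s t :: complex. s \<noteq> 0 \<or> t \<noteq> 0 \<Longrightarrow> meval (\<lambda>x. s * \<alpha> x + t * \<beta> x) h \<noteq> 0"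
  shows "n = 0"
proof -
  define v where "v s t = meval (\<lambda>x. s * \<alpha> x + t * \<beta> x) h" for s t
  have const: "poly P x = poly P 0" if "\<And>z :: complex. poly P z \<noteq> 0" for P x
  proof -
    have "constant (poly P)" using fundamental_theorem_of_algebra[of P] that by blast
    then show ?thesis unfolding constant_def by blast
  qed
  have t: "v 1 t = v 1 0" for t
  proof -
    define P where "P = phom (\<lambda>c. [:c:]) (\<lambda>x. [:\<alpha> x, \<beta> x:]) h"
    have P: "v 1 t = poly P t" for t
      by (simp add: P_def poly_peval v_def)
    have "poly P z \<noteq> 0" for z using nz[of 1 z] unfolding P[symmetric] v_def by simp
    from const[OF this] show ?thesis unfolding P by blast
  qed
  have s: "v s 1 = v 0 1" for s
  proof -
    define P where "P = phom (\<lambda>c. [:c:]) (\<lambda>x. [:\<beta> x, \<alpha> x:]) h"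
    have P: "v s 1 = poly P s" for s
      by (simp add: P_def poly_peval v_def add.commute)
    have "poly P z \<noteq> 0" for z using nz[of z 1] unfolding P[symmetric] v_def by simp
    from const[OF this] show ?thesis unfolding P by blast
  qed
  \<comment> \<open>The point with parameters (1, 2) is twice the one with parameters (1/2, 1).\<close>
  have "v 1 2 = 2 ^ n * v (1/2) 1"
    using meval_scale_homogeneous[OF h, of 2 "\<lambda>x. 1/2 * \<alpha> x + 1 * \<beta> x"]
    by (simp add: v_def distrib_left)
  also have "v (1/2) 1 = v 1 2" using s[of "1/2"] s[of 1] t[of 1] t[of 2] by simp
  finally have "2 ^ n = (1 :: complex)" using nz[of 1 2] by (simp add: v_def)
  then have "norm ((2 :: complex) ^ n) = 1" by simp
  then have "(2 :: real) ^ n = 1" by (simp add: norm_power)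
  then show "n = 0" using one_less_power[of "2 :: real" n] by (cases "n = 0") simp_all
qed

lemma homogeneous_0_const:
  assumes "homogeneous 0 (h :: 'n mpoly)"
  obtains x where "h = mconst x"
proof -
  have "m = 0" if "m \<in> Poly_Mapping.keys h" for m
    using that assms by (intro poly_mapping_eqI) (auto simp: homog_def weight_def in_keys_iff)
  then have "h = mconst (Poly_Mapping.lookup h 0)"
    by (intro poly_mapping_eqI) (auto simp: mconst_def lookup_single when_def in_keys_iff)
  then show ?thesis by (rule that)
qed

lemma mpoly_unit_if_const:
  assumes "homogeneous 0 (h :: 'n mpoly)" "h \<noteq> 0"
  shows "h dvd 1"
proof -
  obtain x where h: "h = mconst x" by (rule homogeneous_0_const[OF assms(1)])
  then have "x \<noteq> 0" using assms(2) by (auto simp: mconst_def)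
  then have "h * mconst (1 / x) = 1" by (simp add: h mconst_def mult_single)
  then show ?thesis by (metis dvd_triv_left)
qed

text \<open>
  A common factor is again homogeneous and its zeros are common zeros of the tuple. It suffices to find
  one line in the space of all coordinates, spanned by \<open>\<alpha>\<close> and \<open>\<beta>\<close>, that contains no common zero.
\<close>

lemma no_common_factor_if_nonvanishing_on_line:
  assumes hom: "\<And>j. homogeneous N (G j)"
    and nz: "\<And>s t :: complex. s \<noteq> 0 \<or> t \<noteq> 0 \<Longrightarrow> \<exists>j. meval (\<lambda>x. s * \<alpha> x + t * \<beta> x) (G j) \<noteq> 0"
  shows "no_common_factor (G :: 'n tuple)"
  unfolding no_common_factor_def
proof (intro allI impI)
  fix h assume h: "\<forall>j. h dvd G j"
  obtain j0 where "G j0 \<noteq> 0" using nz[of 1 0] by fastforce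
  moreover from h obtain q where q: "G j0 = h * q" by (metis dvdE)
  ultimately have "h \<noteq> 0" "q \<noteq> 0" by auto
  from homog_factor[OF hom[of j0, unfolded q] this] obtain n where n: "homogeneous n h" by metis
  have "meval (\<lambda>x. s * \<alpha> x + t * \<beta> x) h \<noteq> 0" if st: "s \<noteq> 0 \<or> t \<noteq> 0" for s t :: complex
  proof -
    obtain j where "meval (\<lambda>x. s * \<alpha> x + t * \<beta> x) (G j) \<noteq> 0" using nz[OF st] by blast
    moreover have "h dvd G j" using h by blast
    ultimately show ?thesis by (auto simp: dvd_def meval.phom_mult)
  qed
  from nonvanishing_on_line_imp_const[OF n this] have "n = 0" by blast
  with n \<open>h \<noteq> 0\<close> show "h dvd 1" by (simp add: mpoly_unit_if_const)
qed

section \<open>Dependence on the choice of homogeneous coordinates\<close>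

lemma meval_rescale_sites:
  fixes p :: "('n::finite) mpoly"
  assumes "multihomogeneous \<delta> p" "finite S" "mvars p \<subseteq> S \<times> UNIV"
  shows "meval (\<lambda>(s, k). r s * f (s, k)) p = (\<Prod>s\<in>S. r s ^ \<delta> s) * meval f p"
proof -
  have "monom_value (\<lambda>(s, k). r s * f (s, k)) m = (\<Prod>s\<in>S. r s ^ \<delta> s) * monom_value f m"
    if m: "m \<in> Poly_Mapping.keys p" for m
  proof -
    have sub: "Poly_Mapping.keys m \<subseteq> S \<times> UNIV" using m assms(3) by (auto simp: mvars_def)
    have "monom_value (\<lambda>x. r (fst x)) m = (\<Prod>x\<in>S \<times> UNIV. r (fst x) ^ Poly_Mapping.lookup m x)"
      using assms(2) sub by (intro monom_value_superset) simp_all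
    also have "\<dots> = (\<Prod>s\<in>S. \<Prod>k\<in>UNIV. r s ^ Poly_Mapping.lookup m (s, k))"
      by (simp add: prod.cartesian_product case_prod_unfold)
    also have "\<dots> = (\<Prod>s\<in>S. r s ^ \<delta> s)"
      using assms(1) m by (simp add: power_sum[symmetric] multihomogeneous_def)
    finally have "monom_value (\<lambda>x. r (fst x)) m = (\<Prod>s\<in>S. r s ^ \<delta> s)" .
    moreover have "monom_value (\<lambda>(s, k). r s * f (s, k)) m = monom_value (\<lambda>x. r (fst x)) m * monom_value f m"
      by (simp add: monom_value_def case_prod_unfold power_mult_distrib prod.distrib)
    ultimately show ?thesis by simp
  qed
  then show ?thesis
    by (simp add: meval_eq_phom phom_def sum_distrib_left mult_ac)
qed

text \<open>
  The homogeneous coordinates of a point are an arbitrary choice; a local rule only notices it through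
  one nonzero factor common to all components.
\<close>

lemma meval_rescaled_tuple:
  fixes F :: "('n::finite) tuple"
  assumes "local_rule S F" "\<And>s. r s \<noteq> 0"
  obtains K where "K \<noteq> 0" "\<And>j. meval (\<lambda>(s, k). r s * f (s, k)) (F j) = K * meval f (F j)"
proof -
  obtain \<delta> where "finite S" "\<forall>j. multihomogeneous \<delta> (F j)" "\<forall>j. mvars (F j) \<subseteq> S \<times> UNIV"
    using assms(1) by (auto simp: local_rule_def)
  then have "meval (\<lambda>(s, k). r s * f (s, k)) (F j) = (\<Prod>s\<in>S. r s ^ \<delta> s) * meval f (F j)" for j
    by (simp add: meval_rescale_sites)
  moreover have "(\<Prod>s\<in>S. r s ^ \<delta> s) \<noteq> 0" using assms(2) \<open>finite S\<close> by simp
  ultimately show ?thesis by (rule that[rotated])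
qed

section \<open>The rule of a skew pentagram map\<close>

definition skew_rule :: "int \<Rightarrow> int \<Rightarrow> int \<Rightarrow> int \<Rightarrow> 3 tuple" where
  "skew_rule a b c d = line_meet (generic_point a) (generic_point b) (generic_point c) (generic_point d)"

lemma skew_rule_eq_generic_iterate: "skew_rule a b c d = generic_iterate a b c d 1 0"
  using generic_iterate_Suc[of a b c d 0 0] by (simp add: skew_rule_def fun_eq_iff)

lemma tuple_value_eq: "tuple_value F v $ j = meval (\<lambda>(s, k). pcoords (v s) k) (F j)"
  by (simp add: tuple_value_def pcoords_def)

lemma tuple_value_skew_rule: "tuple_value (skew_rule a b c d) v =
    (\<chi> j. line_meet (pcoords (v a)) (pcoords (v b)) (pcoords (v c)) (pcoords (v d)) j)"
  by (simp add: Finite_Cartesian_Product.vec_eq_iff tuple_value_eq skew_rule_def meval_line_meet generic_point_def)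

lemma in_indet_skew_rule_iff: "v \<in> indet (skew_rule a b c d) \<longleftrightarrow>
    line_meet (pcoords (v a)) (pcoords (v b)) (pcoords (v c)) (pcoords (v d)) = (\<lambda>_. 0)"
  by (simp add: indet_def tuple_value_skew_rule Finite_Cartesian_Product.vec_eq_iff fun_eq_iff)

lemma lattice_map_skew_rule: "lattice_map (skew_rule a b c d) = skew_pentagram a b c d"
proof
  fix v :: "int \<Rightarrow> 3 proj"
  have def: "(\<lambda>s. v (i + s)) \<notin> indet (skew_rule a b c d) \<longleftrightarrow>
      v (i + a) \<noteq> v (i + b) \<and> v (i + c) \<noteq> v (i + d) \<and>
      line (v (i + a)) (v (i + b)) \<noteq> line (v (i + c)) (v (i + d))" for i
    unfolding in_indet_skew_rule_iff by (rule line_meet_nonzero_iff)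
  show "lattice_map (skew_rule a b c d) v = skew_pentagram a b c d v"
  proof (cases "\<forall>i. (\<lambda>s. v (i + s)) \<notin> indet (skew_rule a b c d)")
    case True
    have "rule_map (skew_rule a b c d) (\<lambda>s. v (i + s)) =
        (THE p. p \<in> line (v (i + a)) (v (i + b)) \<inter> line (v (i + c)) (v (i + d)))" for i
      unfolding rule_map_def tuple_value_skew_rule
      by (rule line_meet_is_intersection[symmetric]) (use True in \<open>simp add: in_indet_skew_rule_iff\<close>)
    then show ?thesis
      using True unfolding lattice_map_def skew_pentagram_def def by simp
  next
    case False
    then show ?thesis unfolding lattice_map_def skew_pentagram_def def by (simp only: if_False)
  qed
qed

lemma mvar_nonzero: "mvar x \<noteq> 0"
proof
  assume "mvar x = 0"
  then have "meval (\<lambda>_. 1) (mvar x) = 0" by simp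
  then show False by simp
qed

lemma local_rule_generic_point: "local_rule {0} (generic_point 0)"
  unfolding local_rule_def
proof (intro conjI)
  show "\<exists>\<delta>. \<forall>j. multihomogeneous \<delta> (generic_point 0 j)"
    using generic_iterate_multihomogeneous[of 0 0 0 0 0 0] by simp
  have hom: "homogeneous 1 (generic_point 0 j)" for j
    using generic_iterate_homogeneous[of 0 0 0 0 0 0 j] by simp
  define \<alpha> :: "int \<times> 3 \<Rightarrow> complex" where "\<alpha> x = (if snd x = 1 then 1 else 0)" for x
  define \<beta> :: "int \<times> 3 \<Rightarrow> complex" where "\<beta> x = (if snd x = 2 then 1 else 0)" for x
  show "no_common_factor (generic_point 0)"
  proof (rule no_common_factor_if_nonvanishing_on_line[where \<alpha> = \<alpha> and \<beta> = \<beta>, OF hom])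
    fix s t :: complex assume "s \<noteq> 0 \<or> t \<noteq> 0"
    then have "meval (\<lambda>x. s * \<alpha> x + t * \<beta> x) (generic_point 0 1) \<noteq> 0 \<or> meval (\<lambda>x. s * \<alpha> x + t * \<beta> x) (generic_point 0 2) \<noteq> 0"
      by (simp add: generic_point_def \<alpha>_def \<beta>_def)
    then show "\<exists>j. meval (\<lambda>x. s * \<alpha> x + t * \<beta> x) (generic_point 0 j) \<noteq> 0" by blast
  qed
  show "\<exists>j. generic_point 0 j \<noteq> 0"
    by (simp add: generic_point_def mvar_nonzero)
qed (simp_all add: generic_point_def)

lemma lattice_map_generic_point: "lattice_map (generic_point 0 :: 3 tuple) = Some"
proof
  fix v :: "int \<Rightarrow> 3 proj"
  have val: "tuple_value (generic_point 0) w = hcoords (w 0)" for w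
    by (simp add: Finite_Cartesian_Product.vec_eq_iff tuple_value_eq generic_point_def pcoords_def)
  show "lattice_map (generic_point 0) v = Some v"
    by (simp add: lattice_map_def indet_def rule_map_def val hcoords(1) proj_point_hcoords)
qed

section \<open>Iterates from reduced tuples\<close>

lemma rule_subst_skew_rule:
  "rule_subst (skew_rule a b c d) H =
     line_meet (\<lambda>k. mshift a (H k)) (\<lambda>k. mshift b (H k)) (\<lambda>k. mshift c (H k)) (\<lambda>k. mshift d (H k))"
  by (simp add: fun_eq_iff rule_subst_def skew_rule_def msubst_line_meet generic_point_def msubst_hom)

lemma rule_subst_generic_iterate:
  "rule_subst (skew_rule a b c d) (generic_iterate a b c d m 0) = generic_iterate a b c d (Suc m) 0"
  by (simp add: fun_eq_iff rule_subst_skew_rule mshift_generic_iterate generic_iterate_Suc)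

text \<open>
  Proportionality in the form of vanishing minors is hard to substitute into; a common multiple of
  both tuples is preserved by multilinear constructions.
\<close>

lemma proportional_common_multiple:
  fixes H P :: "'n tuple"
  assumes "proportional H P" "\<exists>j. P j \<noteq> 0" "\<exists>j. H j \<noteq> 0"
  obtains \<alpha> \<beta> where "\<alpha> \<noteq> 0" "\<beta> \<noteq> 0" "\<And>j. \<alpha> * H j = \<beta> * P j"
proof -
  obtain j0 where j0: "P j0 \<noteq> 0" using assms(2) by blast
  have eq: "P j0 * H k = H j0 * P k" for k
    using assms(1) by (simp add: proportional_def mult.commute[of "P j0"])
  have "H j0 \<noteq> 0"
  proof
    assume "H j0 = 0"
    then have "P j0 * H k = 0" for k using eq by simp
    then have "H k = 0" for k using mpoly_mult_nonzero[OF j0, of "H k"] by blast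
    with assms(3) show False by blast
  qed
  with j0 eq show ?thesis using that[of "P j0" "H j0"] by blast
qed

lemma rule_subst_common_multiple:
  fixes H P :: "3 tuple"
  assumes "proportional H P" "\<exists>j. P j \<noteq> 0" "\<exists>j. H j \<noteq> 0"
  obtains \<alpha> \<beta> where "\<alpha> \<noteq> 0" "\<beta> \<noteq> 0"
    "\<And>j. \<alpha> * rule_subst (skew_rule a b c d) H j = \<beta> * rule_subst (skew_rule a b c d) P j"
proof -
  obtain \<alpha> \<beta> where ab: "\<alpha> \<noteq> 0" "\<beta> \<noteq> 0" "\<And>j. \<alpha> * H j = \<beta> * P j"
    by (rule proportional_common_multiple[OF assms]) blast
  define A where "A = mshift a \<alpha> * mshift b \<alpha> * mshift c \<alpha> * mshift d \<alpha>"
  define B where "B = mshift a \<beta> * mshift b \<beta> * mshift c \<beta> * mshift d \<beta>"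
  have "mshift e \<alpha> * mshift e (H k) = mshift e \<beta> * mshift e (P k)" for e k
    using ab(3)[of k] by (simp add: mshift_def msubst_hom(3)[symmetric])
  then have "A * rule_subst (skew_rule a b c d) H j = B * rule_subst (skew_rule a b c d) P j" for j
    unfolding rule_subst_skew_rule A_def B_def
    using fun_cong[OF line_meet_scale[of "mshift a \<alpha>" "\<lambda>k. mshift a (H k)" "mshift b \<alpha>" "\<lambda>k. mshift b (H k)"
        "mshift c \<alpha>" "\<lambda>k. mshift c (H k)" "mshift d \<alpha>" "\<lambda>k. mshift d (H k)"], of j]
      fun_cong[OF line_meet_scale[of "mshift a \<beta>" "\<lambda>k. mshift a (P k)" "mshift b \<beta>" "\<lambda>k. mshift b (P k)"
        "mshift c \<beta>" "\<lambda>k. mshift c (P k)" "mshift d \<beta>" "\<lambda>k. mshift d (P k)"], of j]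
    by simp
  moreover have "A \<noteq> 0" "B \<noteq> 0"
    using ab(1,2) unfolding A_def B_def by (simp_all add: mpoly_mult_nonzero mshift_nonzero)
  ultimately show ?thesis by (intro that)
qed

text \<open>
  At a configuration where one component of the composite and the shifts of one component of \<open>H\<close> do not
  vanish, nothing is indeterminate. Such configurations exist since a product of nonzero polynomials
  is nonzero.
\<close>

lemma rules_composable_if_rule_subst_nonzero:
  fixes H :: "3 tuple"
  assumes H: "local_rule S H" and nz: "\<exists>j. rule_subst (skew_rule a b c d) H j \<noteq> 0"
  shows "rules_composable {a, b, c, d} (skew_rule a b c d) H"
proof -
  obtain j0 where j0: "H j0 \<noteq> 0" using H by (auto simp: local_rule_def)
  obtain j1 where j1: "rule_subst (skew_rule a b c d) H j1 \<noteq> 0" using nz by blast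
  \<comment> \<open>Its nonvanishing collects all the conditions on the configuration.\<close>
  define Q where "Q = rule_subst (skew_rule a b c d) H j1 * (\<Prod>i\<in>{a, b, c, d}. mshift i (H j0))"
  have "Q \<noteq> 0" unfolding Q_def
    by (intro mpoly_mult_nonzero mpoly_prod_nonzero j1 mshift_nonzero j0)
  then obtain f where f: "\<And>x. f x \<noteq> 0" "meval f Q \<noteq> 0" by (rule meval_generic) blast
  have f1: "meval f (rule_subst (skew_rule a b c d) H j1) \<noteq> 0"
    using f(2) unfolding Q_def meval.phom_mult by (rule mult_not_zero[THEN conjunct1])
  have prod: "(\<Prod>i\<in>{a, b, c, d}. meval f (mshift i (H j0))) \<noteq> 0"
    using f(2) unfolding Q_def meval.phom_mult meval.phom_prod by (rule mult_not_zero[THEN conjunct2])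
  have f0: "meval f (mshift i (H j0)) \<noteq> 0" if "i \<in> {a, b, c, d}" for i
  proof
    assume "meval f (mshift i (H j0)) = 0"
    with that have "(\<Prod>i\<in>{a, b, c, d}. meval f (mshift i (H j0))) = 0"
      by (intro prod_zero) blast+
    with prod show False ..
  qed
  define v :: "int \<Rightarrow> 3 proj" where "v s = proj_point (\<chi> k. f (s, k))" for s
  have "\<exists>r. r \<noteq> 0 \<and> pcoords (v s) = (\<lambda>k. r * f (s, k))" for s
  proof -
    have "(\<lambda>k. f (s, k)) \<noteq> (\<lambda>_. 0)" using f(1) by (simp add: fun_eq_iff)
    from pcoords_proj_point[OF this] show ?thesis unfolding v_def by blast
  qed
  then obtain r where r: "\<And>s. r s \<noteq> 0" "\<And>s. pcoords (v s) = (\<lambda>k. r s * f (s, k))" by metis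
  define g where "g i k = meval f (mshift i (H k))" for i k
  have "\<exists>K. K \<noteq> 0 \<and> (\<forall>j. tuple_value H (\<lambda>s. v (i + s)) $ j = K * g i j)" for i
  proof -
    obtain K where "K \<noteq> 0" "\<And>j. meval (\<lambda>(s, k). r (i + s) * f (i + s, k)) (H j) =
        K * meval (\<lambda>(s, k). f (i + s, k)) (H j)"
      using meval_rescaled_tuple[OF H, of "\<lambda>s. r (i + s)" "\<lambda>(s, k). f (i + s, k)"] r(1) by auto
    then show ?thesis by (auto simp: tuple_value_eq r(2) g_def meval_mshift)
  qed
  then obtain K where K: "\<And>i. K i \<noteq> 0" "\<And>i j. tuple_value H (\<lambda>s. v (i + s)) $ j = K i * g i j"
    by metis
  have def: "(\<lambda>s. v (i + s)) \<notin> indet H" if "i \<in> {a, b, c, d}" for i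
  proof -
    have "tuple_value H (\<lambda>s. v (i + s)) $ j0 \<noteq> 0"
      using K(1)[of i] f0[OF that] by (simp add: K(2) g_def)
    then show ?thesis unfolding indet_def by force
  qed
  define u where "u = (\<lambda>i. rule_map H (\<lambda>s. v (i + s)))"
  have "\<exists>l. l \<noteq> 0 \<and> pcoords (u i) = (\<lambda>k. l * g i k)" if "i \<in> {a, b, c, d}" for i
  proof -
    have ne: "(\<lambda>k. K i * g i k) \<noteq> (\<lambda>_. 0)"
      using f0[OF that] K(1)[of i] by (auto simp: fun_eq_iff g_def)
    have "tuple_value H (\<lambda>s. v (i + s)) = (\<chi> k. K i * g i k)" by (simp add: Finite_Cartesian_Product.vec_eq_iff K(2))
    then have "u i = proj_point (\<chi> k. K i * g i k)" by (simp add: u_def rule_map_def)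
    then obtain l where "l \<noteq> 0" "pcoords (u i) = (\<lambda>k. l * (K i * g i k))"
      using pcoords_proj_point[OF ne] by auto
    then show ?thesis using K(1)[of i] by (intro exI[of _ "l * K i"]) (simp add: mult.assoc)
  qed
  then have "\<forall>i\<in>{a, b, c, d}. \<exists>l. l \<noteq> 0 \<and> pcoords (u i) = (\<lambda>k. l * g i k)" by blast
  then have "\<exists>l. \<forall>i\<in>{a, b, c, d}. l i \<noteq> 0 \<and> pcoords (u i) = (\<lambda>k. l i * g i k)" by (rule bchoice)
  then obtain l where l0: "\<forall>i\<in>{a, b, c, d}. l i \<noteq> 0 \<and> pcoords (u i) = (\<lambda>k. l i * g i k)" ..
  have l: "l i \<noteq> 0" "pcoords (u i) = (\<lambda>k. l i * g i k)" if "i \<in> {a, b, c, d}" for i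
    using bspec[OF l0 that] by simp_all
  have "line_meet (pcoords (u a)) (pcoords (u b)) (pcoords (u c)) (pcoords (u d)) j1 =
      l a * l b * l c * l d * line_meet (g a) (g b) (g c) (g d) j1"
    using l(2) by (simp add: line_meet_scale)
  moreover have "line_meet (g a) (g b) (g c) (g d) j1 = meval f (rule_subst (skew_rule a b c d) H j1)"
    by (simp add: rule_subst_skew_rule meval_line_meet g_def[abs_def])
  ultimately have "line_meet (pcoords (u a)) (pcoords (u b)) (pcoords (u c)) (pcoords (u d)) j1 \<noteq> 0"
    using l(1) f1 by simp
  then have "u \<notin> indet (skew_rule a b c d)"
    by (auto simp: in_indet_skew_rule_iff)
  with def show ?thesis unfolding rules_composable_def u_def by blast
qed

text \<open>
  Any sequence of reduced tuples proportional to the symbolic iterates describes the iterates: the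
  composition of one step with \<open>H m\<close> is proportional to the composition of one step with the symbolic
  iterate, and the latter is the next symbolic iterate.
\<close>

lemma skew_iterates:
  assumes F: "local_rule {a, b, c, d} (skew_rule a b c d)"
    and H0: "H 0 = generic_point 0"
    and H: "\<And>m. local_rule (sites {a, b, c, d} m) (H m)"
    and HP: "\<And>m. proportional (H m) (generic_iterate a b c d m 0)"
    and nz: "\<And>m. \<exists>j. generic_iterate a b c d m 0 j \<noteq> 0"
  shows "is_iterate (skew_pentagram a b c d) m (lattice_map (H m))"
proof (induction m)
  case 0
  show ?case unfolding H0 lattice_map_generic_point by (rule is_iterate.zero)
next
  case (Suc m)
  let ?F = "skew_rule a b c d" and ?P = "\<lambda>m. generic_iterate a b c d m 0"
  have Hnz: "\<exists>j. H m j \<noteq> 0" for m using H by (auto simp: local_rule_def)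
  obtain \<alpha> \<beta> where ab: "\<alpha> \<noteq> 0" "\<beta> \<noteq> 0" "\<And>j. \<alpha> * rule_subst ?F (H m) j = \<beta> * ?P (Suc m) j"
    using rule_subst_common_multiple[OF HP[of m] nz[of m] Hnz[of m], of a b c d]
    unfolding rule_subst_generic_iterate by blast
  have "\<exists>j. rule_subst ?F (H m) j \<noteq> 0"
  proof -
    obtain j where "?P (Suc m) j \<noteq> 0" using nz by blast
    then have "\<alpha> * rule_subst ?F (H m) j \<noteq> 0" unfolding ab(3) by (rule mpoly_mult_nonzero[OF ab(2)])
    then show ?thesis by (intro exI[of _ j]) auto
  qed
  then have "rules_composable {a, b, c, d} ?F (H m)"
    by (rule rules_composable_if_rule_subst_nonzero[OF H])
  moreover have "proportional (H (Suc m)) (rule_subst ?F (H m))"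
    unfolding proportional_def
  proof (intro allI)
    fix j k
    have "\<alpha> * (H (Suc m) j * rule_subst ?F (H m) k) = \<beta> * (H (Suc m) j * ?P (Suc m) k)"
      using ab(3)[of k] by (simp add: mult.left_commute[of _ "H (Suc m) j"])
    also have "\<dots> = \<beta> * (H (Suc m) k * ?P (Suc m) j)"
      using HP[of "Suc m"] by (simp add: proportional_def)
    also have "\<dots> = \<alpha> * (H (Suc m) k * rule_subst ?F (H m) j)"
      using ab(3)[of j] by (simp add: mult.left_commute[of _ "H (Suc m) k"])
    finally show "H (Suc m) j * rule_subst ?F (H m) k = H (Suc m) k * rule_subst ?F (H m) j"
      by (rule mpoly_mult_cancel_left[OF ab(1)])
  qed
  ultimately have "is_comp (skew_pentagram a b c d) (lattice_map (H m)) (lattice_map (H (Suc m)))"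
    unfolding is_comp_def has_local_rule_def
    using H[of m] F H[of "Suc m"] lattice_map_skew_rule[of a b c d]
    by (intro exI[of _ "sites {a, b, c, d} m"] exI[of _ "H m"] exI[of _ "{a, b, c, d}"]
        exI[of _ ?F] exI[of _ "H (Suc m)"]) simp
  with Suc show ?case by (rule is_iterate.Suc)
qed

lemma has_dynamical_degree_if_reduced_tuples:
  assumes F: "local_rule {a, b, c, d} (skew_rule a b c d)"
    and H0: "H 0 = generic_point 0"
    and H: "\<And>m. local_rule (sites {a, b, c, d} m) (H m)"
    and HP: "\<And>m. proportional (H m) (generic_iterate a b c d m 0)"
    and nz: "\<And>m. \<exists>j. generic_iterate a b c d m 0 j \<noteq> 0"
    and deg: "\<And>m j. H m j \<noteq> 0 \<Longrightarrow> mdegree (H m j) = D m"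
    and lim: "(\<lambda>m. root m (real (D m))) \<longlonglongrightarrow> l"
  shows "has_dynamical_degree (skew_pentagram a b c d) l"
proof -
  note it = skew_iterates[OF F H0 H HP nz]
  have "has_degree (lattice_map (H m)) (D m)" for m
  proof -
    obtain j where "H m j \<noteq> 0" using H[of m] by (auto simp: local_rule_def)
    then have "has_local_rule (lattice_map (H m)) (sites {a, b, c, d} m) (H m) \<and> H m j \<noteq> 0 \<and>
        D m = mdegree (H m j)"
      using H[of m] deg by (simp add: has_local_rule_def)
    then show ?thesis unfolding has_degree_def by blast
  qed
  with it lim show ?thesis
    unfolding has_dynamical_degree_def iterable_def by blast
qed

section \<open>Three-torsion points and tangents in the Hesse pencil\<close>

definition vec3 :: "'r \<Rightarrow> 'r \<Rightarrow> 'r \<Rightarrow> 3 \<Rightarrow> 'r" where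
  "vec3 x y z = (\<lambda>j. if j = 1 then x else if j = 2 then y else z)"

lemma vec3_simps [simp]: "vec3 x y z 1 = x" "vec3 x y z 2 = y" "vec3 x y z 3 = z"
  by (simp_all add: vec3_def)

definition omega :: complex where
  "omega = Complex (-1/2) (sqrt 3 / 2)"

lemma omega_square: "omega * omega = - 1 - omega"
  by (simp add: omega_def complex_eq_iff)

text \<open>
  Let \<open>X\<close> be the cyclic shift of coordinates and \<open>Z\<close> the diagonal matrix with entries \<open>1, \<omega>, \<omega>\<^sup>2\<close>. On every cubic
  \<open>x\<^sup>3 + y\<^sup>3 + z\<^sup>3 = \<mu> x y z\<close> the matrices \<open>X\<^sup>p Z\<^sup>q\<close> act as the translations by the nine 3-torsion points. The
  line for \<open>r\<close> is \<open>X\<^sup>p Z\<^sup>q\<close> for the coordinates \<open>\<theta>\<^sup>r = p + q \<theta>\<close> in the field with nine elements, up to a scalar: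
  \<open>(1,0), (0,1), (1,1), (1,2), (2,0), (0,2), (2,2), (2,1)\<close> for \<open>r = 0, \<dots>, 7\<close>.
\<close>

definition heisenberg_residue :: "int \<Rightarrow> (3 \<Rightarrow> complex) \<Rightarrow> 3 \<Rightarrow> complex" where
  "heisenberg_residue r P =
     (if r = 0 then vec3 (P 2) (P 3) (P 1)
      else if r = 1 then vec3 (P 1) (omega * P 2) (omega * omega * P 3)
      else if r = 2 then vec3 (omega * P 2) (omega * omega * P 3) (P 1)
      else if r = 3 then vec3 (omega * omega * P 2) (omega * P 3) (P 1)
      else if r = 4 then vec3 (P 3) (P 1) (P 2)
      else if r = 5 then vec3 (P 1) (omega * omega * P 2) (omega * P 3)
      else if r = 6 then vec3 (omega * P 3) (P 1) (omega * omega * P 2)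
      else vec3 (omega * omega * P 3) (P 1) (omega * P 2))"

definition heisenberg :: "int \<Rightarrow> (3 \<Rightarrow> complex) \<Rightarrow> 3 \<Rightarrow> complex" where
  "heisenberg i = heisenberg_residue (i mod 8)"

text \<open>
  The remaining intersection of the tangent at \<open>P\<close> to the cubic of the Hesse pencil through \<open>P\<close>, that is,
  \<open>- 2 P\<close> in the group law. The formula does not involve the parameter of the cubic.
\<close>

definition tangential :: "(3 \<Rightarrow> complex) \<Rightarrow> 3 \<Rightarrow> complex" where
  "tangential P = vec3 (P 1 * (P 2 ^ 3 - P 3 ^ 3)) (P 2 * (P 3 ^ 3 - P 1 ^ 3)) (P 3 * (P 1 ^ 3 - P 2 ^ 3))"

definition heisenberg_factor :: "int \<Rightarrow> complex" where
  "heisenberg_factor r = (if r = 0 \<or> r = 4 then 2 * omega + 1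
     else if r = 2 \<or> r = 6 then - 2 - omega else - (2 * omega + 1))"

lemma omega_nonzero_combinations: "omega \<noteq> 0" "2 * omega + 1 \<noteq> 0" "- 2 - omega \<noteq> 0"
  by (simp_all add: omega_def complex_eq_iff)

lemma heisenberg_factor_nonzero: "heisenberg_factor r \<noteq> 0"
  using omega_nonzero_combinations by (simp add: heisenberg_factor_def del: minus_add_distrib)

lemma residues_mod_8: "(i :: int) mod 8 \<in> {0, 1, 2, 3, 4, 5, 6, 7}"
proof -
  have "0 \<le> i mod 8" "i mod 8 < 8" by simp_all
  then show ?thesis by auto
qed

text \<open>
  The lines through \<open>P + 1, P + \<theta>\<^sup>2\<close> and through \<open>P + \<theta>, P + \<theta>\<^sup>4\<close> have a third point of the cubic in common,
  because \<open>1 + \<theta>\<^sup>2 = \<theta> + \<theta>\<^sup>4\<close>. It is \<open>- 2 P - (1 + \<theta>\<^sup>2) = - 2 P + \<theta>\<^sup>3\<close>, and multiplying all torsion points by \<open>\<theta>\<^sup>r\<close>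
  gives the general case. The proof just expands the resulting polynomial identities.
\<close>

lemma line_meet_heisenberg_residue:
  assumes "r \<in> {0, 1, 2, 3, 4, 5, 6, 7}"
  shows "line_meet (heisenberg_residue r P) (heisenberg_residue ((r + 2) mod 8) P)
      (heisenberg_residue ((r + 1) mod 8) P) (heisenberg_residue ((r + 4) mod 8) P) =
    (\<lambda>j. heisenberg_factor r * heisenberg_residue ((r + 3) mod 8) (tangential P) j)"
proof -
  have w: "omega * omega = - 1 - omega" by (rule omega_square)
  have w': "omega * (omega * x) = - x - omega * x" for x
    using w by (simp flip: mult.assoc add: left_diff_distrib)
  note expand = heisenberg_residue_def heisenberg_factor_def tangential_def cross_simps line_meet_def fun3_eq_iff
    power3_eq_cube w w'
  consider "r = 0" | "r = 1" | "r = 2" | "r = 3" | "r = 4" | "r = 5" | "r = 6" | "r = 7"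
    using assms by auto
  then show ?thesis
    by cases (simp_all add: expand algebra_simps)
qed


lemma line_meet_heisenberg:
  "line_meet (heisenberg n P) (heisenberg (n + 2) P) (heisenberg (n + 1) P) (heisenberg (n + 4) P) =
    (\<lambda>j. heisenberg_factor (n mod 8) * heisenberg (n + 3) (tangential P) j)"
  using line_meet_heisenberg_residue[OF residues_mod_8[of n], of P] by (simp add: heisenberg_def mod_add_left_eq)

lemma heisenberg_linear: "heisenberg i (\<lambda>k. s * P k + t * Q k) j = s * heisenberg i P j + t * heisenberg i Q j"
  by (simp add: heisenberg_def heisenberg_residue_def vec3_def algebra_simps)

lemma heisenberg_periodic: "heisenberg (8 * k + i) = heisenberg i"
  by (simp add: heisenberg_def)

text \<open>
  The four triangles of the pencil have the vertices \<open>(1, 0, 0), (0, 1, 0), (0, 0, 1)\<close> and \<open>(1, \<omega>\<^sup>i, \<omega>\<^sup>j)\<close>; the zero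
  vector is excluded as well. These are the zeros of the tangential map.
\<close>

definition off_vertices :: "(3 \<Rightarrow> complex) \<Rightarrow> bool" where
  "off_vertices P \<longleftrightarrow> \<not> (P 1 = 0 \<and> P 2 = 0) \<and> \<not> (P 2 = 0 \<and> P 3 = 0) \<and> \<not> (P 1 = 0 \<and> P 3 = 0) \<and>
     \<not> (P 1 ^ 3 = P 2 ^ 3 \<and> P 2 ^ 3 = P 3 ^ 3)"

text \<open>
  With \<open>a, b, c\<close> for the cubes of the coordinates, this says that the tangential map does not reach the
  nine vertices \<open>(1, \<omega>\<^sup>i, \<omega>\<^sup>j)\<close>. If the common value \<open>k\<close> is nonzero, then the differences \<open>u, v, w\<close>, whose sum is
  \<open>0\<close>, turn out to have vanishing second elementary symmetric function. Hence they are proportional to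
  \<open>1, \<omega>, \<omega>\<^sup>2\<close> and have equal cubes, and this forces one of them to vanish.
\<close>

lemma no_equal_tangential_cubes:
  fixes a b c :: complex
  assumes eq: "a * (b - c) ^ 3 = b * (c - a) ^ 3" "b * (c - a) ^ 3 = c * (a - b) ^ 3"
  shows "a * (b - c) ^ 3 = 0"
proof (rule ccontr)
  define k where "k = a * (b - c) ^ 3"
  define u v w where "u = b - c" and "v = c - a" and "w = a - b"
  assume "a * (b - c) ^ 3 \<noteq> 0"
  then have k: "k \<noteq> 0" "a * u ^ 3 = k" "b * v ^ 3 = k" "c * w ^ 3 = k"
    using eq by (simp_all add: k_def u_def v_def w_def)
  then have nz: "u \<noteq> 0" "v \<noteq> 0" "w \<noteq> 0" by auto
  have 1: "u * v ^ 3 * w ^ 3 = k * w ^ 3 - k * v ^ 3"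
  proof -
    have "u * v ^ 3 * w ^ 3 = (b * v ^ 3) * w ^ 3 - (c * w ^ 3) * v ^ 3"
      unfolding u_def by (simp add: algebra_simps)
    then show ?thesis using k(3,4) by simp
  qed
  have 2: "v * w ^ 3 * u ^ 3 = k * u ^ 3 - k * w ^ 3"
  proof -
    have "v * w ^ 3 * u ^ 3 = (c * w ^ 3) * u ^ 3 - (a * u ^ 3) * w ^ 3"
      unfolding v_def by (simp add: algebra_simps)
    then show ?thesis using k(2,4) by simp
  qed
  have 3: "w * u ^ 3 * v ^ 3 = k * v ^ 3 - k * u ^ 3"
  proof -
    have "w * u ^ 3 * v ^ 3 = (a * u ^ 3) * v ^ 3 - (b * v ^ 3) * u ^ 3"
      unfolding w_def by (simp add: algebra_simps)
    then show ?thesis using k(2,3) by simp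
  qed
  have "u * v * w * (v\<^sup>2 * w\<^sup>2 + w\<^sup>2 * u\<^sup>2 + u\<^sup>2 * v\<^sup>2) = 0"
  proof -
    have "u * v * w * (v\<^sup>2 * w\<^sup>2 + w\<^sup>2 * u\<^sup>2 + u\<^sup>2 * v\<^sup>2) =
        u * v ^ 3 * w ^ 3 + v * w ^ 3 * u ^ 3 + w * u ^ 3 * v ^ 3"
      by (simp add: algebra_simps power2_eq_square power3_eq_cube)
    then show ?thesis unfolding 1 2 3 by simp
  qed
  moreover have u: "u = - v - w" by (simp add: u_def v_def w_def)
  moreover have "v\<^sup>2 * w\<^sup>2 + w\<^sup>2 * u\<^sup>2 + u\<^sup>2 * v\<^sup>2 = (v\<^sup>2 + v * w + w\<^sup>2)\<^sup>2"
    unfolding u by (simp add: algebra_simps power2_eq_square)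
  ultimately have "v\<^sup>2 + v * w + w\<^sup>2 = 0" using nz by simp
  moreover have "w ^ 3 - v ^ 3 = (w - v) * (v\<^sup>2 + v * w + w\<^sup>2)"
    by (simp add: algebra_simps power2_eq_square power3_eq_cube)
  ultimately have "w ^ 3 = v ^ 3" by simp
  then show False using 1 nz by simp
qed

lemma off_vertices_tangential:
  assumes "off_vertices P"
  shows "off_vertices (tangential P)"
proof -
  let ?Q = "tangential P"
  have "\<not> (?Q 1 = 0 \<and> ?Q 2 = 0)" "\<not> (?Q 2 = 0 \<and> ?Q 3 = 0)" "\<not> (?Q 1 = 0 \<and> ?Q 3 = 0)"
    using assms by (auto simp: off_vertices_def tangential_def)
  moreover have "\<not> (?Q 1 ^ 3 = ?Q 2 ^ 3 \<and> ?Q 2 ^ 3 = ?Q 3 ^ 3)"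
  proof
    assume eq: "?Q 1 ^ 3 = ?Q 2 ^ 3 \<and> ?Q 2 ^ 3 = ?Q 3 ^ 3"
    then have "?Q 1 ^ 3 = 0"
      using no_equal_tangential_cubes[of "P 1 ^ 3" "P 2 ^ 3" "P 3 ^ 3"]
      by (simp add: tangential_def power_mult_distrib)
    moreover from this eq have "?Q 2 ^ 3 = 0" by metis
    ultimately have "?Q 1 = 0 \<and> ?Q 2 = 0" by simp
    with \<open>\<not> (?Q 1 = 0 \<and> ?Q 2 = 0)\<close> show False by blast
  qed
  ultimately show ?thesis unfolding off_vertices_def by blast
qed

text \<open>
  The line \<open>x + y + 3 z = 0\<close> contains no vertex: on it, three coordinates of equal absolute value would
  have to vanish by the triangle inequality, and two vanishing coordinates force the third to vanish.
\<close>

lemma off_vertices_line: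
  assumes "s \<noteq> 0 \<or> t \<noteq> 0"
  shows "off_vertices (vec3 (3 * s) (3 * t) (- (s + t)))"
proof -
  have "\<not> ((3 * s) ^ 3 = (3 * t) ^ 3 \<and> (3 * t) ^ 3 = (- (s + t)) ^ 3)"
  proof
    assume eq: "(3 * s) ^ 3 = (3 * t) ^ 3 \<and> (3 * t) ^ 3 = (- (s + t)) ^ 3"
    have cube: "norm x = norm y" if "x ^ 3 = y ^ 3" for x y :: complex
      using that by (metis norm_power norm_ge_zero power_eq_imp_eq_base zero_less_numeral)
    have "norm (3 * s) = norm (3 * t)" "norm (3 * t) = norm (- (s + t))" using eq cube by blast+
    then have "norm s = norm t" "3 * norm t = norm (s + t)"
      by (simp_all add: norm_mult norm_minus_commute flip: norm_minus_cancel[of "s + t"])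
    then have "norm t \<le> 0" using norm_triangle_ineq[of s t] by linarith
    with \<open>norm s = norm t\<close> assms show False by simp
  qed
  moreover have "\<not> (t = 0 \<and> s + t = 0)" "\<not> (s = 0 \<and> s + t = 0)" using assms by auto
  ultimately show ?thesis using assms by (simp add: off_vertices_def add_eq_0_iff2)
qed

lemma heisenberg_nonzero:
  assumes "off_vertices P"
  obtains j where "heisenberg i P j \<noteq> 0"
proof -
  have "heisenberg_residue r P \<noteq> (\<lambda>_. 0)" for r
    using assms omega_nonzero_combinations(1)
    by (auto simp: off_vertices_def heisenberg_residue_def fun3_eq_iff)
  then show ?thesis using that unfolding heisenberg_def by blast
qed

text \<open>
  The configurations \<open>P + Q\<^sub>i\<close> are reproduced with \<open>P\<close> replaced by its tangential point and the indices of
  the torsion points advanced by \<open>3\<close>. The scalars \<open>l i\<close> have no geometric meaning; what matters is that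
  they are nonzero.
\<close>

lemma lattice_step_heisenberg_iterate:
  assumes "d mod 8 = 4"
  shows "\<exists>l. (\<forall>i. l i \<noteq> 0) \<and> (lattice_step 0 2 1 d ^^ m) (\<lambda>i. heisenberg i P) =
    (\<lambda>i j. l i * heisenberg (i + 3 * int m) ((tangential ^^ m) P) j)"
proof (induction m)
  case 0
  show ?case by (intro exI[of _ "\<lambda>_. 1"]) simp
next
  case (Suc m)
  then obtain l where l: "\<And>i. l i \<noteq> 0" and eq: "(lattice_step 0 2 1 d ^^ m) (\<lambda>i. heisenberg i P) =
      (\<lambda>i j. l i * heisenberg (i + 3 * int m) ((tangential ^^ m) P) j)" by blast
  define Q where "Q = (tangential ^^ m) P"
  define l' where "l' i = l i * l (i + 2) * l (i + 1) * l (i + d) * heisenberg_factor ((i + 3 * int m) mod 8)" for i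
  have "(lattice_step 0 2 1 d ^^ Suc m) (\<lambda>i. heisenberg i P) i j = l' i * heisenberg (i + 3 * int (Suc m)) (tangential Q) j" for i j
  proof -
    have d: "heisenberg (i + d + 3 * int m) = heisenberg (i + 3 * int m + 4)"
    proof -
      have "i + d + 3 * int m = 8 * (d div 8) + (i + 3 * int m + 4)"
        using assms mult_div_mod_eq[of 8 d] by linarith
      then show ?thesis using heisenberg_periodic by metis
    qed
    have "(lattice_step 0 2 1 d ^^ Suc m) (\<lambda>i. heisenberg i P) i j =
        l i * l (i + 2) * l (i + 1) * l (i + d) * line_meet (heisenberg (i + 3 * int m) Q) (heisenberg (i + 3 * int m + 2) Q)
          (heisenberg (i + 3 * int m + 1) Q) (heisenberg (i + 3 * int m + 4) Q) j"
      unfolding funpow.simps o_apply eq lattice_step_def line_meet_scale d Q_def[symmetric] by (simp add: add_ac)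
    then show ?thesis unfolding line_meet_heisenberg l'_def by (simp add: algebra_simps)
  qed
  moreover have "l' i \<noteq> 0" for i using l heisenberg_factor_nonzero by (simp add: l'_def)
  ultimately show ?case unfolding Q_def by (intro exI[of _ l']) (auto simp: fun_eq_iff)
qed

lemma no_common_factor_generic_iterate:
  assumes "d mod 8 = 4"
  shows "no_common_factor (generic_iterate 0 2 1 d m 0)" "\<exists>j. generic_iterate 0 2 1 d m 0 j \<noteq> 0"
proof -
  define \<alpha> \<beta> where "\<alpha> x = heisenberg (fst x) (vec3 3 0 (-1)) (snd x)"
    and "\<beta> x = heisenberg (fst x) (vec3 0 3 (-1)) (snd x)" for x :: "int \<times> 3"
  have nz: "\<exists>j. meval (\<lambda>x. s * \<alpha> x + t * \<beta> x) (generic_iterate 0 2 1 d m 0 j) \<noteq> 0"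
    if "s \<noteq> 0 \<or> t \<noteq> 0" for s t :: complex
  proof -
    define P where "P = vec3 (3 * s) (3 * t) (- (s + t))"
    have P: "P = (\<lambda>k. s * vec3 3 0 (-1) k + t * vec3 0 3 (-1) k)"
      by (simp add: P_def fun3_eq_iff)
    have "off_vertices P" unfolding P_def by (rule off_vertices_line[OF that])
    then have off: "off_vertices ((tangential ^^ m) P)"
      by (induction m) (simp_all add: off_vertices_tangential)
    obtain l where l: "\<And>i. l i \<noteq> 0" and eq: "(lattice_step 0 2 1 d ^^ m) (\<lambda>i. heisenberg i P) =
      (\<lambda>i j. l i * heisenberg (i + 3 * int m) ((tangential ^^ m) P) j)"
      using lattice_step_heisenberg_iterate[OF assms, of m P] by blast
    have val: "meval (\<lambda>x. s * \<alpha> x + t * \<beta> x) (generic_iterate 0 2 1 d m 0 j) =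
        l 0 * heisenberg (0 + 3 * int m) ((tangential ^^ m) P) j" for j
    proof -
      have "(\<lambda>i j. s * \<alpha> (i, j) + t * \<beta> (i, j)) = (\<lambda>i. heisenberg i P)"
        unfolding P \<alpha>_def \<beta>_def by (simp add: fun_eq_iff heisenberg_linear)
      then show ?thesis unfolding meval_generic_iterate by (simp add: eq)
    qed
    obtain j where "heisenberg (0 + 3 * int m) ((tangential ^^ m) P) j \<noteq> 0" by (rule heisenberg_nonzero[OF off])
    then show ?thesis using val[of j] l[of 0] by (intro exI[of _ j]) simp
  qed
  show "no_common_factor (generic_iterate 0 2 1 d m 0)"
    by (rule no_common_factor_if_nonvanishing_on_line[OF generic_iterate_homogeneous nz])
  obtain j where "meval (\<lambda>x. 1 * \<alpha> x + 0 * \<beta> x) (generic_iterate 0 2 1 d m 0 j) \<noteq> 0"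
    using nz[of 1 0] by auto
  then show "\<exists>j. generic_iterate 0 2 1 d m 0 j \<noteq> 0" by (intro exI[of _ j]) auto
qed

text \<open>
  A single step involves just four points, which may be taken from the torsion configuration for
  arbitrary distinct parameters; so the rule itself is reduced by the same argument.
\<close>

lemma local_rule_skew_rule:
  assumes "distinct [a, b, c, d]"
  shows "local_rule {a, b, c, d} (skew_rule a b c d)"
proof -
  \<comment> \<open>The sites a, b, c, d play the roles of 0, 2, 1, 4.\<close>
  define site where "site s = (if s = a then 0 else if s = b then 2 else if s = c then 1 else 4 :: int)" for s
  have site: "site a = 0" "site b = 2" "site c = 1" "site d = 4" using assms by (auto simp: site_def)
  define \<alpha> \<beta> where "\<alpha> x = heisenberg (site (fst x)) (vec3 3 0 (-1)) (snd x)"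
    and "\<beta> x = heisenberg (site (fst x)) (vec3 0 3 (-1)) (snd x)" for x :: "int \<times> 3"
  have nz: "\<exists>j. meval (\<lambda>x. s * \<alpha> x + t * \<beta> x) (skew_rule a b c d j) \<noteq> 0"
    if "s \<noteq> 0 \<or> t \<noteq> 0" for s t :: complex
  proof -
    define P where "P = vec3 (3 * s) (3 * t) (- (s + t))"
    have P: "P = (\<lambda>k. s * vec3 3 0 (-1) k + t * vec3 0 3 (-1) k)"
      by (simp add: P_def fun3_eq_iff)
    have "off_vertices (tangential P)"
      unfolding P_def by (intro off_vertices_tangential off_vertices_line that)
    then obtain j where j: "heisenberg (0 + 3) (tangential P) j \<noteq> 0" by (rule heisenberg_nonzero)
    have "(\<lambda>j. s * \<alpha> (i, j) + t * \<beta> (i, j)) = heisenberg (site i) P" for i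
      unfolding P \<alpha>_def \<beta>_def by (simp add: fun_eq_iff heisenberg_linear)
    then have "meval (\<lambda>x. s * \<alpha> x + t * \<beta> x) (skew_rule a b c d j) =
        line_meet (heisenberg 0 P) (heisenberg (0 + 2) P) (heisenberg (0 + 1) P) (heisenberg (0 + 4) P) j"
      by (simp add: skew_rule_def meval_line_meet generic_point_def site)
    then show ?thesis using j heisenberg_factor_nonzero unfolding line_meet_heisenberg by (intro exI[of _ j]) simp
  qed
  have "mvars (skew_rule a b c d j) \<subseteq> {a, b, c, d} \<times> UNIV" for j
    unfolding skew_rule_def by (intro mvars_line_meet) (simp_all add: generic_point_def)
  moreover have "no_common_factor (skew_rule a b c d)"
    by (rule no_common_factor_if_nonvanishing_on_line[OF _ nz])
      (simp_all only: skew_rule_eq_generic_iterate, rule generic_iterate_homogeneous)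
  moreover obtain j where "meval (\<lambda>x. 1 * \<alpha> x + 0 * \<beta> x) (skew_rule a b c d j) \<noteq> 0"
    using nz[of 1 0] by auto
  then have "\<exists>j. skew_rule a b c d j \<noteq> 0" by (intro exI[of _ j]) auto
  moreover have "\<exists>\<delta>. \<forall>j. multihomogeneous \<delta> (skew_rule a b c d j)"
    unfolding skew_rule_eq_generic_iterate by (rule generic_iterate_multihomogeneous)
  ultimately show ?thesis by (simp add: local_rule_def)
qed

lemma dynamical_degree_4:
  assumes "d mod 8 = 4"
  shows "has_dynamical_degree (skew_pentagram 0 2 1 d) 4"
proof (rule has_dynamical_degree_if_reduced_tuples[where H = "\<lambda>m. generic_iterate 0 2 1 d m 0" and D = "\<lambda>m. 4 ^ m"])
  have "d \<noteq> 0" "d \<noteq> 1" "d \<noteq> 2" using assms by auto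
  then show "local_rule {0, 2, 1, d} (skew_rule 0 2 1 d)" by (intro local_rule_skew_rule) auto
  fix m
  have "mvars (generic_iterate 0 2 1 d m 0 j) \<subseteq> sites {0, 2, 1, d} m \<times> UNIV" for j
    using mvars_generic_iterate[of 0 2 1 d m 0 j] by simp
  then show "local_rule (sites {0, 2, 1, d} m) (generic_iterate 0 2 1 d m 0)"
    unfolding local_rule_def
    using finite_sites[of "{0, 2, 1, d}" m] sites_nonempty[of "{0, 2, 1, d}" m]
      generic_iterate_multihomogeneous[of 0 2 1 d m 0] no_common_factor_generic_iterate[OF assms, of m] by blast
  show "\<exists>j. generic_iterate 0 2 1 d m 0 j \<noteq> 0" by (rule no_common_factor_generic_iterate[OF assms])
  show "mdegree (generic_iterate 0 2 1 d m 0 j) = 4 ^ m" if "generic_iterate 0 2 1 d m 0 j \<noteq> 0" for j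
    using mdegree_homogeneous[OF generic_iterate_homogeneous that] .
next
  have "eventually (\<lambda>m. root m (real (4 ^ m)) = 4) sequentially"
    using eventually_gt_at_top[of 0] by eventually_elim (simp add: real_root_power_cancel)
  then show "(\<lambda>m. root m (real (4 ^ m))) \<longlonglongrightarrow> 4" by (rule tendsto_eventually)
qed (simp_all add: proportional_def mult.commute)

section \<open>Distinct parameters give distinct maps\<close>

text \<open>
  On a conic, three points are independent as soon as they are distinct. So the point \<open>x d\<close> is allowed
  to coincide with \<open>x a\<close> or \<open>x b\<close>.
\<close>

lemma conic_line_meet_nonzero:
  fixes x :: "int \<Rightarrow> complex"
  assumes "x a \<noteq> x b" "x c \<noteq> x a" "x c \<noteq> x b" "x c \<noteq> x d"
  shows "line_meet (vec3 1 (x a) (x a ^ 2)) (vec3 1 (x b) (x b ^ 2)) (vec3 1 (x c) (x c ^ 2)) (vec3 1 (x d) (x d ^ 2))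
    \<noteq> (\<lambda>_. 0)"
proof
  let ?q = "\<lambda>s. vec3 1 (x s) (x s ^ 2)"
  let ?C = "det3 (?q a) (?q b) (?q c)" and ?D = "det3 (?q a) (?q b) (?q d)"
  assume "line_meet (?q a) (?q b) (?q c) (?q d) = (\<lambda>_. 0)"
  then have "?D * ?q c 1 - ?C * ?q d 1 = 0" "?D * ?q c 2 - ?C * ?q d 2 = 0"
    unfolding line_meet_on_second_line fun3_eq_iff by blast+
  then have "?C * (x c - x d) = 0" by (simp add: algebra_simps)
  moreover have "?C = (x b - x a) * (x c - x a) * (x c - x b)"
    by (simp add: det3_def cross_simps algebra_simps power2_eq_square)
  ultimately show False using assms by simp
qed

text \<open>
  Take distinct points on a conic, but repeat at site \<open>d\<close> the point of site \<open>1\<close>. The map with parameter \<open>d\<close>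
  is undefined there at site \<open>0\<close>; for the other parameter the two equal points never meet in a
  degenerate way.
\<close>

lemma skew_pentagram_differ:
  assumes "d \<ge> 4" "d' \<ge> 4" "d \<noteq> (d' :: int)"
  shows "skew_pentagram 0 2 1 d \<noteq> skew_pentagram 0 2 1 d'"
proof
  assume eq: "skew_pentagram 0 2 1 d = skew_pentagram 0 2 1 d'"
  define x :: "int \<Rightarrow> complex" where "x s = (if s = d then 1 else of_int s)" for s
  define v :: "int \<Rightarrow> 3 proj" where "v s = proj_point (\<chi> j. vec3 1 (x s) (x s ^ 2) j)" for s
  have x: "x s = x t \<longleftrightarrow> s = t \<or> {s, t} = {1, d}" for s t
    using assms by (auto simp: x_def doubleton_eq_iff)
  have "\<exists>r. r \<noteq> 0 \<and> pcoords (v s) = (\<lambda>k. r * vec3 1 (x s) (x s ^ 2) k)" for s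
  proof -
    have "vec3 1 (x s) (x s ^ 2) \<noteq> (\<lambda>_. 0)" by (simp add: fun3_eq_iff)
    from pcoords_proj_point[OF this] show ?thesis unfolding v_def by blast
  qed
  then obtain r where r: "\<And>s. r s \<noteq> 0" "\<And>s. pcoords (v s) = (\<lambda>k. r s * vec3 1 (x s) (x s ^ 2) k)" by metis
  have "(\<lambda>s. v (i + s)) \<notin> indet (skew_rule 0 2 1 d')" for i
  proof -
    have "x (i + 0) \<noteq> x (i + 2)" "x (i + 1) \<noteq> x (i + 0)" "x (i + 1) \<noteq> x (i + 2)" "x (i + 1) \<noteq> x (i + d')"
      unfolding x using assms by (auto simp: doubleton_eq_iff)
    from conic_line_meet_nonzero[of x, OF this] show ?thesis
      unfolding in_indet_skew_rule_iff r(2) line_meet_scale using r(1) by (auto simp: fun_eq_iff)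
  qed
  then have "skew_pentagram 0 2 1 d' v \<noteq> None"
    unfolding lattice_map_skew_rule[symmetric] lattice_map_def by simp
  moreover have "v (0 + 1) = v (0 + d)" by (simp add: v_def x_def)
  then have "\<not> (\<forall>i. v (i + 0) \<noteq> v (i + 2) \<and> v (i + 1) \<noteq> v (i + d) \<and>
      line (v (i + 0)) (v (i + 2)) \<noteq> line (v (i + 1)) (v (i + d)))" by blast
  then have "skew_pentagram 0 2 1 d v = None" unfolding skew_pentagram_def by (rule if_not_P)
  ultimately show False using eq by simp
qed

lemma infinitely_many_of_degree_4:
  "infinite {T. \<exists>a b c d :: int. distinct [a, b, c, d] \<and> \<bar>b - a\<bar> \<noteq> \<bar>d - c\<bar> \<and>
     T = skew_pentagram a b c d \<and> has_dynamical_degree T 4}"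
proof -
  define f where "f n = skew_pentagram 0 2 1 (8 * int n + 4)" for n
  have "inj f"
  proof (rule injI)
    fix m n assume "f m = f n"
    then show "m = n"
      using skew_pentagram_differ[of "8 * int m + 4" "8 * int n + 4"] unfolding f_def by fastforce
  qed
  then have "infinite (range f)" by (rule range_inj_infinite)
  moreover have "range f \<subseteq> {T. \<exists>a b c d :: int. distinct [a, b, c, d] \<and> \<bar>b - a\<bar> \<noteq> \<bar>d - c\<bar> \<and>
     T = skew_pentagram a b c d \<and> has_dynamical_degree T 4}"
  proof
    fix T assume "T \<in> range f"
    then obtain n where T: "T = skew_pentagram 0 2 1 (8 * int n + 4)" by (auto simp: f_def)
    moreover have "has_dynamical_degree T 4" unfolding T by (rule dynamical_degree_4) simp
    moreover have "distinct [0, 2, 1, 8 * int n + 4]" by auto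
    moreover have "\<bar>2 - 0\<bar> \<noteq> \<bar>8 * int n + 4 - 1\<bar>" by simp
    ultimately show "T \<in> {T. \<exists>a b c d :: int. distinct [a, b, c, d] \<and> \<bar>b - a\<bar> \<noteq> \<bar>d - c\<bar> \<and>
     T = skew_pentagram a b c d \<and> has_dynamical_degree T 4}" by blast
  qed
  ultimately show ?thesis by (rule infinite_super[rotated])
qed

section \<open>Linear systems over the polynomial ring\<close>

definition bounded_mpoly :: "(int \<times> 'n) set \<Rightarrow> nat \<Rightarrow> 'n mpoly set" where
  "bounded_mpoly V n = {p. mvars p \<subseteq> V \<and> (\<forall>m \<in> Poly_Mapping.keys p. weight (\<lambda>_. 1) m \<le> n)}"

lemma bounded_mpoly_mono: "p \<in> bounded_mpoly V n \<Longrightarrow> n \<le> n' \<Longrightarrow> p \<in> bounded_mpoly V n'"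
  unfolding bounded_mpoly_def using le_trans by blast

lemma bounded_mpoly_zero: "0 \<in> bounded_mpoly V n"
  by (simp add: bounded_mpoly_def mvars_def)

lemma bounded_mpoly_one: "1 \<in> bounded_mpoly V n"
  by (simp add: bounded_mpoly_def mvars_def)

lemma bounded_mpoly_add:
  assumes "p \<in> bounded_mpoly V n" "q \<in> bounded_mpoly V n"
  shows "p + q \<in> bounded_mpoly V n"
  using assms keys_add[of p q] mvars_add[of p q] unfolding bounded_mpoly_def by blast

lemma bounded_mpoly_uminus: "p \<in> bounded_mpoly V n \<Longrightarrow> - p \<in> bounded_mpoly V n"
  by (simp add: bounded_mpoly_def mvars_def mpoly_keys_uminus)

lemma bounded_mpoly_mult:
  assumes "p \<in> bounded_mpoly V n" "q \<in> bounded_mpoly V n'"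
  shows "p * q \<in> bounded_mpoly V (n + n')"
proof -
  have "weight (\<lambda>_. 1) m \<le> n + n'" if m: "m \<in> Poly_Mapping.keys (p * q)" for m
  proof -
    obtain k l where "m = k + l" "k \<in> Poly_Mapping.keys p" "l \<in> Poly_Mapping.keys q"
      using m keys_mult[of p q] by auto
    then show ?thesis using assms by (auto simp: bounded_mpoly_def weight_add intro!: add_mono)
  qed
  then show ?thesis using assms mvars_mult[of p q] unfolding bounded_mpoly_def by blast
qed

lemma bounded_mpoly_sum:
  "(\<And>x. x \<in> A \<Longrightarrow> g x \<in> bounded_mpoly V n) \<Longrightarrow> sum g A \<in> bounded_mpoly V n"
  by (induction A rule: infinite_finite_induct) (simp_all add: bounded_mpoly_zero bounded_mpoly_add)

lemma bounded_mpoly_prod: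
  "(\<And>x. x \<in> A \<Longrightarrow> g x \<in> bounded_mpoly V n) \<Longrightarrow> prod g A \<in> bounded_mpoly V (card A * n)"
  by (induction A rule: infinite_finite_induct) (simp_all add: bounded_mpoly_one bounded_mpoly_mult)

lemma bounded_mpoly_det:
  assumes "\<And>i j. i < k \<Longrightarrow> j < k \<Longrightarrow> g (i, j) \<in> bounded_mpoly V n"
  shows "Determinant.det (Matrix.mat k k g) \<in> bounded_mpoly V (k * n)"
proof -
  have sign: "signof p \<in> bounded_mpoly V 0" for p
    by (simp add: sign_def bounded_mpoly_one bounded_mpoly_uminus)
  have "(\<Prod>i = 0..<k. Matrix.mat k k g $$ (i, p i)) \<in> bounded_mpoly V (card {0..<k} * n)"
    if "p permutes {0..<k}" for p
  proof (rule bounded_mpoly_prod)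
    fix i assume "i \<in> {0..<k}"
    moreover from this that have "p i < k" using permutes_in_image by fastforce
    ultimately show "Matrix.mat k k g $$ (i, p i) \<in> bounded_mpoly V n" using assms by simp
  qed
  then show ?thesis
    unfolding det_def'[OF mat_carrier]
    using bounded_mpoly_mult[OF sign] by (intro bounded_mpoly_sum) fastforce
qed

text \<open>
  Cramer's rule without any assumption on the rank: choose a nonvanishing minor of maximal size \<open>k\<close> and
  one further column. The signed minors of size \<open>k\<close> in the enlarged block solve the equations of the
  chosen rows because a matrix with two equal rows is singular, and the other equations by maximality.
\<close>

lemma small_kernel_vector:
  fixes c :: "'i \<Rightarrow> 'j \<Rightarrow> 'n mpoly"
  assumes fin: "finite I" "finite J" and card: "card I < card J"
    and c: "\<And>i j. i \<in> I \<Longrightarrow> j \<in> J \<Longrightarrow> c i j \<in> bounded_mpoly V n"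
  obtains x where "\<exists>j\<in>J. x j \<noteq> 0" "\<And>j. x j \<in> bounded_mpoly V (card I * n)"
    "\<And>i. i \<in> I \<Longrightarrow> (\<Sum>j\<in>J. c i j * x j) = 0"
proof -
  define minor where "minor k \<rho> \<gamma> = Determinant.det (Matrix.mat k k (\<lambda>(a, b). c (\<rho> a) (\<gamma> b)))" for k \<rho> \<gamma>
  define P where "P k \<longleftrightarrow> (\<exists>\<rho> \<gamma>. inj_on \<rho> {..<k} \<and> \<rho> ` {..<k} \<subseteq> I \<and> inj_on \<gamma> {..<k} \<and> \<gamma> ` {..<k} \<subseteq> J \<and>
    minor k \<rho> \<gamma> \<noteq> 0)" for k
  have "P 0" by (simp add: P_def minor_def)
  have bound: "k \<le> card I" if Pk: "P k" for k
  proof -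
    obtain \<rho> where "inj_on \<rho> {..<k}" "\<rho> ` {..<k} \<subseteq> I" using Pk unfolding P_def by blast
    then show ?thesis using card_inj_on_le[of \<rho> "{..<k}" I] fin by simp
  qed
  define k where "k = (GREATEST k. P k)"
  have "P k" unfolding k_def using \<open>P 0\<close> bound by (rule GreatestI_nat)
  have max: "\<not> P (Suc k)"
    using Greatest_le_nat[of P "Suc k" "card I"] bound unfolding k_def by fastforce
  obtain \<rho> \<gamma> where \<rho>: "inj_on \<rho> {..<k}" "\<rho> ` {..<k} \<subseteq> I" and \<gamma>: "inj_on \<gamma> {..<k}" "\<gamma> ` {..<k} \<subseteq> J"
    and nz: "minor k \<rho> \<gamma> \<noteq> 0" using \<open>P k\<close> unfolding P_def by blast
  have "card (\<gamma> ` {..<k}) < card J"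
    using card_image_le[of "{..<k}" \<gamma>] bound[OF \<open>P k\<close>] card by simp
  then obtain j0 where j0: "j0 \<in> J" "j0 \<notin> \<gamma> ` {..<k}"
    by (metis \<gamma>(2) less_irrefl subsetI subset_antisym)
  define \<gamma>' where "\<gamma>' = \<gamma>(k := j0)"
  have \<gamma>': "inj_on \<gamma>' {..<Suc k}" "\<gamma>' ` {..<Suc k} \<subseteq> J"
    using \<gamma> j0 by (auto simp: \<gamma>'_def inj_on_def lessThan_Suc image_iff)
  \<comment> \<open>The chosen rows with row \<open>i\<close> appended; the cofactors along the last row do not depend on \<open>i\<close>.\<close>
  define M where "M i = Matrix.mat (Suc k) (Suc k) (\<lambda>(a, b). c ((\<rho>(k := i)) a) (\<gamma>' b))" for i
  have M: "M i \<in> carrier_mat (Suc k) (Suc k)" for i by (simp add: M_def)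
  have detM: "Determinant.det (M i) = 0" if "i \<in> I" for i
  proof (cases "i \<in> \<rho> ` {..<k}")
    case True
    then obtain a where a: "a < k" "i = \<rho> a" by auto
    have "row (M i) a = row (M i) k" using a by (intro eq_vecI) (auto simp: M_def)
    then show ?thesis using a by (intro det_identical_rows[OF M, of a k]) auto
  next
    case False
    have "inj_on (\<rho>(k := i)) {..<Suc k}" "(\<rho>(k := i)) ` {..<Suc k} \<subseteq> I"
      using \<rho> False that by (auto simp: inj_on_def lessThan_Suc image_iff)
    with \<gamma>' max have "minor (Suc k) (\<rho>(k := i)) \<gamma>' = 0" unfolding P_def by blast
    then show ?thesis by (simp add: minor_def M_def)
  qed
  \<comment> \<open>The enumeration of the columns other than \<open>b\<close>.\<close>
  define \<sigma> where "\<sigma> b b' = (if b' < b then b' else Suc b')" for b b' :: nat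
  define y where "y b = (-1) ^ (k + b) * minor k \<rho> (\<lambda>b'. \<gamma>' (\<sigma> b b'))" for b
  have cof: "cofactor (M i) k b = y b" if "b < Suc k" for i b
  proof -
    have "mat_delete (M i) k b = Matrix.mat k k (\<lambda>(a, b'). c (\<rho> a) (\<gamma>' (\<sigma> b b')))"
      using that by (intro eq_matI) (auto simp: mat_delete_def M_def \<sigma>_def)
    then show ?thesis by (simp add: cofactor_def y_def minor_def)
  qed
  have ker: "(\<Sum>b<Suc k. c i (\<gamma>' b) * y b) = 0" if "i \<in> I" for i
  proof -
    have "Determinant.det (M i) = (\<Sum>b<Suc k. M i $$ (k, b) * cofactor (M i) k b)"
      by (rule laplace_expansion_row[OF M]) simp
    also have "\<dots> = (\<Sum>b<Suc k. c i (\<gamma>' b) * y b)"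
    proof (rule sum.cong)
      fix b assume "b \<in> {..<Suc k}"
      moreover from this have "M i $$ (k, b) = c i (\<gamma>' b)" by (simp add: M_def)
      ultimately show "M i $$ (k, b) * cofactor (M i) k b = c i (\<gamma>' b) * y b" by (simp add: cof)
    qed simp
    finally show ?thesis using detM[OF that] by simp
  qed
  define x where "x j = (if j \<in> \<gamma>' ` {..<Suc k} then y (the_inv_into {..<Suc k} \<gamma>' j) else 0)" for j
  have x: "x (\<gamma>' b) = y b" if "b < Suc k" for b
    using that the_inv_into_f_f[OF \<gamma>'(1)] by (auto simp: x_def)
  show ?thesis
  proof (rule that)
    have "x j0 = y k" using x[of k] by (simp add: \<gamma>'_def)
    moreover have "minor k \<rho> (\<lambda>b'. \<gamma>' (\<sigma> k b')) = minor k \<rho> \<gamma>"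
      unfolding minor_def by (intro arg_cong[where f = Determinant.det] cong_mat) (auto simp: \<sigma>_def \<gamma>'_def)
    ultimately have "x j0 = minor k \<rho> \<gamma>" by (simp add: y_def flip: mult_2)
    with j0 nz show "\<exists>j\<in>J. x j \<noteq> 0" by auto
  next
    fix j
    have "y b \<in> bounded_mpoly V (k * n)" if "b < Suc k" for b
    proof -
      have "minor k \<rho> (\<lambda>b'. \<gamma>' (\<sigma> b b')) \<in> bounded_mpoly V (k * n)"
        unfolding minor_def
      proof (rule bounded_mpoly_det, unfold prod.case)
        fix a b' assume "a < k" "b' < k"
        then have "\<rho> a \<in> I" "\<gamma>' (\<sigma> b b') \<in> J" using \<rho>(2) \<gamma>'(2) by (auto simp: \<sigma>_def)
        then show "c (\<rho> a) (\<gamma>' (\<sigma> b b')) \<in> bounded_mpoly V n" by (rule c)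
      qed
      moreover have "(-1) ^ e \<in> bounded_mpoly V 0" for e
        by (induction e) (simp_all add: bounded_mpoly_one bounded_mpoly_uminus)
      ultimately show ?thesis unfolding y_def using bounded_mpoly_mult by fastforce
    qed
    then have "x j \<in> bounded_mpoly V (k * n)"
      using x by (cases "j \<in> \<gamma>' ` {..<Suc k}") (auto simp: bounded_mpoly_zero x_def)
    then show "x j \<in> bounded_mpoly V (card I * n)"
      by (rule bounded_mpoly_mono) (simp add: bound[OF \<open>P k\<close>])
  next
    fix i assume "i \<in> I"
    have "(\<Sum>j\<in>J. c i j * x j) = (\<Sum>j\<in>\<gamma>' ` {..<Suc k}. c i j * x j)"
      using \<gamma>'(2) fin by (intro sum.mono_neutral_right) (auto simp: x_def)
    also have "\<dots> = (\<Sum>b<Suc k. c i (\<gamma>' b) * x (\<gamma>' b))"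
      by (simp only: sum.reindex[OF \<gamma>'(1)] o_def)
    also have "\<dots> = 0"
      using ker[OF \<open>i \<in> I\<close>] x by (simp del: sum.lessThan_Suc)
    finally show "(\<Sum>j\<in>J. c i j * x j) = 0" .
  qed
qed

section \<open>Laplace transforms of planar nets\<close>

context
  fixes L k :: int
begin

text \<open>
  The site \<open>s\<close> stands for the quadrilateral with corners \<open>s\<close>, \<open>s + L\<close> (lower edge) and \<open>s + k\<close>, \<open>s + k + L\<close>
  (upper edge). Four vectors in a three-dimensional space satisfy one linear relation, and by
  Cramer's rule these are its coefficients, the two upper ones moved to the other side.
\<close>

definition lower_left :: "(int \<Rightarrow> 3 \<Rightarrow> 'r::comm_ring_1) \<Rightarrow> int \<Rightarrow> 'r" where
  "lower_left v s = - det3 (v (s + L)) (v (s + k)) (v (s + k + L))"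
definition lower_right :: "(int \<Rightarrow> 3 \<Rightarrow> 'r::comm_ring_1) \<Rightarrow> int \<Rightarrow> 'r" where
  "lower_right v s = det3 (v s) (v (s + k)) (v (s + k + L))"
definition upper_left :: "(int \<Rightarrow> 3 \<Rightarrow> 'r::comm_ring_1) \<Rightarrow> int \<Rightarrow> 'r" where
  "upper_left v s = det3 (v s) (v (s + L)) (v (s + k + L))"
definition upper_right :: "(int \<Rightarrow> 3 \<Rightarrow> 'r::comm_ring_1) \<Rightarrow> int \<Rightarrow> 'r" where
  "upper_right v s = - det3 (v s) (v (s + L)) (v (s + k))"

text \<open>
  The Laplace transform of the net: the lines along the lower and the upper edge are intersected.
\<close>

definition laplace :: "(int \<Rightarrow> 3 \<Rightarrow> 'r::comm_ring_1) \<Rightarrow> int \<Rightarrow> 3 \<Rightarrow> 'r" where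
  "laplace v = lattice_step 0 L k (k + L) v"

lemma laplace_first: "laplace v s = (\<lambda>j. lower_left v s * v s j + lower_right v s * v (s + L) j)"
  unfolding laplace_def lattice_step_def line_meet_on_first_line lower_left_def lower_right_def by (simp add: add.assoc)

lemma laplace_second: "laplace v s = (\<lambda>j. upper_left v s * v (s + k) j + upper_right v s * v (s + k + L) j)"
  unfolding laplace_def lattice_step_def line_meet_on_second_line upper_left_def upper_right_def by (simp add: add.assoc)

text \<open>
  Both \<open>laplace v s\<close> and \<open>laplace v (s - k)\<close> lie on the line through \<open>v s\<close> and \<open>v (s + L)\<close>. This is the determinant
  of their coordinates there; it is nonzero if and only if they are independent, provided that \<open>v s\<close> and
  \<open>v (s + L)\<close> are.
\<close>

definition edge_det :: "(int \<Rightarrow> 3 \<Rightarrow> 'r::comm_ring_1) \<Rightarrow> int \<Rightarrow> 'r" where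
  "edge_det v s = lower_left v s * upper_right v (s - k) - lower_right v s * upper_left v (s - k)"

lemma cross_laplace: "cross (laplace v s) (laplace v (s - k)) = (\<lambda>j. edge_det v s * cross (v s) (v (s + L)) j)"
proof -
  have "laplace v (s - k) = (\<lambda>j. upper_left v (s - k) * v s j + upper_right v (s - k) * v (s + L) j)"
    unfolding laplace_second by simp
  then show ?thesis
    unfolding laplace_first[of v s] edge_det_def fun3_eq_iff cross_simps by (simp add: algebra_simps)
qed

text \<open>
  All four corners of a transformed quadrilateral lie on lines through consecutive points of one
  row, so they expand in the three vectors \<open>v (s + k)\<close>, \<open>v (s + k + L)\<close>, \<open>v (s + k + 2 L)\<close>. Hence the coefficients of its
  relation are the old coefficients up to factors that a rescaling of the multipliers absorbs.
\<close>

lemma transformed_coefficients: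
  fixes v :: "int \<Rightarrow> 3 \<Rightarrow> 'r::comm_ring_1"
  defines "w \<equiv> laplace v"
  defines "\<delta> s \<equiv> det3 (v (s + k)) (v (s + k + L)) (v (s + k + L + L))"
  shows "lower_left w s = - \<delta> s * lower_left v (s + k) * edge_det v (s + k + L)"
    "lower_right w s = - \<delta> s * edge_det v (s + k) * lower_right v (s + k + L)"
    "upper_left w s = - \<delta> s * upper_left v s * edge_det v (s + k + L)"
    "upper_right w s = - \<delta> s * upper_right v (s + L) * edge_det v (s + k)"
proof -
  define x y z where "x = v (s + k)" and "y = v (s + k + L)" and "z = v (s + k + L + L)"
  have d: "\<delta> s = det3 x y z" by (simp add: \<delta>_def x_def y_def z_def)
  have Delta: "edge_det v (s + k) = lower_left v (s + k) * upper_right v s - lower_right v (s + k) * upper_left v s"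
    "edge_det v (s + k + L) = lower_left v (s + k + L) * upper_right v (s + L) - lower_right v (s + k + L) * upper_left v (s + L)"
    by (simp_all add: edge_det_def algebra_simps)
  have swap: "s + L + k = s + k + L" by simp
  have w: "w s = (\<lambda>j. upper_left v s * x j + upper_right v s * y j)"
    "w (s + L) = (\<lambda>j. upper_left v (s + L) * y j + upper_right v (s + L) * z j)"
    "w (s + k) = (\<lambda>j. lower_left v (s + k) * x j + lower_right v (s + k) * y j)"
    "w (s + k + L) = (\<lambda>j. lower_left v (s + k + L) * y j + lower_right v (s + k + L) * z j)"
    unfolding w_def x_def y_def z_def
    by (simp_all only: laplace_second[of v s] laplace_second[of v "s + L"] laplace_first[of v "s + k"]
        laplace_first[of v "s + k + L"] swap)
  have perm: "det3 y z x = det3 x y z" "det3 z x y = det3 x y z"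
    "det3 y x z = - det3 x y z" "det3 z y x = - det3 x y z" "det3 x z y = - det3 x y z"
    unfolding det3_def cross_simps by (simp_all add: algebra_simps)
  show "lower_left w s = - \<delta> s * lower_left v (s + k) * edge_det v (s + k + L)"
    "lower_right w s = - \<delta> s * edge_det v (s + k) * lower_right v (s + k + L)"
    "upper_left w s = - \<delta> s * upper_left v s * edge_det v (s + k + L)"
    "upper_right w s = - \<delta> s * upper_right v (s + L) * edge_det v (s + k)"
    unfolding d Delta lower_left_def[of w] lower_right_def[of w] upper_left_def[of w] upper_right_def[of w] w det3_combination
    by (simp_all add: perm algebra_simps)
qed

definition net :: "int \<Rightarrow> int \<Rightarrow> int" where
  "net p q = p * L + q * k"

lemma net_simps: "net p q + L = net (p + 1) q" "net p q + k = net p (q + 1)"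
  "net p q - k = net p (q - 1)" "net p q - L = net (p - 1) q"
  by (simp_all add: net_def algebra_simps)

text \<open>
  Multiply the relation of each quadrilateral \<open>(p, q)\<close> of an \<open>m \<times> m\<close> block by \<open>e p q\<close> and add up. The
  condition says that all vertices of the rows strictly between the bottom and the top row cancel,
  so that a combination of the bottom row equals a combination of the top row. Multipliers outside
  the columns of the block are \<open>0\<close>, which makes the condition uniform at the ends of a row.
\<close>

definition row_relations :: "(int \<Rightarrow> 3 \<Rightarrow> 'r::comm_ring_1) \<Rightarrow> int \<Rightarrow> (int \<Rightarrow> int \<Rightarrow> 'r) \<Rightarrow> bool" where
  "row_relations v m e \<longleftrightarrow>
     (\<forall>p q. p \<notin> {0..<m} \<longrightarrow> e p q = 0) \<and>
     (\<forall>p. \<forall>q\<in>{1..<m}.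
        e p q * lower_left v (net p q) + e (p - 1) q * lower_right v (net (p - 1) q) =
        e p (q - 1) * upper_left v (net p (q - 1)) + e (p - 1) (q - 1) * upper_right v (net (p - 1) (q - 1)))"

text \<open>
  Multipliers on a block come from multipliers on the block of the transformed net, which has one row
  and one column less. The partial sums \<open>f\<close> of the relation along a row express \<open>e p q\<close> and \<open>e p (q - 1)\<close> by
  \<open>f p q\<close> and \<open>f (p - 1) q\<close>. This gives two expressions for the multipliers of each inner row, and to equate
  them is, after the rescaling of \<open>f\<close> to \<open>e'\<close>, the condition for the transformed net.
\<close>

lemma row_relations_step:
  fixes v :: "int \<Rightarrow> 3 \<Rightarrow> 'r::field"
  assumes e: "row_relations v m e" and m: "m \<ge> 2"
    and Delta: "\<And>p q. p \<in> {0..<m} \<Longrightarrow> q \<in> {1..<m} \<Longrightarrow> edge_det v (net p q) \<noteq> 0"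
    and delta: "\<And>p q. p \<in> {0..<m - 1} \<Longrightarrow> q \<in> {1..<m} \<Longrightarrow>
      det3 (v (net p q)) (v (net (p + 1) q)) (v (net (p + 2) q)) \<noteq> 0"
  obtains e' where "row_relations (laplace v) (m - 1) e'"
    "\<And>p q. q \<in> {0..<m - 1} \<Longrightarrow>
      e p q = e' p q * lower_left (laplace v) (net p q) + e' (p - 1) q * lower_right (laplace v) (net (p - 1) q)"
    "\<And>p q. q \<in> {1..<m} \<Longrightarrow> e p q = e' p (q - 1) * upper_left (laplace v) (net p (q - 1)) +
      e' (p - 1) (q - 1) * upper_right (laplace v) (net (p - 1) (q - 1))"
proof -
  define w where "w = laplace v"
  define \<delta> where "\<delta> p q = det3 (v (net p q)) (v (net (p + 1) q)) (v (net (p + 2) q))" for p q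
  \<comment> \<open>The part of the row sum up to column \<open>p\<close> that is left over at the vertex \<open>(p + 1, q)\<close>.\<close>
  define f where "f p q = e p q * lower_right v (net p q) - e p (q - 1) * upper_right v (net p (q - 1))" for p q
  have supp: "e p q = 0" if "p \<notin> {0..<m}" for p q
    using e that unfolding row_relations_def by blast
  have rel: "e p q * lower_left v (net p q) + e (p - 1) q * lower_right v (net (p - 1) q) =
      e p (q - 1) * upper_left v (net p (q - 1)) + e (p - 1) (q - 1) * upper_right v (net (p - 1) (q - 1))"
    if "q \<in> {1..<m}" for p q
    using e that unfolding row_relations_def by blast
  have f': "f (p - 1) q = e p (q - 1) * upper_left v (net p (q - 1)) - e p q * lower_left v (net p q)"
    if "q \<in> {1..<m}" for p q
    using rel[OF that, of p] by (simp add: f_def algebra_simps)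
  have f_supp: "f p q = 0" if "q \<in> {1..<m}" "p \<notin> {0..<m - 1}" for p q
  proof (cases "p = m - 1")
    case True
    then show ?thesis using f'[OF that(1), of m] supp[of m] by simp
  next
    case False
    then have "p \<notin> {0..<m}" using that by auto
    then show ?thesis using supp by (simp add: f_def)
  qed
  have D: "edge_det v (net p q) = lower_left v (net p q) * upper_right v (net p (q - 1)) - lower_right v (net p q) * upper_left v (net p (q - 1))" for p q
    by (simp add: edge_det_def net_simps)
  \<comment> \<open>Cramer's rule for the two equations that determine the multipliers above and below the edge.\<close>
  have upper: "e p q * edge_det v (net p q) =
      - (upper_left v (net p (q - 1)) * f p q + upper_right v (net p (q - 1)) * f (p - 1) q)" if "q \<in> {1..<m}" for p q
    unfolding D f'[OF that] by (simp add: f_def algebra_simps)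
  have lower: "e p (q - 1) * edge_det v (net p q) =
      - (lower_left v (net p q) * f p q + lower_right v (net p q) * f (p - 1) q)" if "q \<in> {1..<m}" for p q
    unfolding D f'[OF that] by (simp add: f_def algebra_simps)
  define e' where "e' p q = (if q \<in> {0..<m - 1} \<and> p \<in> {0..<m - 1}
      then f p (q + 1) / (\<delta> p (q + 1) * edge_det v (net p (q + 1)) * edge_det v (net (p + 1) (q + 1))) else 0)" for p q
  have coeffs:
    "lower_left w (net p q) = - \<delta> p (q + 1) * lower_left v (net p (q + 1)) * edge_det v (net (p + 1) (q + 1))"
    "lower_right w (net p q) = - \<delta> p (q + 1) * edge_det v (net p (q + 1)) * lower_right v (net (p + 1) (q + 1))"
    "upper_left w (net p q) = - \<delta> p (q + 1) * upper_left v (net p q) * edge_det v (net (p + 1) (q + 1))"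
    "upper_right w (net p q) = - \<delta> p (q + 1) * upper_right v (net (p + 1) q) * edge_det v (net p (q + 1))" for p q
    unfolding w_def \<delta>_def transformed_coefficients net_simps by (simp_all add: add.assoc)
  have e'_supp: "e' p q = 0" if "p \<notin> {0..<m - 1}" for p q
    using that unfolding e'_def by (intro if_not_P) blast
  have key: "\<delta> p (q + 1) * edge_det v (net p (q + 1)) * edge_det v (net (p + 1) (q + 1)) * e' p q = f p (q + 1)"
    if "q \<in> {0..<m - 1}" for p q
  proof (cases "p \<in> {0..<m - 1}")
    case True
    then have "\<delta> p (q + 1) \<noteq> 0" "edge_det v (net p (q + 1)) \<noteq> 0" "edge_det v (net (p + 1) (q + 1)) \<noteq> 0"
      using that delta[of p "q + 1"] Delta[of p "q + 1"] Delta[of "p + 1" "q + 1"] by (auto simp: \<delta>_def)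
    then show ?thesis using True that by (simp add: e'_def)
  next
    case False
    have "q + 1 \<in> {1..<m}" using that by auto
    from f_supp[OF this False] e'_supp[OF False] show ?thesis by simp
  qed
  have first: "e p q = e' p q * lower_left w (net p q) + e' (p - 1) q * lower_right w (net (p - 1) q)"
    if q: "q \<in> {0..<m - 1}" for p q
  proof (cases "p \<in> {0..<m}")
    case True
    then have nz: "edge_det v (net p (q + 1)) \<noteq> 0" using Delta[of p "q + 1"] q by auto
    have "edge_det v (net p (q + 1)) * (e' p q * lower_left w (net p q) + e' (p - 1) q * lower_right w (net (p - 1) q)) =
      - (lower_left v (net p (q + 1)) * (\<delta> p (q + 1) * edge_det v (net p (q + 1)) * edge_det v (net (p + 1) (q + 1)) * e' p q)
        + lower_right v (net p (q + 1)) * (\<delta> (p - 1) (q + 1) * edge_det v (net (p - 1) (q + 1)) * edge_det v (net (p - 1 + 1) (q + 1)) * e' (p - 1) q))"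
      unfolding coeffs by (simp add: algebra_simps)
    also have "\<dots> = - (lower_left v (net p (q + 1)) * f p (q + 1) + lower_right v (net p (q + 1)) * f (p - 1) (q + 1))"
      unfolding key[OF q] ..
    also have "\<dots> = edge_det v (net p (q + 1)) * e p q"
      using lower[of "q + 1" p] q by (simp add: mult.commute)
    finally show ?thesis using nz by simp
  next
    case False
    then show ?thesis using supp[of p q] e'_supp[of p q] e'_supp[of "p - 1" q] by auto
  qed
  have second: "e p q = e' p (q - 1) * upper_left w (net p (q - 1)) + e' (p - 1) (q - 1) * upper_right w (net (p - 1) (q - 1))"
    if q: "q \<in> {1..<m}" for p q
  proof (cases "p \<in> {0..<m}")
    case True
    then have nz: "edge_det v (net p q) \<noteq> 0" using Delta[of p q] q by auto
    have q': "q - 1 \<in> {0..<m - 1}" using q by auto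
    have "edge_det v (net p q) * (e' p (q - 1) * upper_left w (net p (q - 1)) + e' (p - 1) (q - 1) * upper_right w (net (p - 1) (q - 1))) =
      - (upper_left v (net p (q - 1)) * (\<delta> p (q - 1 + 1) * edge_det v (net p (q - 1 + 1)) * edge_det v (net (p + 1) (q - 1 + 1)) * e' p (q - 1))
        + upper_right v (net p (q - 1)) * (\<delta> (p - 1) (q - 1 + 1) * edge_det v (net (p - 1) (q - 1 + 1)) * edge_det v (net (p - 1 + 1) (q - 1 + 1)) * e' (p - 1) (q - 1)))"
      unfolding coeffs by (simp add: algebra_simps)
    also have "\<dots> = - (upper_left v (net p (q - 1)) * f p q + upper_right v (net p (q - 1)) * f (p - 1) q)"
      unfolding key[OF q'] by simp
    also have "\<dots> = edge_det v (net p q) * e p q"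
      using upper[OF q, of p] by (simp add: mult.commute)
    finally show ?thesis using nz by simp
  next
    case False
    then show ?thesis using supp[of p q] e'_supp[of p "q - 1"] e'_supp[of "p - 1" "q - 1"] by auto
  qed
  have "row_relations w (m - 1) e'"
    unfolding row_relations_def
  proof (intro conjI allI impI ballI)
    fix p q assume "p \<notin> {0..<m - 1}"
    then show "e' p q = 0" by (rule e'_supp)
  next
    fix p q assume q: "q \<in> {1..<m - 1}"
    then have "q \<in> {0..<m - 1}" "q \<in> {1..<m}" by auto
    then show "e' p q * lower_left w (net p q) + e' (p - 1) q * lower_right w (net (p - 1) q) =
        e' p (q - 1) * upper_left w (net p (q - 1)) + e' (p - 1) (q - 1) * upper_right w (net (p - 1) (q - 1))"
      using first[of q p] second[of q p] by simp
  qed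
  then show ?thesis using that[of e'] first second unfolding w_def by blast
qed


text \<open>
  Restricted to finitely many sites and steps, so that it can be enforced by the nonvanishing of a
  single polynomial.
\<close>

definition nondegenerate :: "(int \<Rightarrow> 3 \<Rightarrow> 'r::comm_ring_1) \<Rightarrow> int set \<Rightarrow> nat \<Rightarrow> bool" where
  "nondegenerate v \<Omega> n \<longleftrightarrow> (\<forall>i\<le>n. \<forall>s\<in>\<Omega>. \<forall>t\<in>\<Omega>. \<forall>u\<in>\<Omega>. distinct [s, t, u] \<longrightarrow>
     det3 ((laplace ^^ i) v s) ((laplace ^^ i) v t) ((laplace ^^ i) v u) \<noteq> 0)"

text \<open>
  Applying \<open>row_relations_step\<close> \<open>n\<close> times shrinks the block to a single quadrilateral with one multiplier
  \<open>r\<close>. Each step rewrites the combination of the bottom row as the same kind of combination for the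
  transformed net, and \<open>r = 0\<close> would force all multipliers to vanish.
\<close>

lemma combination_is_iterated_laplace:
  fixes v :: "int \<Rightarrow> 3 \<Rightarrow> 'r::field"
  assumes "L \<noteq> 0" "k \<noteq> 0" "L \<noteq> - k"
    and "row_relations v (int (Suc n)) e" "nondegenerate v \<Omega> n"
    and "\<And>p q. p \<in> {0..int (Suc n)} \<Longrightarrow> q \<in> {0..int (Suc n)} \<Longrightarrow> net p q \<in> \<Omega>"
  shows "\<exists>r. (\<forall>j. (\<Sum>p\<in>{0..<int (Suc n)}. e p 0 * laplace v (net p 0) j) = r * (laplace ^^ Suc n) v 0 j) \<and>
    (\<forall>p\<in>{0..<int (Suc n)}. \<forall>q\<in>{0..<int (Suc n)}. e p q \<noteq> 0 \<longrightarrow> r \<noteq> 0)"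
  using assms(4-)
proof (induction n arbitrary: v e)
  case 0
  have "{0..<int (Suc 0)} = {0}" by auto
  then show ?case by (intro exI[of _ "e 0 0"]) (simp add: net_def)
next
  case (Suc n)
  define m where "m = int (Suc (Suc n))"
  define w where "w = laplace v"
  have m: "m \<ge> 2" "m - 1 = int (Suc n)" by (simp_all add: m_def)
  have \<Omega>: "net p q \<in> \<Omega>" if "p \<in> {0..m}" "q \<in> {0..m}" for p q
    using Suc.prems(3) that unfolding m_def by blast
  have nd: "det3 ((laplace ^^ i) v s) ((laplace ^^ i) v t) ((laplace ^^ i) v u) \<noteq> 0"
    if "i \<le> Suc n" "s \<in> \<Omega>" "t \<in> \<Omega>" "u \<in> \<Omega>" "distinct [s, t, u]" for i s t u
    using Suc.prems(2) that unfolding nondegenerate_def by blast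
  have Delta: "edge_det v (net p q) \<noteq> 0" if p: "p \<in> {0..<m}" and q: "q \<in> {1..<m}" for p q
  proof
    assume "edge_det v (net p q) = 0"
    then have zero: "cross (laplace v (net p q)) (laplace v (net p (q - 1))) = (\<lambda>_. 0)"
      using cross_laplace[of v "net p q"] by (simp add: net_simps)
    have "distinct [net (p + 1) q, net p q, net p (q - 1)]"
      using assms(1-3) by (auto simp: net_def algebra_simps)
    then have "det3 (laplace v (net (p + 1) q)) (laplace v (net p q)) (laplace v (net p (q - 1))) \<noteq> 0"
      using nd[of 1 "net (p + 1) q" "net p q" "net p (q - 1)"] \<Omega> p q by simp
    then show False using zero by (simp add: det3_def)
  qed
  have delta: "det3 (v (net p q)) (v (net (p + 1) q)) (v (net (p + 2) q)) \<noteq> 0"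
    if p: "p \<in> {0..<m - 1}" and q: "q \<in> {1..<m}" for p q
  proof -
    have "distinct [net p q, net (p + 1) q, net (p + 2) q]"
      using assms(1) by (auto simp: net_def algebra_simps)
    then show ?thesis
      using nd[of 0 "net p q" "net (p + 1) q" "net (p + 2) q"] \<Omega> p q by simp
  qed
  obtain e' where e': "row_relations w (m - 1) e'"
    and first: "\<And>p q. q \<in> {0..<m - 1} \<Longrightarrow>
      e p q = e' p q * lower_left w (net p q) + e' (p - 1) q * lower_right w (net (p - 1) q)"
    and second: "\<And>p q. q \<in> {1..<m} \<Longrightarrow> e p q = e' p (q - 1) * upper_left w (net p (q - 1)) +
      e' (p - 1) (q - 1) * upper_right w (net (p - 1) (q - 1))"
    using row_relations_step[OF Suc.prems(1)[folded m_def] m(1) Delta delta] unfolding w_def by blast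
  have supp: "e' p q = 0" if "p \<notin> {0..<m - 1}" for p q
    using e' that unfolding row_relations_def by blast
  have nd_w: "nondegenerate w \<Omega> n"
    unfolding nondegenerate_def w_def
    using nd[of "Suc _"] by (simp add: funpow_swap1)
  have \<Omega>': "net p q \<in> \<Omega>" if "p \<in> {0..int (Suc n)}" "q \<in> {0..int (Suc n)}" for p q
    using \<Omega> that m(2) by simp
  obtain r where
    r: "\<forall>j. (\<Sum>p\<in>{0..<m - 1}. e' p 0 * laplace w (net p 0) j) = r * (laplace ^^ Suc n) w 0 j"
    and r_nz: "\<forall>p\<in>{0..<m - 1}. \<forall>q\<in>{0..<m - 1}. e' p q \<noteq> 0 \<longrightarrow> r \<noteq> 0"
    using Suc.IH[OF e'[unfolded m(2)] nd_w \<Omega>', folded m(2)] by blast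
  have iter: "(laplace ^^ Suc (Suc n)) v = (laplace ^^ Suc n) w"
    unfolding w_def funpow_Suc_right[of "Suc n"] by simp
  have "(\<Sum>p\<in>{0..<m}. e p 0 * laplace v (net p 0) j) = r * (laplace ^^ Suc (Suc n)) v 0 j" for j
  proof -
    have "(\<Sum>p\<in>{0..<m}. e p 0 * w (net p 0) j) =
        (\<Sum>p\<in>{0..<m}. e' p 0 * lower_left w (net p 0) * w (net p 0) j) +
        (\<Sum>p\<in>{0..<m}. e' (p - 1) 0 * lower_right w (net (p - 1) 0) * w (net p 0) j)"
      using first[of 0] m(1) by (simp add: distrib_right sum.distrib)
    also have "(\<Sum>p\<in>{0..<m}. e' p 0 * lower_left w (net p 0) * w (net p 0) j) =
        (\<Sum>p\<in>{0..<m - 1}. e' p 0 * lower_left w (net p 0) * w (net p 0) j)"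
      by (rule sum.mono_neutral_right) (use supp in auto)
    also have "(\<Sum>p\<in>{0..<m}. e' (p - 1) 0 * lower_right w (net (p - 1) 0) * w (net p 0) j) =
        (\<Sum>p\<in>{-1..<m - 1}. e' p 0 * lower_right w (net p 0) * w (net (p + 1) 0) j)"
      by (rule sum.reindex_bij_witness[of _ "\<lambda>p. p + 1" "\<lambda>p. p - 1"]) auto
    also have "\<dots> = (\<Sum>p\<in>{0..<m - 1}. e' p 0 * lower_right w (net p 0) * w (net (p + 1) 0) j)"
      by (rule sum.mono_neutral_right) (use supp in auto)
    also have "(\<Sum>p\<in>{0..<m - 1}. e' p 0 * lower_left w (net p 0) * w (net p 0) j) + \<dots> =
        (\<Sum>p\<in>{0..<m - 1}. e' p 0 * laplace w (net p 0) j)"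
      unfolding laplace_first[of w] net_simps sum.distrib[symmetric] by (simp add: algebra_simps)
    also have "\<dots> = r * (laplace ^^ Suc (Suc n)) v 0 j"
      unfolding iter using r ..
    finally show ?thesis by (simp add: w_def)
  qed
  moreover have "r \<noteq> 0" if p: "p \<in> {0..<m}" and q: "q \<in> {0..<m}" and nz: "e p q \<noteq> 0" for p q
  proof (rule ccontr)
    assume "\<not> r \<noteq> 0"
    then have e'0: "e' p q = 0" if "q \<in> {0..<m - 1}" for p q
      using r_nz supp[of p q] that by blast
    show False
    proof (cases "q \<in> {0..<m - 1}")
      case True
      then show False using nz first[OF True, of p] e'0 by simp
    next
      case False
      then have "q \<in> {1..<m}" "q - 1 \<in> {0..<m - 1}" using q m(1) by auto
      then show False using nz second[of q p] e'0 by simp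
    qed
  qed
  ultimately show ?case unfolding m_def[symmetric] by blast
qed

end

section \<open>Tuples of small degree for equal-length maps\<close>

lemma meval_coefficients:
  "meval f (lower_left L k v s) = lower_left L k (\<lambda>s j. meval f (v s j)) s"
  "meval f (lower_right L k v s) = lower_right L k (\<lambda>s j. meval f (v s j)) s"
  "meval f (upper_left L k v s) = upper_left L k (\<lambda>s j. meval f (v s j)) s"
  "meval f (upper_right L k v s) = upper_right L k (\<lambda>s j. meval f (v s j)) s"
  by (simp_all add: lower_left_def lower_right_def upper_left_def upper_right_def meval_det3 meval.phom_uminus)

lemma meval_laplace_iterate:
  "meval f ((laplace L k ^^ m) v s j) = (laplace L k ^^ m) (\<lambda>s j. meval f (v s j)) s j"
  by (induction m arbitrary: s j) (simp_all add: laplace_def lattice_step_def meval_line_meet)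

lemma laplace_iterate_shift:
  "(laplace L k ^^ m) (\<lambda>s. v (s + t)) i = (laplace L k ^^ m) v (i + t)"
  by (induction m arbitrary: i) (simp_all add: laplace_def lattice_step_def add_ac)

lemma lattice_step_iterate_eq_laplace:
  "(lattice_step a (a + L) (a + k) (a + k + L) ^^ m) v i = (laplace L k ^^ m) v (i + int m * a)"
  by (induction m arbitrary: i) (simp_all add: laplace_def lattice_step_def algebra_simps)

lemma two_powi_eq_iff:
  "(2 :: complex) powi s = 2 powi t \<longleftrightarrow> s = t"
proof
  assume "(2 :: complex) powi s = 2 powi t"
  then have "norm ((2 :: complex) powi s) = norm ((2 :: complex) powi t)" by simp
  then have "(2 :: real) powi s = 2 powi t" by (simp add: norm_power_int)
  then have "(2 :: real) powr s = 2 powr t" by (simp add: powr_real_of_int')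
  then show "s = t" using powr_inj[of 2 "real_of_int s" "real_of_int t"] by simp
qed simp

text \<open>
  A torus orbit \<open>(x t\<^sup>-\<^sup>1, y, z t)\<close>, \<open>t = 2\<^sup>s\<close>, is mapped to a torus orbit. So the iterates of this configuration
  are explicitly known, and they lie on conics, where distinct points are independent. It witnesses
  that generic equal-length iterates are nondegenerate.
\<close>

lemma laplace_torus:
  fixes x y z :: complex
  assumes "L \<noteq> 0" "k \<noteq> 0" "x \<noteq> 0" "y \<noteq> 0" "z \<noteq> 0"
  shows "\<exists>x' y' z'. x' \<noteq> 0 \<and> y' \<noteq> 0 \<and> z' \<noteq> 0 \<and>
    laplace L k (\<lambda>s. vec3 (x / 2 powi s) y (z * 2 powi s)) = (\<lambda>s. vec3 (x' / 2 powi s) y' (z' * 2 powi s))"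
proof -
  define l \<kappa> :: complex where "l = 2 powi L" and "\<kappa> = 2 powi k"
  have ne: "l \<noteq> 0" "\<kappa> \<noteq> 0" by (simp_all add: l_def \<kappa>_def)
  have sq: "l * l = 2 powi (L + L)" "\<kappa> * \<kappa> = 2 powi (k + k)"
    unfolding l_def \<kappa>_def by (rule power_int_add[symmetric], simp)+
  have "l \<noteq> 1" "\<kappa> \<noteq> 1" "l * l \<noteq> 1" "\<kappa> * \<kappa> \<noteq> 1"
    unfolding sq using two_powi_eq_iff[of L 0] two_powi_eq_iff[of k 0] two_powi_eq_iff[of "L + L" 0]
      two_powi_eq_iff[of "k + k" 0] assms(1,2) by (simp_all add: l_def \<kappa>_def)
  then have ne1: "1 / l - l \<noteq> 0" "1 - 1 / l \<noteq> 0" "l - 1 \<noteq> 0" "1 / \<kappa> - 1 \<noteq> 0" "\<kappa> - 1 / \<kappa> \<noteq> 0" "1 - \<kappa> \<noteq> 0"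
    using ne by (simp_all add: field_simps)
  define x' y' z' where "x' = x * x * y * z * ((1 / l - l) * (1 - 1 / l) * (1 / \<kappa> - 1))"
    and "y' = x * y * y * z * ((1 - 1 / l) * (l - 1) * (\<kappa> - 1 / \<kappa>))"
    and "z' = x * y * z * z * ((l - 1) * (1 / l - l) * (1 - \<kappa>))"
  have "laplace L k (\<lambda>s. vec3 (x / 2 powi s) y (z * 2 powi s)) s = vec3 (x' / 2 powi s) y' (z' * 2 powi s)" for s
  proof -
    define a :: complex where "a = 2 powi s"
    have "a \<noteq> 0" by (simp add: a_def)
    have p: "2 powi (s + L) = a * l" "2 powi (s + k) = a * \<kappa>" "2 powi (s + (k + L)) = a * \<kappa> * l"
      by (simp_all add: a_def l_def \<kappa>_def power_int_add)
    show ?thesis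
      unfolding laplace_def lattice_step_def line_meet_def fun3_eq_iff cross_simps p x'_def y'_def z'_def a_def[symmetric] add_0_right
      using \<open>a \<noteq> 0\<close> ne by (simp add: field_simps)
  qed
  moreover have "x' \<noteq> 0" "y' \<noteq> 0" "z' \<noteq> 0"
    unfolding x'_def y'_def z'_def using assms(3-5) ne1 by simp_all
  ultimately show ?thesis by blast
qed

lemma laplace_iterate_torus:
  assumes "L \<noteq> 0" "k \<noteq> 0"
  shows "\<exists>x y z. x \<noteq> 0 \<and> y \<noteq> 0 \<and> z \<noteq> 0 \<and>
    (laplace L k ^^ m) (\<lambda>s. vec3 (1 / 2 powi s) 1 (2 powi s)) =
      (\<lambda>s. vec3 (x / 2 powi s) y (z * 2 powi s :: complex))"
proof (induction m)
  case 0
  show ?case by (intro exI[of _ 1]) simp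
next
  case (Suc m)
  then obtain x y z where "x \<noteq> 0" "y \<noteq> 0" "z \<noteq> 0" "(laplace L k ^^ m) (\<lambda>s. vec3 (1 / 2 powi s) 1 (2 powi s)) =
      (\<lambda>s. vec3 (x / 2 powi s) y (z * 2 powi s :: complex))" by blast
  then show ?case using laplace_torus[OF assms, of x y z] by simp
qed

lemma det3_torus_nonzero:
  fixes x y z :: complex
  assumes "x \<noteq> 0" "y \<noteq> 0" "z \<noteq> 0" "distinct [s, t, u]"
  shows "det3 (vec3 (x / 2 powi s) y (z * 2 powi s)) (vec3 (x / 2 powi t) y (z * 2 powi t))
    (vec3 (x / 2 powi u) y (z * 2 powi u)) \<noteq> 0"
proof -
  define a b c :: complex where "a = 2 powi s" and "b = 2 powi t" and "c = 2 powi u"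
  have nz: "a \<noteq> 0" "b \<noteq> 0" "c \<noteq> 0" by (simp_all add: a_def b_def c_def)
  have ne: "a \<noteq> b" "a \<noteq> c" "b \<noteq> c" using assms(4) two_powi_eq_iff unfolding a_def b_def c_def by auto
  have "det3 (vec3 (x / a) y (z * a)) (vec3 (x / b) y (z * b)) (vec3 (x / c) y (z * c)) =
      x * y * z * ((b - a) * (c - a) * (c - b)) / (a * b * c)"
    using nz by (simp add: det3_def cross_simps field_simps)
  then show ?thesis unfolding a_def[symmetric] b_def[symmetric] c_def[symmetric]
    using nz ne assms(1-3) by simp
qed

definition torus_point :: "int \<times> 3 \<Rightarrow> complex" where
  "torus_point x = vec3 (1 / 2 powi fst x) 1 (2 powi fst x) (snd x)"

lemma meval_torus_generic_point: "(\<lambda>s j. meval torus_point (generic_point s j)) = (\<lambda>s. vec3 (1 / 2 powi s) 1 (2 powi s))"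
  by (simp add: fun_eq_iff generic_point_def torus_point_def)

lemma det3_laplace_generic_point_nonzero:
  assumes "L \<noteq> 0" "k \<noteq> 0" "distinct [s, t, u]"
  shows "det3 ((laplace L k ^^ i) generic_point s) ((laplace L k ^^ i) generic_point t) ((laplace L k ^^ i) generic_point u) \<noteq> 0"
proof
  assume zero: "det3 ((laplace L k ^^ i) generic_point s) ((laplace L k ^^ i) generic_point t) ((laplace L k ^^ i) generic_point u) = 0"
  obtain x y z where xyz: "x \<noteq> 0" "y \<noteq> 0" "z \<noteq> 0" "(laplace L k ^^ i) (\<lambda>s. vec3 (1 / 2 powi s) 1 (2 powi s)) =
      (\<lambda>s. vec3 (x / 2 powi s) y (z * 2 powi s :: complex))" using laplace_iterate_torus[OF assms(1,2)] by blast
  from arg_cong[OF zero, of "meval torus_point"] show False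
    using det3_torus_nonzero[OF xyz(1-3) assms(3)]
    unfolding meval_det3 meval_laplace_iterate meval_torus_generic_point xyz(4) by simp
qed

lemma laplace_generic_point_nonzero:
  assumes "L \<noteq> 0" "k \<noteq> 0"
  shows "\<exists>j. (laplace L k ^^ i) generic_point s j \<noteq> 0"
proof (rule ccontr)
  assume "\<nexists>j. (laplace L k ^^ i) generic_point s j \<noteq> 0"
  then have "(laplace L k ^^ i) generic_point s = (\<lambda>_. 0)" by auto
  then show False using det3_laplace_generic_point_nonzero[OF assms, of s "s + 1" "s + 2" i] by simp
qed

lemma bounded_mpoly_cross:
  assumes "\<And>j. u j \<in> bounded_mpoly V m" "\<And>j. v j \<in> bounded_mpoly V n"
  shows "cross u v j \<in> bounded_mpoly V (m + n)"
proof -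
  have "u i * v l - u i' * v l' \<in> bounded_mpoly V (m + n)" for i l i' l'
    using bounded_mpoly_add[OF bounded_mpoly_mult bounded_mpoly_uminus[OF bounded_mpoly_mult]] assms
    by (metis diff_conv_add_uminus)
  then show ?thesis by (simp add: cross_def)
qed

lemma bounded_mpoly_line_meet:
  assumes "\<And>j. u j \<in> bounded_mpoly V 1" "\<And>j. v j \<in> bounded_mpoly V 1"
    "\<And>j. x j \<in> bounded_mpoly V 1" "\<And>j. y j \<in> bounded_mpoly V 1"
  shows "line_meet u v x y j \<in> bounded_mpoly V 4"
proof -
  have "cross u v i \<in> bounded_mpoly V (1 + 1)" "cross x y i \<in> bounded_mpoly V (1 + 1)" for i
    by (rule bounded_mpoly_cross, (rule assms)+)+
  then have "cross (cross u v) (cross x y) j \<in> bounded_mpoly V (1 + 1 + (1 + 1))"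
    by (rule bounded_mpoly_cross)
  moreover have "1 + 1 + (1 + 1) = (4 :: nat)" by simp
  ultimately show ?thesis by (simp only: line_meet_def)
qed

lemma bounded_mpoly_det3:
  assumes "\<And>j. u j \<in> bounded_mpoly V 1" "\<And>j. v j \<in> bounded_mpoly V 1" "\<And>j. w j \<in> bounded_mpoly V 1"
  shows "det3 u v w \<in> bounded_mpoly V 3"
proof -
  have "u j * cross v w j \<in> bounded_mpoly V (1 + (1 + 1))" for j
    by (intro bounded_mpoly_mult bounded_mpoly_cross assms)
  then show ?thesis unfolding det3_def by (simp add: bounded_mpoly_add numeral_3_eq_3)
qed

lemma bounded_mpoly_generic_point: "s \<in> S \<Longrightarrow> generic_point s j \<in> bounded_mpoly (S \<times> UNIV) 1"
  using homog_mvar[of "\<lambda>_. 1" "(s, j)"] by (simp add: bounded_mpoly_def generic_point_def homog_def)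

text \<open>
  The block of \<open>(m + 1) \<times> (m + 1)\<close> vertices is within the domain of dependence of the \<open>m\<close>-th iterate.
\<close>

lemma net_in_sites:
  assumes "p \<in> {0..int m}" "q \<in> {0..int m}"
  shows "net L k p q + int m * a \<in> sites {a, a + L, a + k, a + k + L} m"
  using assms
proof (induction m arbitrary: p q)
  case 0
  then show ?case by (simp add: net_def)
next
  case (Suc m)
  define p' q' where "p' = (if p = 0 then 0 else p - 1)" and "q' = (if q = 0 then 0 else q - 1)"
  have "p' \<in> {0..int m}" "q' \<in> {0..int m}" using Suc.prems by (auto simp: p'_def q'_def)
  from Suc.IH[OF this] have IH: "net L k p' q' + int m * a \<in> sites {a, a + L, a + k, a + k + L} m" .
  define e where "e = net L k p q + int (Suc m) * a - (net L k p' q' + int m * a)"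
  have "e \<in> {a, a + L, a + k, a + k + L}"
    by (auto simp: e_def p'_def q'_def net_def algebra_simps)
  moreover have "net L k p q + int (Suc m) * a = net L k p' q' + int m * a + e" by (simp add: e_def)
  ultimately show ?case unfolding sites.simps using IH by blast
qed

text \<open>
  Solve the row relations symbolically with \<open>small_kernel_vector\<close>: there are \<open>(n + 1)\<^sup>2\<close> multipliers and
  \<open>(n + 2) n\<close> vertices in the inner rows. At a generic complex point the solution specializes to one for
  which \<open>combination_is_iterated_laplace\<close> applies, and an identity that holds at generic points holds
  for polynomials.
\<close>

lemma small_tuple_parallel_to_iterate:
  fixes L k a :: int
  assumes nz: "L \<noteq> 0" "k \<noteq> 0" "L \<noteq> - k"
  defines "S \<equiv> {a, a + L, a + k, a + k + L}"
  obtains G where "\<And>j. G j \<in> bounded_mpoly (sites S (Suc n) \<times> UNIV) (3 * (Suc n)\<^sup>2 + 1)"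
    "\<exists>j. G j \<noteq> 0" "proportional G (generic_iterate a (a + L) (a + k) (a + k + L) (Suc n) 0)"
proof -
  define m where "m = int (Suc n)"
  have m: "m \<ge> 1" by (simp add: m_def)
  define V :: "(int \<times> 3) set" where "V = sites S (Suc n) \<times> UNIV"
  define v where "v s = generic_point (s + m * a)" for s
  have iter_v: "(laplace L k ^^ i) v s = (laplace L k ^^ i) generic_point (s + m * a)" for i s
    unfolding v_def by (rule laplace_iterate_shift)
  define R where "R = (laplace L k ^^ Suc n) v 0"
  have R: "generic_iterate a (a + L) (a + k) (a + k + L) (Suc n) 0 = R"
    unfolding generic_iterate_def R_def iter_v lattice_step_iterate_eq_laplace by (simp add: m_def)
  have generic_point_bound: "v (net L k p q) j \<in> bounded_mpoly V 1" if "p \<in> {0..m}" "q \<in> {0..m}" for p q j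
    using net_in_sites[of p "Suc n" q L k a] that unfolding V_def v_def S_def m_def
    by (intro bounded_mpoly_generic_point) blast
  note corner = net_simps[of L k]
  have coeff_bound: "lower_left L k v (net L k p q) \<in> bounded_mpoly V 3" "lower_right L k v (net L k p q) \<in> bounded_mpoly V 3"
    "upper_left L k v (net L k p q) \<in> bounded_mpoly V 3" "upper_right L k v (net L k p q) \<in> bounded_mpoly V 3"
    if "p \<in> {0..<m}" "q \<in> {0..<m}" for p q
    unfolding lower_left_def lower_right_def upper_left_def upper_right_def corner
    using that by (auto intro!: bounded_mpoly_det3 bounded_mpoly_uminus generic_point_bound)
  define I where "I = {0..m} \<times> {1..<m}"
  define J where "J = {0..<m} \<times> {0..<m}"
  have "card I < card J"
  proof -
    have "card I = (n + 2) * n" "card J = (n + 1) * (n + 1)"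
      by (simp_all add: I_def J_def m_def card_cartesian_product nat_add_distrib)
    then show ?thesis by simp
  qed
  have card_I: "card I * 3 + 4 \<le> 3 * (Suc n)\<^sup>2 + 1"
    by (simp add: I_def m_def card_cartesian_product nat_add_distrib power2_eq_square)
  \<comment> \<open>The coefficient matrix: row \<open>(p, q)\<close> is the vertex at which the coefficients are compared.\<close>
  define entry where "entry x j x' = (if x' = x then j else 0)" for x x' :: "int \<times> int" and j :: "3 mpoly"
  define c where "c i x = (case i of (p, q) \<Rightarrow>
      entry (p, q) (lower_left L k v (net L k p q)) x + entry (p - 1, q) (lower_right L k v (net L k (p - 1) q)) x
      - entry (p, q - 1) (upper_left L k v (net L k p (q - 1))) x - entry (p - 1, q - 1) (upper_right L k v (net L k (p - 1) (q - 1))) x)"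
    for i x
  have c_bound: "c i x \<in> bounded_mpoly V 3" if "i \<in> I" "x \<in> J" for i x
  proof -
    have entry_bound: "entry (p, q) g x \<in> bounded_mpoly V 3"
      if "p \<in> {0..<m} \<Longrightarrow> q \<in> {0..<m} \<Longrightarrow> g \<in> bounded_mpoly V 3" for p q g
      using that \<open>x \<in> J\<close> by (auto simp: entry_def J_def bounded_mpoly_zero)
    obtain p q where "i = (p, q)" by (cases i)
    then show ?thesis
      unfolding c_def prod.case diff_conv_add_uminus
      by (simp only: prod.case, intro bounded_mpoly_add bounded_mpoly_uminus entry_bound coeff_bound)
  qed
  obtain x where x_nz: "\<exists>j\<in>J. x j \<noteq> 0" and x_bound: "\<And>j. x j \<in> bounded_mpoly V (card I * 3)"
    and ker: "\<And>i. i \<in> I \<Longrightarrow> (\<Sum>j\<in>J. c i j * x j) = 0"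
    by (rule small_kernel_vector[of I J c V 3, OF _ _ \<open>card I < card J\<close> c_bound])
      (simp_all add: I_def J_def)
  define e where "e p q = (if (p, q) \<in> J then x (p, q) else 0)" for p q
  have entry_sum: "(\<Sum>y\<in>J. entry (p, q) g y * x y) = g * e p q" for p q g
  proof -
    have "(\<Sum>y\<in>J. entry (p, q) g y * x y) = (\<Sum>y\<in>J. if y = (p, q) then g * x y else 0)"
      by (rule sum.cong) (simp_all add: entry_def)
    also have "\<dots> = g * e p q" by (simp add: e_def J_def)
    finally show ?thesis .
  qed
  have rel: "row_relations L k v m e"
    unfolding row_relations_def
  proof (intro conjI allI impI ballI)
    fix p q assume "p \<notin> {0..<m}"
    then show "e p q = 0" by (auto simp: e_def J_def)
  next
    fix p q assume q: "q \<in> {1..<m}"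
    show "e p q * lower_left L k v (net L k p q) + e (p - 1) q * lower_right L k v (net L k (p - 1) q) =
        e p (q - 1) * upper_left L k v (net L k p (q - 1)) + e (p - 1) (q - 1) * upper_right L k v (net L k (p - 1) (q - 1))"
    proof (cases "p \<in> {0..m}")
      case True
      then have "(p, q) \<in> I" using q by (simp add: I_def)
      from ker[OF this] show ?thesis
        unfolding c_def prod.case left_diff_distrib distrib_right sum_subtractf sum.distrib entry_sum
        by (simp add: algebra_simps)
    next
      case False
      then have "(p, q') \<notin> J" "(p - 1, q') \<notin> J" for q' by (auto simp: J_def)
      then show ?thesis by (simp add: e_def)
    qed
  qed
  define G where "G j = (\<Sum>p\<in>{0..<m}. e p 0 * laplace L k v (net L k p 0) j)" for j
  have G_bound: "G j \<in> bounded_mpoly V (3 * (Suc n)\<^sup>2 + 1)" for j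
  proof -
    have "laplace L k v (net L k p 0) j \<in> bounded_mpoly V 4" if "p \<in> {0..<m}" for p
      unfolding laplace_def lattice_step_def add_0_right add.assoc[symmetric] corner
      using that m by (intro bounded_mpoly_line_meet generic_point_bound) auto
    then have "e p 0 * laplace L k v (net L k p 0) j \<in> bounded_mpoly V (card I * 3 + 4)"
      if "p \<in> {0..<m}" for p
      using that by (intro bounded_mpoly_mult) (simp_all add: e_def x_bound bounded_mpoly_zero)
    then have "G j \<in> bounded_mpoly V (card I * 3 + 4)"
      unfolding G_def by (intro bounded_mpoly_sum) blast
    then show ?thesis by (rule bounded_mpoly_mono) (use card_I in simp)
  qed
  define \<Omega> where "\<Omega> = (\<lambda>(p, q). net L k p q) ` ({0..m} \<times> {0..m})"
  define T where "T = {(i, s, t, u). i \<in> {..n} \<and> s \<in> \<Omega> \<and> t \<in> \<Omega> \<and> u \<in> \<Omega> \<and> distinct [s, t, u]}"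
  \<comment> \<open>Nonzero at a complex point exactly if the net with these values is nondegenerate.\<close>
  define N where "N = (\<Prod>(i, s, t, u)\<in>T. det3 ((laplace L k ^^ i) v s) ((laplace L k ^^ i) v t) ((laplace L k ^^ i) v u))"
  have "finite T"
    by (rule finite_subset[of _ "{..n} \<times> \<Omega> \<times> \<Omega> \<times> \<Omega>"]) (auto simp: T_def \<Omega>_def)
  have "N \<noteq> 0"
    unfolding N_def iter_v
    by (intro mpoly_prod_nonzero) (auto simp: T_def intro!: det3_laplace_generic_point_nonzero[OF nz(1,2)])
  have generic: "\<exists>r. (\<forall>j. meval f (G j) = r * meval f (R j)) \<and> (\<forall>p q. (p, q) \<in> J \<longrightarrow> meval f (e p q) \<noteq> 0 \<longrightarrow> r \<noteq> 0)"
    if f: "meval f N \<noteq> 0" for f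
  proof -
    define u where "u = (\<lambda>s j. meval f (v s j))"
    define E where "E p q = meval f (e p q)" for p q
    have iter_u: "(\<lambda>j. meval f ((laplace L k ^^ i) v s j)) = (laplace L k ^^ i) u s" for i s
      unfolding u_def meval_laplace_iterate ..
    have rel_u: "row_relations L k u (int (Suc n)) E"
      unfolding row_relations_def
    proof (intro conjI allI impI ballI)
      fix p q assume "p \<notin> {0..<int (Suc n)}"
      then show "E p q = 0" using rel unfolding row_relations_def E_def m_def by (simp add: meval.phom_zero)
    next
      fix p q assume "q \<in> {1..<int (Suc n)}"
      then have "e p q * lower_left L k v (net L k p q) + e (p - 1) q * lower_right L k v (net L k (p - 1) q) =
        e p (q - 1) * upper_left L k v (net L k p (q - 1)) + e (p - 1) (q - 1) * upper_right L k v (net L k (p - 1) (q - 1))"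
        using rel unfolding row_relations_def m_def by blast
      from arg_cong[OF this, of "meval f"]
      show "E p q * lower_left L k u (net L k p q) + E (p - 1) q * lower_right L k u (net L k (p - 1) q) =
        E p (q - 1) * upper_left L k u (net L k p (q - 1)) + E (p - 1) (q - 1) * upper_right L k u (net L k (p - 1) (q - 1))"
        by (simp add: meval.phom_add meval.phom_mult meval_coefficients E_def u_def)
    qed
    have nondeg_u: "nondegenerate L k u \<Omega> n"
      unfolding nondegenerate_def
    proof (intro allI impI ballI)
      fix i s t w assume *: "i \<le> n" "s \<in> \<Omega>" "t \<in> \<Omega>" "w \<in> \<Omega>" "distinct [s, t, w]"
      let ?d = "det3 ((laplace L k ^^ i) v s) ((laplace L k ^^ i) v t) ((laplace L k ^^ i) v w)"
      have "(i, s, t, w) \<in> T" using * by (simp add: T_def)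
      then have "?d dvd N" unfolding N_def using \<open>finite T\<close> by (auto intro: dvd_prodI[of T "(i, s, t, w)"])
      then have "meval f ?d \<noteq> 0" using f by (auto simp: dvd_def meval.phom_mult)
      then show "det3 ((laplace L k ^^ i) u s) ((laplace L k ^^ i) u t) ((laplace L k ^^ i) u w) \<noteq> 0"
        by (simp add: meval_det3 iter_u)
    qed
    have \<Omega>: "net L k p q \<in> \<Omega>" if "p \<in> {0..int (Suc n)}" "q \<in> {0..int (Suc n)}" for p q
      using that unfolding \<Omega>_def m_def by auto
    obtain r where r: "\<forall>j. (\<Sum>p\<in>{0..<int (Suc n)}. E p 0 * laplace L k u (net L k p 0) j) = r * (laplace L k ^^ Suc n) u 0 j"
      "\<forall>p\<in>{0..<int (Suc n)}. \<forall>q\<in>{0..<int (Suc n)}. E p q \<noteq> 0 \<longrightarrow> r \<noteq> 0"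
      using combination_is_iterated_laplace[OF nz rel_u nondeg_u \<Omega>] by blast
    have "meval f (G j) = r * meval f (R j)" for j
    proof -
      have "meval f (laplace L k v s j) = laplace L k u s j" for s j
        using fun_cong[OF iter_u[of 1 s], of j] by simp
      then have "meval f (G j) = (\<Sum>p\<in>{0..<int (Suc n)}. E p 0 * laplace L k u (net L k p 0) j)"
        by (simp add: G_def meval.phom_sum meval.phom_mult E_def m_def)
      moreover have "meval f (R j) = (laplace L k ^^ Suc n) u 0 j"
        unfolding R_def using fun_cong[OF iter_u[of "Suc n" 0], of j] .
      ultimately show ?thesis using r(1) by simp
    qed
    moreover have "r \<noteq> 0" if "(p, q) \<in> J" "meval f (e p q) \<noteq> 0" for p q
      using r(2) that unfolding J_def E_def m_def by blast
    ultimately show ?thesis by blast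
  qed
  have "proportional G R"
    unfolding proportional_def
  proof (intro allI, rule ccontr)
    fix i j assume "G i * R j \<noteq> G j * R i"
    then have "G i * R j - G j * R i \<noteq> 0" by simp
    from mpoly_mult_nonzero[OF \<open>N \<noteq> 0\<close> this] obtain f where "meval f (N * (G i * R j - G j * R i)) \<noteq> 0"
      by (rule meval_generic) blast
    then have "meval f N \<noteq> 0" "meval f (G i) * meval f (R j) \<noteq> meval f (G j) * meval f (R i)"
      by (auto simp: meval.phom_mult meval.phom_diff)
    with generic[of f] show False by auto
  qed
  moreover have "\<exists>j. G j \<noteq> 0"
  proof -
    obtain p q where pq: "(p, q) \<in> J" "x (p, q) \<noteq> 0" using x_nz by auto
    then have "e p q \<noteq> 0" by (simp add: e_def)
    obtain j where "R j \<noteq> 0"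
      unfolding R_def iter_v using laplace_generic_point_nonzero[OF nz(1,2)] by blast
    obtain f where "meval f (N * (e p q * R j)) \<noteq> 0"
      using meval_generic[OF mpoly_mult_nonzero[OF \<open>N \<noteq> 0\<close> mpoly_mult_nonzero[OF \<open>e p q \<noteq> 0\<close> \<open>R j \<noteq> 0\<close>]]] by blast
    then have "meval f N \<noteq> 0" "meval f (e p q) \<noteq> 0" "meval f (R j) \<noteq> 0"
      by (auto simp: meval.phom_mult)
    with generic[of f] pq(1) have "meval f (G j) \<noteq> 0" by auto
    then show ?thesis by (intro exI[of _ j]) auto
  qed
  ultimately show ?thesis using that[of G] G_bound unfolding R V_def by blast
qed

section \<open>Reduction of a proportional tuple\<close>

definition monomial_part :: "(((int \<times> 'n) \<Rightarrow>\<^sub>0 nat) \<Rightarrow> bool) \<Rightarrow> 'n mpoly \<Rightarrow> 'n mpoly" where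
  "monomial_part Q p = (\<Sum>m \<in> {m \<in> Poly_Mapping.keys p. Q m}. Poly_Mapping.single m (Poly_Mapping.lookup p m))"

lemma lookup_monomial_part: "Poly_Mapping.lookup (monomial_part Q p) m = (if Q m then Poly_Mapping.lookup p m else 0)"
  by (auto simp: monomial_part_def lookup_sum lookup_single when_def in_keys_iff)

lemma keys_monomial_part: "Poly_Mapping.keys (monomial_part Q p) = {m \<in> Poly_Mapping.keys p. Q m}"
  by (auto simp: in_keys_iff lookup_monomial_part split: if_splits)

lemma keys_nonempty: "p \<noteq> 0 \<Longrightarrow> \<exists>m. m \<in> Poly_Mapping.keys (p :: 'n mpoly)"
  by (metis in_keys_iff lookup_zero poly_mapping_eqI)

text \<open>
  The vanishing minors that express proportionality to a multihomogeneous tuple can be separated by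
  multidegree.
\<close>

lemma proportional_multihomogeneous_part:
  fixes G P :: "('n::finite) tuple" and \<epsilon> :: "int \<Rightarrow> nat"
  assumes same_map: "proportional G P" and P: "\<And>j. multihomogeneous \<delta> (P j)"
  defines "Q \<equiv> \<lambda>m. \<forall>i. weight (site_wt i) m = \<epsilon> i"
  shows "proportional (\<lambda>j. monomial_part Q (G j)) P"
  unfolding proportional_def
proof (intro allI)
  fix j k
  define H G' where "H = (\<lambda>j. monomial_part Q (G j))" and "G' j = G j - H j" for j
  have H: "homog (site_wt i) (\<epsilon> i) (H j)" for i j
    by (auto simp: homog_def H_def keys_monomial_part Q_def)
  have P': "homog (site_wt i) (\<delta> i) (P j)" for i j
    using P by (simp add: multihomogeneous_iff)
  have G': "\<not> Q m" if "m \<in> Poly_Mapping.keys (G' j)" for m j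
    using that by (auto simp: G'_def H_def in_keys_iff lookup_minus lookup_monomial_part)
  define X where "X = H j * P k - H k * P j"
  have X: "homog (site_wt i) (\<epsilon> i + \<delta> i) X" for i
    unfolding X_def by (intro homog_diff homog_mult H P')
  have X': "X = G' k * P j - G' j * P k"
    using same_map unfolding proportional_def X_def G'_def by (simp add: algebra_simps)
  have off: "\<exists>i. weight (site_wt i) m \<noteq> \<epsilon> i + \<delta> i" if "m \<in> Poly_Mapping.keys (G' j * P k)" for m j k
  proof -
    obtain l l' where l: "m = l + l'" "l \<in> Poly_Mapping.keys (G' j)" "l' \<in> Poly_Mapping.keys (P k)"
      using \<open>m \<in> _\<close> keys_mult[of "G' j" "P k"] by auto
    from G'[OF l(2)] obtain i where "weight (site_wt i) l \<noteq> \<epsilon> i" by (auto simp: Q_def)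
    then have "weight (site_wt i) m \<noteq> \<epsilon> i + \<delta> i"
      using P'[of i k] l by (simp add: homog_def weight_add)
    then show ?thesis ..
  qed
  have "m \<notin> Poly_Mapping.keys X" for m
  proof
    assume m: "m \<in> Poly_Mapping.keys X"
    then have "m \<in> Poly_Mapping.keys (G' k * P j) \<or> m \<in> Poly_Mapping.keys (G' j * P k)"
      unfolding X' by (auto simp: in_keys_iff lookup_minus)
    then have "\<exists>i. weight (site_wt i) m \<noteq> \<epsilon> i + \<delta> i" using off by blast
    with X m show False by (auto simp: homog_def)
  qed
  then have "X = 0" using keys_nonempty by blast
  then show "monomial_part Q (G j) * P k = monomial_part Q (G k) * P j" by (simp add: X_def H_def)
qed

text \<open>
  The competitors for a reduced tuple of the map given by \<open>P\<close>: everything that a local rule requires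
  except the absence of common factors.
\<close>

definition represents :: "int set \<Rightarrow> ('n::finite) tuple \<Rightarrow> nat \<Rightarrow> 'n tuple \<Rightarrow> bool" where
  "represents S P N H \<longleftrightarrow> (\<forall>j. mvars (H j) \<subseteq> S \<times> UNIV) \<and> (\<exists>\<delta>. \<forall>j. multihomogeneous \<delta> (H j)) \<and>
     (\<exists>j. H j \<noteq> 0) \<and> proportional H P \<and> (\<forall>j. homogeneous N (H j))"

lemma represents_part:
  fixes G P :: "('n::finite) tuple"
  assumes S: "finite S" and G: "\<And>j. G j \<in> bounded_mpoly (S \<times> UNIV) B" "\<exists>j. G j \<noteq> 0" "proportional G P"
    and P: "\<exists>\<delta>. \<forall>j. multihomogeneous \<delta> (P j)"
  obtains N H where "represents S P N H" "N \<le> B"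
proof -
  obtain \<delta> where \<delta>: "\<And>j. multihomogeneous \<delta> (P j)" using P by blast
  obtain j0 m0 where m0: "m0 \<in> Poly_Mapping.keys (G j0)" using G(2) keys_nonempty by blast
  \<comment> \<open>Keep the part of the tuple whose multidegree is that of some monomial occurring in it.\<close>
  define \<epsilon> where "\<epsilon> i = weight (site_wt i) m0" for i
  define Q where "Q m \<longleftrightarrow> (\<forall>i. weight (site_wt i) m = \<epsilon> i)" for m :: "(int \<times> 'n) \<Rightarrow>\<^sub>0 nat"
  define H where "H j = monomial_part Q (G j)" for j
  define N where "N = (\<Sum>i\<in>S. \<epsilon> i)"
  have sub: "Poly_Mapping.keys (H j) \<subseteq> Poly_Mapping.keys (G j)" for j
    by (auto simp: H_def keys_monomial_part)
  have vars: "mvars (H j) \<subseteq> S \<times> UNIV" for j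
    using sub[of j] G(1)[of j] by (fastforce simp: mvars_def bounded_mpoly_def)
  have multi: "multihomogeneous \<epsilon> (H j)" for j
    unfolding multihomogeneous_iff by (auto simp: homog_def H_def keys_monomial_part Q_def)
  have hom: "homogeneous N (H j)" for j
    unfolding N_def by (rule homogeneous_if_multihomogeneous[OF multi S vars])
  have m0': "m0 \<in> Poly_Mapping.keys (H j0)" using m0 by (simp add: H_def keys_monomial_part Q_def \<epsilon>_def)
  then have "H j0 \<noteq> 0" by auto
  moreover have "proportional H P"
    using proportional_multihomogeneous_part[OF G(3) \<delta>, of \<epsilon>] by (simp add: H_def[abs_def] Q_def[abs_def])
  ultimately have "represents S P N H"
    unfolding represents_def using vars multi hom by blast
  moreover have "N \<le> B"
    using hom[of j0] m0' m0 G(1)[of j0] by (auto simp: homog_def bounded_mpoly_def)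
  ultimately show ?thesis by (rule that)
qed

text \<open>
  The quotient by a nonconstant common factor would be a proportional tuple of smaller degree. It is
  again admissible since factors of multihomogeneous polynomials are multihomogeneous.
\<close>

lemma minimal_representation_reduced:
  fixes P :: "('n::finite) tuple"
  assumes S: "finite S" "S \<noteq> {}" and H: "represents S P N H"
    and min: "\<And>N' H'. represents S P N' H' \<Longrightarrow> N \<le> N'"
  shows "local_rule S H"
proof -
  have vars: "\<And>j. mvars (H j) \<subseteq> S \<times> UNIV" and nz: "\<exists>j. H j \<noteq> 0" and same_map: "proportional H P"
    and hom: "\<And>j. homogeneous N (H j)" and multi: "\<exists>\<delta>. \<forall>j. multihomogeneous \<delta> (H j)"
    using H unfolding represents_def by blast+
  have "no_common_factor H"
    unfolding no_common_factor_def
  proof (intro allI impI)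
    fix h assume "\<forall>j. h dvd H j"
    then have "\<forall>j. \<exists>q. H j = h * q" by (auto simp: dvd_def)
    then obtain q where q: "\<And>j. H j = h * q j" by metis
    obtain j0 where j0: "H j0 \<noteq> 0" using nz by blast
    then have h: "h \<noteq> 0" and q0: "q j0 \<noteq> 0" using q[of j0] by auto
    obtain \<delta> where \<delta>: "\<And>i j. homog (site_wt i) (\<delta> i) (H j)"
      using multi unfolding multihomogeneous_iff by blast
    have quotient: "\<exists>c. homog w c h \<and> c \<le> n \<and> (\<forall>j. homog w (n - c) (q j))"
      if w: "\<And>j. homog w n (H j)" for w n
    proof -
      obtain c where c: "homog w c h" "c \<le> n"
        using homog_factor[OF w[of j0, unfolded q] h q0] by (metis le_add1)
      have "homog w (n - c) (q j)" for j
      proof (cases "q j = 0")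
        case False
        obtain a b where ab: "homog w a h" "homog w b (q j)" "a + b = n"
          using homog_factor[OF w[of j, unfolded q] h False] by metis
        then have "a = c" using c(1) h homog_unique by metis
        then show ?thesis using ab by auto
      qed simp
      with c show ?thesis by blast
    qed
    obtain c where c: "homogeneous c h" "c \<le> N" "\<And>j. homogeneous (N - c) (q j)"
      using quotient[OF hom] by blast
    have "\<forall>i. \<exists>d. \<forall>j. homog (site_wt i) d (q j)" using quotient[OF \<delta>] by blast
    then obtain \<delta>' where \<delta>': "\<And>i j. homog (site_wt i) (\<delta>' i) (q j)" by metis
    have "mvars (q j) \<subseteq> S \<times> UNIV" for j
    proof (cases "q j = 0")
      case False
      then show ?thesis using mvars_factor[OF h, of "q j"] vars[of j] q[of j] by simp
    qed (simp add: mvars_def)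
    moreover have "proportional q P"
      unfolding proportional_def
    proof (intro allI)
      fix j k
      have "h * (q j * P k) = h * (q k * P j)"
        using same_map q unfolding proportional_def by (metis mult.assoc)
      then show "q j * P k = q k * P j" by (rule mpoly_mult_cancel_left[OF h])
    qed
    ultimately have "represents S P (N - c) q"
      unfolding represents_def multihomogeneous_iff using c(3) \<delta>' q0 by blast
    then have "N \<le> N - c" by (rule min)
    then have "c = 0 \<or> N = 0" by auto
    then have "c = 0" using c(2) by auto
    with c(1) h show "h dvd 1" by (simp add: mpoly_unit_if_const)
  qed
  then show ?thesis unfolding local_rule_def using S vars nz multi by blast
qed

lemma reduced_tuple_of_small_degree:
  fixes G P :: "('n::finite) tuple"
  assumes S: "finite S" "S \<noteq> {}"
    and G: "\<And>j. G j \<in> bounded_mpoly (S \<times> UNIV) B" "\<exists>j. G j \<noteq> 0" "proportional G P"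
    and P: "\<exists>\<delta>. \<forall>j. multihomogeneous \<delta> (P j)"
  obtains H N where "local_rule S H" "proportional H P" "\<And>j. homogeneous N (H j)" "N \<le> B"
proof -
  obtain N0 H0 where N0: "represents S P N0 H0" "N0 \<le> B" by (rule represents_part[OF S(1) G P])
  define N where "N = (LEAST N. \<exists>H. represents S P N H)"
  have "\<exists>H. represents S P N H" unfolding N_def by (rule LeastI[of _ N0], rule exI, rule N0(1))
  then obtain H where H: "represents S P N H" ..
  have min: "N \<le> N'" if "represents S P N' H'" for N' H'
    unfolding N_def by (rule Least_le, rule exI, rule that)
  have H': "proportional H P" "homogeneous N (H j)" for j
    using H by (simp_all add: represents_def)
  have "N \<le> B" using min[OF N0(1)] N0(2) by simp
  with minimal_representation_reduced[OF S H min] H' show ?thesis by (rule that)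
qed

section \<open>Equal-length maps\<close>

text \<open>
  A constant tuple would compose with one further step to \<open>(u \<times> u) \<times> (u \<times> u) = 0\<close>.
\<close>

lemma degree_positive:
  fixes H :: "3 tuple"
  assumes H: "local_rule S H" and same_map: "proportional H (generic_iterate a b c d m 0)"
    and hom: "\<And>j. homogeneous N (H j)"
    and nz: "\<And>m. \<exists>j. generic_iterate a b c d m 0 j \<noteq> 0"
  shows "N \<ge> 1"
proof (rule ccontr)
  assume "\<not> N \<ge> 1"
  then have "N = 0" by simp
  then have hom0: "homogeneous 0 (H j)" for j using hom[of j] by (simp only:)
  have const: "mshift e (H j) = H j" for e j
  proof -
    obtain x where "H j = mconst x" using homogeneous_0_const[OF hom0] by blast
    then show ?thesis by (simp add: mshift_def msubst_hom mconst_def)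
  qed
  have "rule_subst (skew_rule a b c d) H = (\<lambda>_. 0)"
    unfolding rule_subst_skew_rule const line_meet_def by simp
  moreover have "\<exists>j. H j \<noteq> 0" using H by (auto simp: local_rule_def)
  then obtain \<alpha> \<beta> where ab: "\<alpha> \<noteq> 0" "\<beta> \<noteq> 0"
    "\<And>j. \<alpha> * rule_subst (skew_rule a b c d) H j = \<beta> * generic_iterate a b c d (Suc m) 0 j"
    using rule_subst_common_multiple[OF same_map nz, of a b c d] unfolding rule_subst_generic_iterate by blast
  obtain j where "generic_iterate a b c d (Suc m) 0 j \<noteq> 0" using nz by blast
  then have "\<beta> * generic_iterate a b c d (Suc m) 0 j \<noteq> 0" by (rule mpoly_mult_nonzero[OF ab(2)])
  ultimately show False using ab(3)[of j] by simp
qed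

lemma root_quadratic_tendsto:
  assumes "\<And>m. 1 \<le> D m" "\<And>m. D m \<le> 3 * m\<^sup>2 + (1 :: nat)"
  shows "(\<lambda>m. root m (real (D m))) \<longlonglongrightarrow> 1"
proof (rule tendsto_sandwich[of "\<lambda>_. 1"])
  show "eventually (\<lambda>m. 1 \<le> root m (real (D m))) sequentially"
    using eventually_gt_at_top[of 0] by eventually_elim (use assms(1) in simp)
  show "eventually (\<lambda>m. root m (real (D m)) \<le> root m 4 * (root m (real m) * root m (real m))) sequentially"
    using eventually_gt_at_top[of 0]
  proof eventually_elim
    case (elim m)
    have "1 \<le> m * m" using elim by (metis Suc_leI One_nat_def nat_0_less_mult_iff)
    then have "D m \<le> 4 * (m * m)" using assms(2)[of m] unfolding power2_eq_square by linarith
    then have "real (D m) \<le> 4 * (real m * real m)" by (metis of_nat_le_iff of_nat_mult of_nat_numeral)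
    then have "root m (real (D m)) \<le> root m (4 * (real m * real m))" using elim by simp
    then show ?case by (simp add: real_root_mult)
  qed
  have "(\<lambda>m. root m 4 * (root m (real m) * root m (real m))) \<longlonglongrightarrow> 1 * (1 * 1)"
    by (intro tendsto_mult LIMSEQ_root LIMSEQ_root_const) simp
  then show "(\<lambda>m. root m 4 * (root m (real m) * root m (real m))) \<longlonglongrightarrow> 1" by simp
qed simp

lemma dynamical_degree_1:
  assumes dist: "distinct [a, a + L, a + k, a + k + L]"
  shows "has_dynamical_degree (skew_pentagram a (a + L) (a + k) (a + k + L)) 1"
proof -
  define S where "S = {a, a + L, a + k, a + k + L}"
  define P where "P m = generic_iterate a (a + L) (a + k) (a + k + L) m 0" for m
  have ne: "L \<noteq> 0" "k \<noteq> 0" "L \<noteq> - k" using dist by auto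
  have sites: "finite (sites S m)" "sites S m \<noteq> {}" for m
    by (simp_all add: S_def finite_sites sites_nonempty)
  have P_nz: "\<exists>j. P m j \<noteq> 0" for m
    unfolding P_def generic_iterate_def lattice_step_iterate_eq_laplace by (rule laplace_generic_point_nonzero[OF ne(1,2)])
  have "\<exists>H N. local_rule (sites S m) H \<and> proportional H (P m) \<and> (\<forall>j. homogeneous N (H j)) \<and>
      N \<le> 3 * m\<^sup>2 + 1 \<and> (m = 0 \<longrightarrow> H = generic_point 0)" for m
  proof (cases m)
    case 0
    have "homogeneous 1 (generic_point 0 j)" for j using generic_iterate_homogeneous[of 0 a a a a 0 j] by simp
    then show ?thesis using local_rule_generic_point 0
      by (intro exI[of _ "generic_point 0"] exI[of _ 1]) (simp add: P_def proportional_def mult.commute)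
  next
    case (Suc n)
    obtain G where G: "\<And>j. G j \<in> bounded_mpoly (sites S m \<times> UNIV) (3 * m\<^sup>2 + 1)" "\<exists>j. G j \<noteq> 0"
      "proportional G (P m)"
      using small_tuple_parallel_to_iterate[OF ne, where a = a and n = n] unfolding P_def S_def Suc by blast
    obtain H N where "local_rule (sites S m) H" "proportional H (P m)" "\<And>j. homogeneous N (H j)"
      "N \<le> 3 * m\<^sup>2 + 1"
      using reduced_tuple_of_small_degree[OF sites G] generic_iterate_multihomogeneous unfolding P_def by blast
    then show ?thesis using Suc by blast
  qed
  then obtain H N where HN: "\<And>m. local_rule (sites S m) (H m)" "\<And>m. proportional (H m) (P m)"
    "\<And>m j. homogeneous (N m) (H m j)" "\<And>m. N m \<le> 3 * m\<^sup>2 + 1" "H 0 = generic_point 0"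
    by metis
  have "1 \<le> N m" for m
    by (rule degree_positive[OF HN(1) HN(2)[unfolded P_def] HN(3) P_nz[unfolded P_def]])
  then have lim: "(\<lambda>m. root m (real (N m))) \<longlonglongrightarrow> 1"
    using HN(4) by (rule root_quadratic_tendsto)
  show ?thesis
    by (rule has_dynamical_degree_if_reduced_tuples[OF local_rule_skew_rule[OF dist] HN(5)
          HN(1)[unfolded S_def] HN(2)[unfolded P_def] P_nz[unfolded P_def] mdegree_homogeneous[OF HN(3)] lim])
qed

lemma skew_pentagram_commute: "skew_pentagram a b c d = skew_pentagram a b d c"
proof -
  have line: "line (v (i + d)) (v (i + c)) = line (v (i + c)) (v (i + d))" for v :: "int \<Rightarrow> 3 proj" and i
    by (simp add: line_def Un_commute)
  have neq: "v (i + d) \<noteq> v (i + c) \<longleftrightarrow> v (i + c) \<noteq> v (i + d)" for v :: "int \<Rightarrow> 3 proj" and i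
    by auto
  show ?thesis
    unfolding fun_eq_iff skew_pentagram_def[of a b d c] skew_pentagram_def[of a b c d] line neq by blast
qed

theorem theorem1p3:
  shows "(\<forall>a b c d :: int. distinct [a, b, c, d] \<and> \<bar>b - a\<bar> = \<bar>d - c\<bar> \<longrightarrow>
            has_dynamical_degree (skew_pentagram a b c d) 1)
       \<and> infinite {T. \<exists>a b c d :: int. distinct [a, b, c, d] \<and> \<bar>b - a\<bar> \<noteq> \<bar>d - c\<bar> \<and>
            T = skew_pentagram a b c d \<and> has_dynamical_degree T 4}"
proof (intro conjI allI impI)
  fix a b c d :: int
  assume *: "distinct [a, b, c, d] \<and> \<bar>b - a\<bar> = \<bar>d - c\<bar>"
  then consider "d = a + (c - a) + (b - a)" | "c = a + (d - a) + (b - a)" by linarith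
  then show "has_dynamical_degree (skew_pentagram a b c d) 1"
  proof cases
    case 1
    then show ?thesis using dynamical_degree_1[of a "b - a" "c - a"] * by simp
  next
    case 2
    then have "has_dynamical_degree (skew_pentagram a b d c) 1"
      using dynamical_degree_1[of a "b - a" "d - a"] * by auto
    then show ?thesis by (simp only: skew_pentagram_commute[of a b c d])
  qed
next
  show "infinite {T. \<exists>a b c d :: int. distinct [a, b, c, d] \<and> \<bar>b - a\<bar> \<noteq> \<bar>d - c\<bar> \<and>
            T = skew_pentagram a b c d \<and> has_dynamical_degree T 4}"
    by (rule infinitely_many_of_degree_4)
qed

end
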